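(* Let $R$ be a unital commutative ring, $D$ a unital superdialgebra over $R$, and $m,n$ non-negative integers with $m+n\geq 5$. Then there is an isomorphism of Leibniz superalgebras $$\mathfrak{stl}(m,n,D)\otimes\mathfrak{stl}(m,n,D)\cong\mathfrak{stl}(m,n,D),$$ where $\otimes$ denotes the non-abelian tensor product of Leibniz superalgebras.
   Context: $R$ is a fixed unital commutative ring; $|x|\in\mathbb{Z}_2$ denotes the degree of a homogeneous element, and formulas involving degrees are for homogeneous elements and extended linearly. A superdialgebra $D=D_{\bar 0}\oplus D_{\bar 1}$ is a $\mathbb{Z}_2$-graded $R$-module with two associative $R$-linear operations $\vdash,\dashv\colon D\otimes_R D\to D$, compatible with the grading ($D_{\bar\alpha}\vdash D_{\bar\beta}\subseteq D_{\bar\alpha+\bar\beta}$ and likewise for $\dashv$), such that $a\dashv(b\dashv c)=a\dashv(b\vdash c)$, $(a\vdash b)\dashv c=a\vdash(b\dashv c)$, $(a\dashv b)\vdash c=(a\vdash b)\vdash c$. It is unital if it has a chosen bar-unit, i.e. an (even) element $1$ with $a\dashv 1=a=1\vdash a$ for all $a\in D$. A Leibniz superalgebra $L$ is an $R$-supermodule with an even $R$-linear map $[-,-]\colon L\otimes_R L\to L$ satisfying $[x,[y,z]]=[[x,y],z]-(-1)^{|y||z|}[[x,z],y]$. It is perfect if it equals the ideal $[L,L]$ generated by all brackets. For $L$ perfect, the non-abelian tensor product $L\otimes L$ is the quotient of $L\otimes_R L$ by the $R$-submodule generated by the elements $-[x,y]\otimes z+x\otimes[y,z]+(-1)^{|y||z|}[x,z]\otimes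 y$, with bracket $[x\otimes y,x'\otimes y']=[x,y]\otimes[x',y']$. For $m+n\geq3$, put $|i|=\bar 0$ for $1\le i\le m$ and $|i|=\bar 1$ for $m+1\le i\le m+n$. The Steinberg Leibniz superalgebra $\mathfrak{stl}(m,n,D)$ is the Leibniz superalgebra over $R$ generated by elements $F_{ij}(a)$, $a\in D_{\bar 0}\cup D_{\bar 1}$, $1\le i\ne j\le m+n$, of degree $|F_{ij}(a)|=|i|+|j|+|a|$, subject to: $a\mapsto F_{ij}(a)$ is $R$-linear; $[F_{ij}(a),F_{kl}(b)]=F_{il}(a\dashv b)$ if $i\ne l$ and $j=k$; $[F_{ij}(a),F_{kl}(b)]=-(-1)^{|F_{ij}(a)||F_{kl}(b)|}F_{kj}(b\vdash a)$ if $i=l$ and $j\neq k$; $[F_{ij}(a),F_{kl}(b)]=0$ if $i\ne l$ and $j\ne k$. It is a perfect Leibniz superalgebra. *)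

theory Defs
  imports "HOL-Algebra.Module" "HOL-Algebra.AbelCoset" "HOL-Library.Z2" "HOL.Hull"
begin

section \<open>Supermodules, superdialgebras and Leibniz superalgebras\<close>

text \<open>
  All structures are carrier-based modules in the sense of HOL-Algebra. The fields \<open>mult\<close> and
  \<open>one\<close> that the record type of modules inherits from rings play no role. Degrees live in
  the type \<^typ>\<open>bit\<close>, so addition and multiplication of degrees are those of the integers modulo 2.
\<close>

record ('r, 'a) supermodule = "('r, 'a) module" +
  hpart :: "bit \<Rightarrow> 'a set"

locale supermodule = module R M for R (structure) and M (structure) +
  assumes hpart_submodule: "submodule (hpart M p) R M"
    and hpart_direct_sum: "x \<in> carrier M \<Longrightarrow>
      \<exists>!z. z \<in> hpart M 0 \<times> hpart M 1 \<and> x = fst z \<oplus>\<^bsub>M\<^esub> snd z"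

text \<open>The scalar \<open>(-1)^p\<close>.\<close>

definition sgn_pow :: "('r, 'rm) ring_scheme \<Rightarrow> bit \<Rightarrow> 'r" where
  "sgn_pow R p = (if p = 0 then \<one>\<^bsub>R\<^esub> else \<ominus>\<^bsub>R\<^esub> \<one>\<^bsub>R\<^esub>)"

definition bilinear_map ::
  "('r, 'rm) ring_scheme \<Rightarrow> ('r, 'a, 'am) module_scheme \<Rightarrow> ('r, 'b, 'bm) module_scheme \<Rightarrow>
   ('r, 'c, 'cm) module_scheme \<Rightarrow> ('a \<Rightarrow> 'b \<Rightarrow> 'c) \<Rightarrow> bool" where
  "bilinear_map R M N P f \<longleftrightarrow>
     (\<forall>x\<in>carrier M. \<forall>y\<in>carrier N. f x y \<in> carrier P) \<and>
     (\<forall>x\<in>carrier M. \<forall>x'\<in>carrier M. \<forall>y\<in>carrier N. f (x \<oplus>\<^bsub>M\<^esub> x') y = f x y \<oplus>\<^bsub>P\<^esub> f x' y) \<and>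
     (\<forall>x\<in>carrier M. \<forall>y\<in>carrier N. \<forall>y'\<in>carrier N. f x (y \<oplus>\<^bsub>N\<^esub> y') = f x y \<oplus>\<^bsub>P\<^esub> f x y') \<and>
     (\<forall>r\<in>carrier R. \<forall>x\<in>carrier M. \<forall>y\<in>carrier N. f (r \<odot>\<^bsub>M\<^esub> x) y = r \<odot>\<^bsub>P\<^esub> f x y) \<and>
     (\<forall>r\<in>carrier R. \<forall>x\<in>carrier M. \<forall>y\<in>carrier N. f x (r \<odot>\<^bsub>N\<^esub> y) = r \<odot>\<^bsub>P\<^esub> f x y)"

record ('r, 'd) superdialgebra = "('r, 'd) supermodule" +
  lprod :: "'d \<Rightarrow> 'd \<Rightarrow> 'd" (infixl "\<turnstile>\<index>" 70)
  rprod :: "'d \<Rightarrow> 'd \<Rightarrow> 'd" (infixl "\<stileturn>\<index>" 70)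

locale superdialgebra = supermodule R D for R (structure) and D (structure) +
  assumes lprod_bilinear: "bilinear_map R D D D (lprod D)"
    and rprod_bilinear: "bilinear_map R D D D (rprod D)"
    and lprod_hpart: "\<lbrakk>a \<in> hpart D \<alpha>; b \<in> hpart D \<beta>\<rbrakk> \<Longrightarrow> a \<turnstile>\<^bsub>D\<^esub> b \<in> hpart D (\<alpha> + \<beta>)"
    and rprod_hpart: "\<lbrakk>a \<in> hpart D \<alpha>; b \<in> hpart D \<beta>\<rbrakk> \<Longrightarrow> a \<stileturn>\<^bsub>D\<^esub> b \<in> hpart D (\<alpha> + \<beta>)"
    and lprod_assoc: "\<lbrakk>a \<in> carrier D; b \<in> carrier D; c \<in> carrier D\<rbrakk> \<Longrightarrow>
      (a \<turnstile>\<^bsub>D\<^esub> b) \<turnstile>\<^bsub>D\<^esub> c = a \<turnstile>\<^bsub>D\<^esub> (b \<turnstile>\<^bsub>D\<^esub> c)"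
    and rprod_assoc: "\<lbrakk>a \<in> carrier D; b \<in> carrier D; c \<in> carrier D\<rbrakk> \<Longrightarrow>
      (a \<stileturn>\<^bsub>D\<^esub> b) \<stileturn>\<^bsub>D\<^esub> c = a \<stileturn>\<^bsub>D\<^esub> (b \<stileturn>\<^bsub>D\<^esub> c)"
    and rprod_rprod: "\<lbrakk>a \<in> carrier D; b \<in> carrier D; c \<in> carrier D\<rbrakk> \<Longrightarrow>
      a \<stileturn>\<^bsub>D\<^esub> (b \<stileturn>\<^bsub>D\<^esub> c) = a \<stileturn>\<^bsub>D\<^esub> (b \<turnstile>\<^bsub>D\<^esub> c)"
    and lprod_rprod: "\<lbrakk>a \<in> carrier D; b \<in> carrier D; c \<in> carrier D\<rbrakk> \<Longrightarrow>
      (a \<turnstile>\<^bsub>D\<^esub> b) \<stileturn>\<^bsub>D\<^esub> c = a \<turnstile>\<^bsub>D\<^esub> (b \<stileturn>\<^bsub>D\<^esub> c)"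
    and lprod_lprod: "\<lbrakk>a \<in> carrier D; b \<in> carrier D; c \<in> carrier D\<rbrakk> \<Longrightarrow>
      (a \<stileturn>\<^bsub>D\<^esub> b) \<turnstile>\<^bsub>D\<^esub> c = (a \<turnstile>\<^bsub>D\<^esub> b) \<turnstile>\<^bsub>D\<^esub> c"

locale unital_superdialgebra = superdialgebra R D for R (structure) and D (structure) and e +
  assumes bar_unit_even: "e \<in> hpart D 0"
    and bar_unit_right: "a \<in> carrier D \<Longrightarrow> a \<stileturn>\<^bsub>D\<^esub> e = a"
    and bar_unit_left: "a \<in> carrier D \<Longrightarrow> e \<turnstile>\<^bsub>D\<^esub> a = a"

record ('r, 'a) superalgebra = "('r, 'a) supermodule" +
  bracket :: "'a \<Rightarrow> 'a \<Rightarrow> 'a"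

locale leibniz_superalgebra = supermodule R L for R (structure) and L (structure) +
  assumes bracket_bilinear: "bilinear_map R L L L (bracket L)"
    and bracket_hpart: "\<lbrakk>x \<in> hpart L \<alpha>; y \<in> hpart L \<beta>\<rbrakk> \<Longrightarrow> bracket L x y \<in> hpart L (\<alpha> + \<beta>)"
    and leibniz: "\<lbrakk>x \<in> hpart L \<alpha>; y \<in> hpart L \<beta>; z \<in> hpart L \<gamma>\<rbrakk> \<Longrightarrow>
      bracket L x (bracket L y z) =
        bracket L (bracket L x y) z \<ominus>\<^bsub>L\<^esub> sgn_pow R (\<beta> * \<gamma>) \<odot>\<^bsub>L\<^esub> bracket L (bracket L x z) y"

definition leibniz_iso ::
  "('r, 'rm) ring_scheme \<Rightarrow> ('r, 'a, 'am) superalgebra_scheme \<Rightarrow>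
   ('r, 'b, 'bm) superalgebra_scheme \<Rightarrow> ('a \<Rightarrow> 'b) \<Rightarrow> bool" where
  "leibniz_iso R L L' f \<longleftrightarrow>
     leibniz_superalgebra R L \<and> leibniz_superalgebra R L' \<and>
     bij_betw f (carrier L) (carrier L') \<and>
     (\<forall>x\<in>carrier L. \<forall>y\<in>carrier L. f (x \<oplus>\<^bsub>L\<^esub> y) = f x \<oplus>\<^bsub>L'\<^esub> f y) \<and>
     (\<forall>r\<in>carrier R. \<forall>x\<in>carrier L. f (r \<odot>\<^bsub>L\<^esub> x) = r \<odot>\<^bsub>L'\<^esub> f x) \<and>
     (\<forall>p. f ` hpart L p \<subseteq> hpart L' p) \<and>
     (\<forall>x\<in>carrier L. \<forall>y\<in>carrier L. f (bracket L x y) = bracket L' (f x) (f y))"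


section \<open>Free modules, quotients and tensor products\<close>

definition free_module :: "('r, 'rm) ring_scheme \<Rightarrow> 'x set \<Rightarrow> ('r, 'x \<Rightarrow> 'r) module" where
  "free_module R X =
     \<lparr>carrier = {f. (\<forall>x\<in>X. f x \<in> carrier R) \<and> (\<forall>x. x \<notin> X \<longrightarrow> f x = \<zero>\<^bsub>R\<^esub>) \<and> finite {x. f x \<noteq> \<zero>\<^bsub>R\<^esub>}},
      mult = undefined, one = undefined,
      zero = (\<lambda>x. \<zero>\<^bsub>R\<^esub>), add = (\<lambda>f g x. f x \<oplus>\<^bsub>R\<^esub> g x),
      smult = (\<lambda>r f x. r \<otimes>\<^bsub>R\<^esub> f x)\<rparr>"

definition basis_vec :: "('r, 'rm) ring_scheme \<Rightarrow> 'x \<Rightarrow> 'x \<Rightarrow> 'r" where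
  "basis_vec R x = (\<lambda>y. if y = x then \<one>\<^bsub>R\<^esub> else \<zero>\<^bsub>R\<^esub>)"

definition submodule_generated ::
  "('r, 'rm) ring_scheme \<Rightarrow> ('r, 'a, 'am) module_scheme \<Rightarrow> 'a set \<Rightarrow> 'a set" where
  "submodule_generated R M S = (\<lambda>N. submodule N R M) hull S"

definition quot_module :: "('r, 'a, 'am) module_scheme \<Rightarrow> 'a set \<Rightarrow> ('r, 'a set) module" where
  "quot_module M N =
     \<lparr>carrier = a_rcosets\<^bsub>M\<^esub> N,
      mult = undefined, one = undefined,
      zero = N, add = set_add M,
      smult = (\<lambda>r U. \<Union>u\<in>U. N +>\<^bsub>M\<^esub> (r \<odot>\<^bsub>M\<^esub> u))\<rparr>"

definition quot_supermodule ::
  "('r, 'a, 'am) supermodule_scheme \<Rightarrow> 'a set \<Rightarrow> ('r, 'a set) supermodule" where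
  "quot_supermodule M N =
     module.extend (quot_module M N)
       (supermodule.fields (\<lambda>p. (\<lambda>x. N +>\<^bsub>M\<^esub> x) ` hpart M p))"

definition quot_superalgebra ::
  "('r, 'a, 'am) superalgebra_scheme \<Rightarrow> 'a set \<Rightarrow> ('r, 'a set) superalgebra" where
  "quot_superalgebra L I =
     supermodule.extend (quot_supermodule L I)
       (superalgebra.fields (\<lambda>U V. \<Union>u\<in>U. \<Union>v\<in>V. I +>\<^bsub>L\<^esub> (bracket L u v)))"

definition tensor_relators ::
  "('r, 'rm) ring_scheme \<Rightarrow> ('r, 'a, 'am) module_scheme \<Rightarrow> ('r, 'b, 'bm) module_scheme \<Rightarrow>
   ('a \<times> 'b \<Rightarrow> 'r) set" where
  "tensor_relators R M N =
    (let E = free_module R (carrier M \<times> carrier N); d = (\<lambda>x y. basis_vec R (x, y)) in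
     {d (x \<oplus>\<^bsub>M\<^esub> x') y \<ominus>\<^bsub>E\<^esub> (d x y \<oplus>\<^bsub>E\<^esub> d x' y) | x x' y.
        x \<in> carrier M \<and> x' \<in> carrier M \<and> y \<in> carrier N} \<union>
     {d x (y \<oplus>\<^bsub>N\<^esub> y') \<ominus>\<^bsub>E\<^esub> (d x y \<oplus>\<^bsub>E\<^esub> d x y') | x y y'.
        x \<in> carrier M \<and> y \<in> carrier N \<and> y' \<in> carrier N} \<union>
     {d (r \<odot>\<^bsub>M\<^esub> x) y \<ominus>\<^bsub>E\<^esub> r \<odot>\<^bsub>E\<^esub> d x y | r x y.
        r \<in> carrier R \<and> x \<in> carrier M \<and> y \<in> carrier N} \<union>
     {d x (r \<odot>\<^bsub>N\<^esub> y) \<ominus>\<^bsub>E\<^esub> r \<odot>\<^bsub>E\<^esub> d x y | r x y.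
        r \<in> carrier R \<and> x \<in> carrier M \<and> y \<in> carrier N})"

definition tensor_null ::
  "('r, 'rm) ring_scheme \<Rightarrow> ('r, 'a, 'am) module_scheme \<Rightarrow> ('r, 'b, 'bm) module_scheme \<Rightarrow>
   ('a \<times> 'b \<Rightarrow> 'r) set" where
  "tensor_null R M N =
     submodule_generated R (free_module R (carrier M \<times> carrier N)) (tensor_relators R M N)"

definition tensor_module ::
  "('r, 'rm) ring_scheme \<Rightarrow> ('r, 'a, 'am) module_scheme \<Rightarrow> ('r, 'b, 'bm) module_scheme \<Rightarrow>
   ('r, ('a \<times> 'b \<Rightarrow> 'r) set) module" where
  "tensor_module R M N =
     quot_module (free_module R (carrier M \<times> carrier N)) (tensor_null R M N)"

definition pure_tensor ::
  "('r, 'rm) ring_scheme \<Rightarrow> ('r, 'a, 'am) module_scheme \<Rightarrow> ('r, 'b, 'bm) module_scheme \<Rightarrow>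
   'a \<Rightarrow> 'b \<Rightarrow> ('a \<times> 'b \<Rightarrow> 'r) set" where
  "pure_tensor R M N x y =
     tensor_null R M N +>\<^bsub>free_module R (carrier M \<times> carrier N)\<^esub> basis_vec R (x, y)"

text \<open>The tensor product over \<open>R\<close> of supermodules, with the total grading.\<close>

definition tensor_supermodule ::
  "('r, 'rm) ring_scheme \<Rightarrow> ('r, 'a, 'am) supermodule_scheme \<Rightarrow>
   ('r, 'b, 'bm) supermodule_scheme \<Rightarrow> ('r, ('a \<times> 'b \<Rightarrow> 'r) set) supermodule" where
  "tensor_supermodule R M N =
     module.extend (tensor_module R M N)
       (supermodule.fields (\<lambda>p. submodule_generated R (tensor_module R M N)
          {pure_tensor R M N x y | x y \<alpha> \<beta>. x \<in> hpart M \<alpha> \<and> y \<in> hpart N \<beta> \<and> \<alpha> + \<beta> = p}))"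


section \<open>The non-abelian tensor square of a perfect Leibniz superalgebra\<close>

definition nonabelian_relators ::
  "('r, 'rm) ring_scheme \<Rightarrow> ('r, 'a, 'am) superalgebra_scheme \<Rightarrow> ('a \<times> 'a \<Rightarrow> 'r) set set" where
  "nonabelian_relators R L =
    (let T = tensor_supermodule R L L; t = pure_tensor R L L in
     {\<ominus>\<^bsub>T\<^esub> t (bracket L x y) z \<oplus>\<^bsub>T\<^esub> t x (bracket L y z)
        \<oplus>\<^bsub>T\<^esub> sgn_pow R (\<beta> * \<gamma>) \<odot>\<^bsub>T\<^esub> t (bracket L x z) y | x y z \<alpha> \<beta> \<gamma>.
        x \<in> hpart L \<alpha> \<and> y \<in> hpart L \<beta> \<and> z \<in> hpart L \<gamma>})"

definition nonabelian_null ::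
  "('r, 'rm) ring_scheme \<Rightarrow> ('r, 'a, 'am) superalgebra_scheme \<Rightarrow> ('a \<times> 'a \<Rightarrow> 'r) set set" where
  "nonabelian_null R L =
     submodule_generated R (tensor_supermodule R L L) (nonabelian_relators R L)"

definition nonabelian_supermodule ::
  "('r, 'rm) ring_scheme \<Rightarrow> ('r, 'a, 'am) superalgebra_scheme \<Rightarrow>
   ('r, ('a \<times> 'a \<Rightarrow> 'r) set set) supermodule" where
  "nonabelian_supermodule R L = quot_supermodule (tensor_supermodule R L L) (nonabelian_null R L)"

definition nonabelian_pure ::
  "('r, 'rm) ring_scheme \<Rightarrow> ('r, 'a, 'am) superalgebra_scheme \<Rightarrow> 'a \<Rightarrow> 'a \<Rightarrow>
   ('a \<times> 'a \<Rightarrow> 'r) set set" where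
  "nonabelian_pure R L x y =
     nonabelian_null R L +>\<^bsub>tensor_supermodule R L L\<^esub> pure_tensor R L L x y"

text \<open>
  The bracket is the bilinear map with the prescribed values on pure tensors. Pure tensors span, so
  at most one such map exists on the carrier; \<open>SOME\<close> only chooses irrelevant values outside the
  carrier. One exists by the Leibniz identity, because \<open>x \<otimes> y \<mapsto> [x, y]\<close> is a well-defined linear map.
\<close>

definition nonabelian_bracket ::
  "('r, 'rm) ring_scheme \<Rightarrow> ('r, 'a, 'am) superalgebra_scheme \<Rightarrow>
   ('a \<times> 'a \<Rightarrow> 'r) set set \<Rightarrow> ('a \<times> 'a \<Rightarrow> 'r) set set \<Rightarrow> ('a \<times> 'a \<Rightarrow> 'r) set set" where
  "nonabelian_bracket R L =
    (let T = nonabelian_supermodule R L; t = nonabelian_pure R L in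
     SOME b. bilinear_map R T T T b \<and>
       (\<forall>x\<in>carrier L. \<forall>y\<in>carrier L. \<forall>x'\<in>carrier L. \<forall>y'\<in>carrier L.
          b (t x y) (t x' y') = t (bracket L x y) (bracket L x' y')))"

definition nonabelian_tensor ::
  "('r, 'rm) ring_scheme \<Rightarrow> ('r, 'a, 'am) superalgebra_scheme \<Rightarrow>
   ('r, ('a \<times> 'a \<Rightarrow> 'r) set set) superalgebra" where
  "nonabelian_tensor R L =
     supermodule.extend (nonabelian_supermodule R L) (superalgebra.fields (nonabelian_bracket R L))"


section \<open>Leibniz superalgebras given by generators and relations\<close>

text \<open>Nonassociative monomials; they form a basis of the free nonassociative superalgebra.\<close>

datatype 'g monomial = Gen 'g | Prod "'g monomial" "'g monomial"

primrec mdeg :: "('g \<Rightarrow> bit) \<Rightarrow> 'g monomial \<Rightarrow> bit" where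
  "mdeg deg (Gen g) = deg g"
| "mdeg deg (Prod s t) = mdeg deg s + mdeg deg t"

definition free_superalgebra ::
  "('r, 'rm) ring_scheme \<Rightarrow> 'g set \<Rightarrow> ('g \<Rightarrow> bit) \<Rightarrow> ('r, 'g monomial \<Rightarrow> 'r) superalgebra" where
  "free_superalgebra R X deg =
    (let E = free_module R {t. set_monomial t \<subseteq> X} in
     supermodule.extend
       (module.extend E
          (supermodule.fields (\<lambda>p. {f \<in> carrier E. \<forall>t. f t \<noteq> \<zero>\<^bsub>R\<^esub> \<longrightarrow> mdeg deg t = p})))
       (superalgebra.fields
          (\<lambda>f g t. case t of Gen x \<Rightarrow> \<zero>\<^bsub>R\<^esub> | Prod u v \<Rightarrow> f u \<otimes>\<^bsub>R\<^esub> g v)))"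

definition leibniz_relators ::
  "('r, 'rm) ring_scheme \<Rightarrow> ('r, 'a, 'am) superalgebra_scheme \<Rightarrow> 'a set" where
  "leibniz_relators R A =
     {bracket A x (bracket A y z) \<ominus>\<^bsub>A\<^esub>
        (bracket A (bracket A x y) z \<ominus>\<^bsub>A\<^esub> sgn_pow R (\<beta> * \<gamma>) \<odot>\<^bsub>A\<^esub> bracket A (bracket A x z) y) |
      x y z \<alpha> \<beta> \<gamma>. x \<in> hpart A \<alpha> \<and> y \<in> hpart A \<beta> \<and> z \<in> hpart A \<gamma>}"

definition two_sided_ideal ::
  "('r, 'rm) ring_scheme \<Rightarrow> ('r, 'a, 'am) superalgebra_scheme \<Rightarrow> 'a set \<Rightarrow> bool" where
  "two_sided_ideal R A I \<longleftrightarrow> submodule I R A \<and>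
     (\<forall>x\<in>carrier A. \<forall>u\<in>I. bracket A x u \<in> I \<and> bracket A u x \<in> I)"

definition presented_leibniz ::
  "('r, 'rm) ring_scheme \<Rightarrow> 'g set \<Rightarrow> ('g \<Rightarrow> bit) \<Rightarrow> ('g monomial \<Rightarrow> 'r) set \<Rightarrow>
   ('r, ('g monomial \<Rightarrow> 'r) set) superalgebra" where
  "presented_leibniz R X deg S =
    (let A = free_superalgebra R X deg in
     quot_superalgebra A (two_sided_ideal R A hull (leibniz_relators R A \<union> S)))"


section \<open>The Steinberg Leibniz superalgebra\<close>

text \<open>
  \<open>F i j \<alpha> a\<close> stands for \<open>F_ij(a)\<close> with \<open>a\<close> homogeneous of degree \<open>\<alpha>\<close>. Recording \<open>\<alpha>\<close> makes
  the degree of every generator well defined; the only element having two degrees is \<open>a = 0\<close>, and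
  both symbols for \<open>F_ij(0)\<close> vanish in the quotient by linearity.
\<close>

datatype 'd st_gen = F nat nat bit 'd

definition index_deg :: "nat \<Rightarrow> nat \<Rightarrow> bit" where
  "index_deg m i = (if i \<le> m then 0 else 1)"

definition st_deg :: "nat \<Rightarrow> nat \<Rightarrow> nat \<Rightarrow> bit \<Rightarrow> bit" where
  "st_deg m i j \<alpha> = index_deg m i + index_deg m j + \<alpha>"

primrec st_gen_deg :: "nat \<Rightarrow> 'd st_gen \<Rightarrow> bit" where
  "st_gen_deg m (F i j \<alpha> a) = st_deg m i j \<alpha>"

definition st_gens :: "('r, 'd, 'dm) superdialgebra_scheme \<Rightarrow> nat \<Rightarrow> nat \<Rightarrow> 'd st_gen set" where
  "st_gens D m n =
     {F i j \<alpha> a | i j \<alpha> a. i \<in> {1..m+n} \<and> j \<in> {1..m+n} \<and> i \<noteq> j \<and> a \<in> hpart D \<alpha>}"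

definition st_free ::
  "('r, 'rm) ring_scheme \<Rightarrow> ('r, 'd, 'dm) superdialgebra_scheme \<Rightarrow> nat \<Rightarrow> nat \<Rightarrow>
   ('r, 'd st_gen monomial \<Rightarrow> 'r) superalgebra" where
  "st_free R D m n = free_superalgebra R (st_gens D m n) (st_gen_deg m)"

definition st_elem ::
  "('r, 'rm) ring_scheme \<Rightarrow> nat \<Rightarrow> nat \<Rightarrow> bit \<Rightarrow> 'd \<Rightarrow> 'd st_gen monomial \<Rightarrow> 'r" where
  "st_elem R i j \<alpha> a = basis_vec R (Gen (F i j \<alpha> a))"

inductive_set st_relators ::
  "('r, 'rm) ring_scheme \<Rightarrow> ('r, 'd, 'dm) superdialgebra_scheme \<Rightarrow> nat \<Rightarrow> nat \<Rightarrow>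
   ('d st_gen monomial \<Rightarrow> 'r) set"
  for R :: "('r, 'rm) ring_scheme" and D :: "('r, 'd, 'dm) superdialgebra_scheme"
    and m n :: nat where
  linear: "\<lbrakk>i \<in> {1..m+n}; j \<in> {1..m+n}; i \<noteq> j; a \<in> hpart D \<alpha>; b \<in> hpart D \<alpha>;
      r \<in> carrier R; s \<in> carrier R\<rbrakk> \<Longrightarrow>
    st_elem R i j \<alpha> (r \<odot>\<^bsub>D\<^esub> a \<oplus>\<^bsub>D\<^esub> s \<odot>\<^bsub>D\<^esub> b) \<ominus>\<^bsub>st_free R D m n\<^esub>
      (r \<odot>\<^bsub>st_free R D m n\<^esub> st_elem R i j \<alpha> a \<oplus>\<^bsub>st_free R D m n\<^esub>
       s \<odot>\<^bsub>st_free R D m n\<^esub> st_elem R i j \<alpha> b) \<in> st_relators R D m n"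
| right: "\<lbrakk>i \<in> {1..m+n}; j \<in> {1..m+n}; k \<in> {1..m+n}; l \<in> {1..m+n}; i \<noteq> j; k \<noteq> l;
      a \<in> hpart D \<alpha>; b \<in> hpart D \<beta>; i \<noteq> l; j = k\<rbrakk> \<Longrightarrow>
    bracket (st_free R D m n) (st_elem R i j \<alpha> a) (st_elem R k l \<beta> b) \<ominus>\<^bsub>st_free R D m n\<^esub>
      st_elem R i l (\<alpha> + \<beta>) (a \<stileturn>\<^bsub>D\<^esub> b) \<in> st_relators R D m n"
| left: "\<lbrakk>i \<in> {1..m+n}; j \<in> {1..m+n}; k \<in> {1..m+n}; l \<in> {1..m+n}; i \<noteq> j; k \<noteq> l;
      a \<in> hpart D \<alpha>; b \<in> hpart D \<beta>; i = l; j \<noteq> k\<rbrakk> \<Longrightarrow>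
    bracket (st_free R D m n) (st_elem R i j \<alpha> a) (st_elem R k l \<beta> b) \<ominus>\<^bsub>st_free R D m n\<^esub>
      (\<ominus>\<^bsub>st_free R D m n\<^esub> (sgn_pow R (st_deg m i j \<alpha> * st_deg m k l \<beta>)
         \<odot>\<^bsub>st_free R D m n\<^esub> st_elem R k j (\<beta> + \<alpha>) (b \<turnstile>\<^bsub>D\<^esub> a))) \<in> st_relators R D m n"
| zero: "\<lbrakk>i \<in> {1..m+n}; j \<in> {1..m+n}; k \<in> {1..m+n}; l \<in> {1..m+n}; i \<noteq> j; k \<noteq> l;
      a \<in> hpart D \<alpha>; b \<in> hpart D \<beta>; i \<noteq> l; j \<noteq> k\<rbrakk> \<Longrightarrow>
    bracket (st_free R D m n) (st_elem R i j \<alpha> a) (st_elem R k l \<beta> b) \<in> st_relators R D m n"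

definition stl ::
  "('r, 'rm) ring_scheme \<Rightarrow> nat \<Rightarrow> nat \<Rightarrow> ('r, 'd, 'dm) superdialgebra_scheme \<Rightarrow>
   ('r, ('d st_gen monomial \<Rightarrow> 'r) set) superalgebra" where
  "stl R m n D = presented_leibniz R (st_gens D m n) (st_gen_deg m) (st_relators R D m n)"

end

theory Submission
  imports Defs
begin

text \<open>
  Write \<open>L\<close> for the Steinberg Leibniz superalgebra and \<open>T\<close> for its non-abelian tensor square. The relators
  of \<open>T\<close> are, with the sign carried along, an instance of the Leibniz identity, so the bracket of \<open>L\<close>
  induces a linear map \<open>\<mu> : T \<rightarrow> L\<close>, \<open>x \<otimes> y \<mapsto> [x, y]\<close> (\<open>commutator_map\<close>), and the bracket of \<open>T\<close> is
  \<open>[u, v] = \<mu> u \<otimes> \<mu> v\<close>. This \<open>\<mu>\<close> is the isomorphism.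

  For an arbitrary Leibniz superalgebra \<open>L\<close>, it is enough to find a graded homomorphism \<open>g : L \<rightarrow> T\<close> with
  \<open>\<mu> (g x) = x\<close> (\<open>commutator_map_iso\<close>). Indeed
  \<open>g (\<mu> (x \<otimes> y)) = g [x, y] = [g x, g y] = \<mu> (g x) \<otimes> \<mu> (g y) = x \<otimes> y\<close>,
  and elements \<open>x \<otimes> y\<close> span \<open>T\<close>. That \<open>T\<close> is the direct sum of its homogeneous parts is
  then inherited from \<open>L\<close> through the two mutually inverse graded maps. Before that point \<open>T\<close> is only
  known to be a \<open>graded_leibniz\<close> structure, in which the parts need not be independent; such a structure is
  still a legitimate target for homomorphisms out of a presented Leibniz superalgebra.

  For the Steinberg algebra, \<open>g\<close> comes from the presentation (\<open>stl_universal\<close>): it sends \<open>F_ij(a)\<close> to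
  \<open>F_is(a) \<otimes> F_sj(e)\<close>, where \<open>e\<close> is the bar-unit and \<open>s\<close> is any index different from \<open>i\<close> and \<open>j\<close>. Since
  \<open>\<mu>\<close> sends this tensor to \<open>[F_is(a), F_sj(e)] = F_ij(a \<stileturn> e) = F_ij(a)\<close>, the equation \<open>\<mu> (g x) = x\<close>
  holds on generators and hence everywhere. What must be checked is that these tensors satisfy the Steinberg
  relations, i.e. that \<open>F_ij(a) \<otimes> F_kl(b)\<close> has the value prescribed for \<open>[F_ij(a), F_kl(b)]\<close>. All
  cases use the defining relation \<open>x \<otimes> [y, z] = [x, y] \<otimes> z - (-1)^(|y||z|) [x, z] \<otimes> y\<close> once, with a fresh index \<open>s\<close>:

  \<^item> \<open>i \<noteq> l\<close>, \<open>j \<noteq> k\<close> (\<open>pure_gen_zero\<close>): split \<open>F_kl(b) = [F_ks(b), F_sl(e)]\<close>; both brackets with \<open>F_ij(a)\<close>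
    vanish because \<open>s\<close> avoids all of \<open>i, j, k, l\<close>. Finding such an \<open>s\<close> is where five indices are needed.
  \<^item> \<open>j = k\<close>, \<open>i \<noteq> l\<close> (\<open>pure_gen_right\<close>): the same splitting leaves \<open>F_is(a \<stileturn> b) \<otimes> F_sl(e)\<close>. With \<open>b = e\<close>
    this also shows that \<open>F_is(a) \<otimes> F_sj(e)\<close> does not depend on \<open>s\<close>.
  \<^item> \<open>i = l\<close>, \<open>j \<noteq> k\<close> (\<open>pure_gen_left\<close>): split the first factor instead, \<open>F_ij(a) = [F_is(a), F_sj(e)]\<close>.

  The rest supplies the algebra that this argument takes for granted: quotients, free modules and
  tensor products with their universal properties, and the fact that an ideal generated by homogeneous elements
  is homogeneous, which makes a presented Leibniz superalgebra a superalgebra.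
\<close>

section \<open>Linear maps\<close>

definition linear_map ::
  "('r, 'rm) ring_scheme \<Rightarrow> ('r, 'a, 'am) module_scheme \<Rightarrow> ('r, 'b, 'bm) module_scheme \<Rightarrow>
   ('a \<Rightarrow> 'b) \<Rightarrow> bool" where
  "linear_map R M P h \<longleftrightarrow>
     (\<forall>x\<in>carrier M. h x \<in> carrier P) \<and>
     (\<forall>x\<in>carrier M. \<forall>y\<in>carrier M. h (x \<oplus>\<^bsub>M\<^esub> y) = h x \<oplus>\<^bsub>P\<^esub> h y) \<and>
     (\<forall>r\<in>carrier R. \<forall>x\<in>carrier M. h (r \<odot>\<^bsub>M\<^esub> x) = r \<odot>\<^bsub>P\<^esub> h x)"

lemma linear_map_closed: "linear_map R M P h \<Longrightarrow> x \<in> carrier M \<Longrightarrow> h x \<in> carrier P"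
  and linear_map_add: "linear_map R M P h \<Longrightarrow> x \<in> carrier M \<Longrightarrow> y \<in> carrier M \<Longrightarrow>
      h (x \<oplus>\<^bsub>M\<^esub> y) = h x \<oplus>\<^bsub>P\<^esub> h y"
  and linear_map_smult: "linear_map R M P h \<Longrightarrow> r \<in> carrier R \<Longrightarrow> x \<in> carrier M \<Longrightarrow>
      h (r \<odot>\<^bsub>M\<^esub> x) = r \<odot>\<^bsub>P\<^esub> h x"
  by (auto simp: linear_map_def)

lemma linear_mapI:
  assumes "\<And>x. x \<in> carrier M \<Longrightarrow> h x \<in> carrier P"
    and "\<And>x y. x \<in> carrier M \<Longrightarrow> y \<in> carrier M \<Longrightarrow> h (x \<oplus>\<^bsub>M\<^esub> y) = h x \<oplus>\<^bsub>P\<^esub> h y"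
    and "\<And>r x. r \<in> carrier R \<Longrightarrow> x \<in> carrier M \<Longrightarrow> h (r \<odot>\<^bsub>M\<^esub> x) = r \<odot>\<^bsub>P\<^esub> h x"
  shows "linear_map R M P h"
  using assms by (auto simp: linear_map_def)

lemma linear_map_comp:
  "linear_map R M P h \<Longrightarrow> linear_map R P Q k \<Longrightarrow> linear_map R M Q (\<lambda>x. k (h x))"
  by (auto simp: linear_map_def)

lemma linear_map_id: "linear_map R M M (\<lambda>x. x)"
  by (auto simp: linear_map_def)

lemma linear_map_zero:
  assumes "module R M" "module R P" "linear_map R M P h"
  shows "h \<zero>\<^bsub>M\<^esub> = \<zero>\<^bsub>P\<^esub>"
proof -
  interpret M: module R M by fact
  interpret P: module R P by fact
  have "h (\<zero>\<^bsub>R\<^esub> \<odot>\<^bsub>M\<^esub> \<zero>\<^bsub>M\<^esub>) = \<zero>\<^bsub>R\<^esub> \<odot>\<^bsub>P\<^esub> h \<zero>\<^bsub>M\<^esub>"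
    by (rule linear_map_smult[OF assms(3)]) auto
  then show ?thesis using assms(3) by (simp add: linear_map_closed)
qed

lemma (in module) uminus_smult: "x \<in> carrier M \<Longrightarrow> \<ominus>\<^bsub>M\<^esub> x = (\<ominus>\<^bsub>R\<^esub> \<one>\<^bsub>R\<^esub>) \<odot>\<^bsub>M\<^esub> x"
  by (simp add: smult_l_minus)

lemma (in abelian_group) minus_eq_zero_iff:
  assumes "x \<in> carrier G" "y \<in> carrier G"
  shows "x \<ominus> y = \<zero> \<longleftrightarrow> x = y"
proof
  assume "x \<ominus> y = \<zero>"
  then have "\<ominus> (\<ominus> y) = x" using assms by (intro minus_equality) (auto simp: a_minus_def)
  then show "x = y" using assms by simp
qed (use assms in \<open>simp add: a_minus_def r_neg\<close>)

lemma linear_map_uminus: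
  assumes "module R M" "module R P" "linear_map R M P h" "x \<in> carrier M"
  shows "h (\<ominus>\<^bsub>M\<^esub> x) = \<ominus>\<^bsub>P\<^esub> h x"
proof -
  interpret M: module R M by fact
  interpret P: module R P by fact
  show ?thesis using assms(3,4)
    by (simp add: M.uminus_smult P.uminus_smult linear_map_smult linear_map_closed)
qed

lemma linear_map_minus:
  assumes "module R M" "module R P" "linear_map R M P h" "x \<in> carrier M" "y \<in> carrier M"
  shows "h (x \<ominus>\<^bsub>M\<^esub> y) = h x \<ominus>\<^bsub>P\<^esub> h y"
proof -
  interpret M: module R M by fact
  show ?thesis using assms
    by (simp add: a_minus_def linear_map_add linear_map_uminus[OF assms(1-3)])
qed

text \<open>Quotients of modules and record extensions of modules are both instances of this criterion.\<close>

lemma module_surjective_image: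
  assumes "module R M" and h: "linear_map R M Q h" "h ` carrier M = carrier Q" "h \<zero>\<^bsub>M\<^esub> = \<zero>\<^bsub>Q\<^esub>"
  shows "module R Q"
proof -
  interpret M: module R M by fact
  have ex: "\<exists>u\<in>carrier M. x = h u" if "x \<in> carrier Q" for x using h(2) that by auto
  show ?thesis
  proof (rule moduleI)
    show "cring R" ..
    show "abelian_group Q"
    proof (rule abelian_groupI)
      show "x \<oplus>\<^bsub>Q\<^esub> y \<in> carrier Q" if "x \<in> carrier Q" "y \<in> carrier Q" for x y
        using ex[OF that(1)] ex[OF that(2)]
        by (auto simp: linear_map_add[OF h(1), symmetric] linear_map_closed[OF h(1)])
      show "\<zero>\<^bsub>Q\<^esub> \<in> carrier Q"
        using linear_map_closed[OF h(1) M.zero_closed] by (simp add: h(3))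
      show "x \<oplus>\<^bsub>Q\<^esub> y \<oplus>\<^bsub>Q\<^esub> z = x \<oplus>\<^bsub>Q\<^esub> (y \<oplus>\<^bsub>Q\<^esub> z)"
        if "x \<in> carrier Q" "y \<in> carrier Q" "z \<in> carrier Q" for x y z
        using ex[OF that(1)] ex[OF that(2)] ex[OF that(3)]
        by (auto simp: linear_map_add[OF h(1), symmetric] M.a_assoc)
      show "x \<oplus>\<^bsub>Q\<^esub> y = y \<oplus>\<^bsub>Q\<^esub> x" if "x \<in> carrier Q" "y \<in> carrier Q" for x y
        using ex[OF that(1)] ex[OF that(2)]
        by (auto simp: linear_map_add[OF h(1), symmetric] M.a_comm)
      show "\<zero>\<^bsub>Q\<^esub> \<oplus>\<^bsub>Q\<^esub> x = x" if "x \<in> carrier Q" for x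
        using ex[OF that] by (auto simp: linear_map_add[OF h(1), symmetric] h(3)[symmetric])
      show "\<exists>y\<in>carrier Q. y \<oplus>\<^bsub>Q\<^esub> x = \<zero>\<^bsub>Q\<^esub>" if x: "x \<in> carrier Q" for x
      proof -
        obtain u where u: "u \<in> carrier M" "x = h u" using ex[OF x] by auto
        then have "h (\<ominus>\<^bsub>M\<^esub> u) \<in> carrier Q" "h (\<ominus>\<^bsub>M\<^esub> u) \<oplus>\<^bsub>Q\<^esub> x = \<zero>\<^bsub>Q\<^esub>"
          by (simp_all add: linear_map_add[OF h(1), symmetric] h(3)[symmetric] M.l_neg
              linear_map_closed[OF h(1)])
        then show ?thesis using u linear_map_closed[OF h(1)] by blast
      qed
    qed
    show "a \<odot>\<^bsub>Q\<^esub> x \<in> carrier Q" if "a \<in> carrier R" "x \<in> carrier Q" for a x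
      using that ex[OF that(2)]
      by (auto simp: linear_map_smult[OF h(1), symmetric] linear_map_closed[OF h(1)])
    show "(a \<oplus>\<^bsub>R\<^esub> b) \<odot>\<^bsub>Q\<^esub> x = a \<odot>\<^bsub>Q\<^esub> x \<oplus>\<^bsub>Q\<^esub> b \<odot>\<^bsub>Q\<^esub> x"
      if "a \<in> carrier R" "b \<in> carrier R" "x \<in> carrier Q" for a b x
      using that ex[OF that(3)]
      by (auto simp: linear_map_add[OF h(1), symmetric] linear_map_smult[OF h(1), symmetric] M.smult_l_distr)
    show "a \<odot>\<^bsub>Q\<^esub> (x \<oplus>\<^bsub>Q\<^esub> y) = a \<odot>\<^bsub>Q\<^esub> x \<oplus>\<^bsub>Q\<^esub> a \<odot>\<^bsub>Q\<^esub> y"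
      if "a \<in> carrier R" "x \<in> carrier Q" "y \<in> carrier Q" for a x y
      using that ex[OF that(2)] ex[OF that(3)]
      by (auto simp: linear_map_add[OF h(1), symmetric] linear_map_smult[OF h(1), symmetric] M.smult_r_distr)
    show "(a \<otimes>\<^bsub>R\<^esub> b) \<odot>\<^bsub>Q\<^esub> x = a \<odot>\<^bsub>Q\<^esub> (b \<odot>\<^bsub>Q\<^esub> x)"
      if "a \<in> carrier R" "b \<in> carrier R" "x \<in> carrier Q" for a b x
      using that ex[OF that(3)]
      by (auto simp: linear_map_smult[OF h(1), symmetric] M.smult_assoc1)
    show "\<one>\<^bsub>R\<^esub> \<odot>\<^bsub>Q\<^esub> x = x" if "x \<in> carrier Q" for x
      using ex[OF that] by (auto simp: linear_map_smult[OF h(1), symmetric])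
  qed
qed


section \<open>Submodules and spanning sets\<close>

lemma submodule_zero: "submodule N R M \<Longrightarrow> \<zero>\<^bsub>M\<^esub> \<in> N"
  using subgroup.one_closed[of N "add_monoid M"] by (auto simp: submodule_def)

lemma submodule_add: "submodule N R M \<Longrightarrow> x \<in> N \<Longrightarrow> y \<in> N \<Longrightarrow> x \<oplus>\<^bsub>M\<^esub> y \<in> N"
  using subgroup.m_closed[of N "add_monoid M"] by (auto simp: submodule_def)

lemma submodule_smult: "submodule N R M \<Longrightarrow> r \<in> carrier R \<Longrightarrow> x \<in> N \<Longrightarrow> r \<odot>\<^bsub>M\<^esub> x \<in> N"
  by (rule submodule.smult_closed)

lemma submodule_uminus: "submodule N R M \<Longrightarrow> x \<in> N \<Longrightarrow> \<ominus>\<^bsub>M\<^esub> x \<in> N"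
  using subgroup.m_inv_closed[of N "add_monoid M"] by (auto simp: submodule_def a_inv_def)

lemma submodule_minus: "submodule N R M \<Longrightarrow> x \<in> N \<Longrightarrow> y \<in> N \<Longrightarrow> x \<ominus>\<^bsub>M\<^esub> y \<in> N"
  by (simp add: a_minus_def submodule_add submodule_uminus)

lemma submodule_carrier: "submodule N R M \<Longrightarrow> x \<in> N \<Longrightarrow> x \<in> carrier M"
  using subgroup.subset[of N "add_monoid M"] by (auto simp: submodule_def)

lemma (in module) submoduleI':
  assumes "\<And>x. x \<in> H \<Longrightarrow> x \<in> carrier M" "\<zero>\<^bsub>M\<^esub> \<in> H"
    and "\<And>a b. a \<in> H \<Longrightarrow> b \<in> H \<Longrightarrow> a \<oplus>\<^bsub>M\<^esub> b \<in> H"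
    and "\<And>a x. a \<in> carrier R \<Longrightarrow> x \<in> H \<Longrightarrow> a \<odot>\<^bsub>M\<^esub> x \<in> H"
  shows "submodule H R M"
  using assms by (intro submoduleI) (auto simp: uminus_smult)

lemma submodule_vimage:
  assumes "module R M" "module R P" "linear_map R M P h" "submodule N R P"
  shows "submodule {x \<in> carrier M. h x \<in> N} R M"
proof -
  interpret M: module R M by fact
  show ?thesis using assms
    by (intro M.submoduleI')
      (auto simp: linear_map_zero linear_map_add linear_map_smult submodule_zero submodule_add submodule_smult)
qed

lemma submodule_image:
  assumes "module R M" "module R P" "linear_map R M P h" "submodule N R M"
  shows "submodule (h ` N) R P"
proof -
  interpret P: module R P by fact
  have c: "x \<in> carrier M" if "x \<in> N" for x using assms(4) that by (rule submodule_carrier)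
  show ?thesis
  proof (rule P.submoduleI')
    show "\<zero>\<^bsub>P\<^esub> \<in> h ` N"
      using linear_map_zero[OF assms(1-3)] submodule_zero[OF assms(4)] by (metis image_eqI)
    show "a \<oplus>\<^bsub>P\<^esub> b \<in> h ` N" if "a \<in> h ` N" "b \<in> h ` N" for a b
      using that c submodule_add[OF assms(4)]
      by (auto simp: linear_map_add[OF assms(3), symmetric])
    show "r \<odot>\<^bsub>P\<^esub> b \<in> h ` N" if "r \<in> carrier R" "b \<in> h ` N" for r b
      using that c submodule_smult[OF assms(4)]
      by (auto simp: linear_map_smult[OF assms(3), symmetric])
  qed (use c linear_map_closed[OF assms(3)] in auto)
qed

lemma submodule_equalizer:
  assumes "module R M" "module R P" "linear_map R M P h" "linear_map R M P k"
  shows "submodule {x \<in> carrier M. h x = k x} R M"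
proof -
  interpret M: module R M by fact
  show ?thesis using assms
    by (intro M.submoduleI') (auto simp: linear_map_zero linear_map_add linear_map_smult)
qed

lemma submodule_kernel:
  assumes "module R M" "module R P" "linear_map R M P h"
  shows "submodule {x \<in> carrier M. h x = \<zero>\<^bsub>P\<^esub>} R M"
proof -
  interpret P: module R P by fact
  have "submodule {\<zero>\<^bsub>P\<^esub>} R P" by (rule P.submoduleI') auto
  from submodule_vimage[OF assms this] show ?thesis by simp
qed

lemma submodule_Inter:
  assumes "module R M" "\<And>N. N \<in> \<N> \<Longrightarrow> submodule N R M" "\<N> \<noteq> {}"
  shows "submodule (\<Inter>\<N>) R M"
proof -
  interpret M: module R M by fact
  show ?thesis
  proof (rule M.submoduleI')
    show "x \<in> carrier M" if "x \<in> \<Inter>\<N>" for x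
      using that assms(3) submodule_carrier[OF assms(2)] by blast
  qed (simp_all add: submodule_zero[OF assms(2)] submodule_add[OF assms(2)] submodule_smult[OF assms(2)])
qed

lemma submodule_generated_submodule:
  assumes "module R M" "S \<subseteq> carrier M"
  shows "submodule (submodule_generated R M S) R M"
  unfolding submodule_generated_def hull_def
  by (rule submodule_Inter[OF assms(1)]) (use assms module.carrier_is_submodule in auto)

lemma submodule_generated_incl: "x \<in> S \<Longrightarrow> x \<in> submodule_generated R M S"
  by (auto simp: submodule_generated_def hull_def)

lemma submodule_generated_least:
  "submodule N R M \<Longrightarrow> S \<subseteq> N \<Longrightarrow> submodule_generated R M S \<subseteq> N"
  by (auto simp: submodule_generated_def hull_def)

text \<open>
  Spanning is phrased through submodules rather than linear combinations, so that it can be used directly as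
  an induction principle.
\<close>

definition spans ::
  "('r, 'rm) ring_scheme \<Rightarrow> ('r, 'a, 'am) module_scheme \<Rightarrow> 'a set \<Rightarrow> bool" where
  "spans R M S \<longleftrightarrow> S \<subseteq> carrier M \<and> (\<forall>N. submodule N R M \<longrightarrow> S \<subseteq> N \<longrightarrow> carrier M \<subseteq> N)"

lemma linear_map_ext:
  assumes "module R M" "module R P" "spans R M S" "linear_map R M P h" "linear_map R M P k"
    and "\<And>x. x \<in> S \<Longrightarrow> h x = k x" "x \<in> carrier M"
  shows "h x = k x"
  using submodule_equalizer[OF assms(1,2,4,5)] assms(3,6,7) by (fastforce simp: spans_def)

text \<open>
  A linear surjection carries a spanning set to a spanning set because preimages of submodules are submodules.
\<close>

lemma spans_surjective_image:
  assumes "module R M" "module R Q" "linear_map R M Q h" "h ` carrier M = carrier Q" "spans R M S"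
  shows "spans R Q (h ` S)"
  unfolding spans_def
proof (intro conjI allI impI)
  show "h ` S \<subseteq> carrier Q" using assms(4,5) by (auto simp: spans_def)
  fix N assume N: "submodule N R Q" "h ` S \<subseteq> N"
  have "S \<subseteq> {x \<in> carrier M. h x \<in> N}" using N(2) assms(5) by (auto simp: spans_def)
  then have "carrier M \<subseteq> {x \<in> carrier M. h x \<in> N}"
    using submodule_vimage[OF assms(1-3) N(1)] assms(5) unfolding spans_def by blast
  then show "carrier Q \<subseteq> N" unfolding assms(4)[symmetric] by auto
qed


section \<open>Bilinear maps\<close>

lemma bilinear_map_iff:
  "bilinear_map R M N P f \<longleftrightarrow>
     (\<forall>y\<in>carrier N. linear_map R M P (\<lambda>x. f x y)) \<and> (\<forall>x\<in>carrier M. linear_map R N P (f x))"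
  unfolding bilinear_map_def linear_map_def by blast

lemma bilinear_map_comp:
  assumes "bilinear_map R M N P f" "linear_map R M' M h" "linear_map R N' N k" "linear_map R P P' g"
  shows "bilinear_map R M' N' P' (\<lambda>x y. g (f (h x) (k y)))"
  unfolding bilinear_map_iff
proof (intro conjI ballI)
  show "linear_map R M' P' (\<lambda>x. g (f (h x) (k y)))" if "y \<in> carrier N'" for y
    using assms that by (auto simp: bilinear_map_iff intro!: linear_map_comp[OF _ assms(4)]
        linear_map_comp[OF assms(2)] linear_map_closed[OF assms(3)])
  show "linear_map R N' P' (\<lambda>y. g (f (h x) (k y)))" if "x \<in> carrier M'" for x
    using assms that by (auto simp: bilinear_map_iff intro!: linear_map_comp[OF _ assms(4)]
        linear_map_comp[OF assms(3)] linear_map_closed[OF assms(2)])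
qed

lemma bilinear_map_ext:
  assumes "module R M" "module R N" "module R P" "spans R M S" "spans R N S'"
    and "bilinear_map R M N P f" "bilinear_map R M N P f'"
    and eq: "\<And>x y. x \<in> S \<Longrightarrow> y \<in> S' \<Longrightarrow> f x y = f' x y" and "x \<in> carrier M" "y \<in> carrier N"
  shows "f x y = f' x y"
proof -
  have 1: "f u y = f' u y" if "u \<in> S" for u
    by (rule linear_map_ext[OF assms(2,3,5)])
      (use assms that in \<open>auto simp: bilinear_map_iff spans_def\<close>)
  show ?thesis
    by (rule linear_map_ext[OF assms(1,3,4)])
      (use assms 1 in \<open>auto simp: bilinear_map_iff spans_def\<close>)
qed


section \<open>Quotient modules\<close>

text \<open>
  Being a quotient by \<open>N\<close> is made a property of a map, so that the coset constructions at the levels of plain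
  modules, supermodules and superalgebras, which differ only in additional record fields, share one theory.
\<close>

definition quotient_map ::
  "('r, 'rm) ring_scheme \<Rightarrow> ('r, 'a, 'am) module_scheme \<Rightarrow> 'a set \<Rightarrow>
   ('r, 'b, 'bm) module_scheme \<Rightarrow> ('a \<Rightarrow> 'b) \<Rightarrow> bool" where
  "quotient_map R M N Q \<pi> \<longleftrightarrow> linear_map R M Q \<pi> \<and> \<pi> ` carrier M = carrier Q \<and>
     (\<forall>x\<in>carrier M. \<pi> x = \<zero>\<^bsub>Q\<^esub> \<longleftrightarrow> x \<in> N)"

lemma quotient_module:
  assumes M: "module R M" and N: "submodule N R M"
    and Q: "carrier Q = a_rcosets\<^bsub>M\<^esub> N" "zero Q = N" "add Q = set_add M"
      "smult Q = (\<lambda>r U. \<Union>u\<in>U. N +>\<^bsub>M\<^esub> (r \<odot>\<^bsub>M\<^esub> u))"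
  shows "module R Q" "quotient_map R M N Q (\<lambda>x. N +>\<^bsub>M\<^esub> x)"
proof -
  interpret M: module R M by fact
  interpret N: abelian_subgroup N M
    by (intro abelian_subgroupI3 additive_subgroup.intro M.abelian_group_axioms
        submodule.axioms(1)[OF N])
  have im: "(\<lambda>x. N +>\<^bsub>M\<^esub> x) ` carrier M = carrier Q"
    by (auto simp: Q A_RCOSETS_def RCOSETS_def a_r_coset_def)
  have ker: "N +>\<^bsub>M\<^esub> x = N \<longleftrightarrow> x \<in> N" if "x \<in> carrier M" for x
    using N.a_rcos_self N.a_rcos_const that by blast
  have sm: "(\<Union>u\<in>N +>\<^bsub>M\<^esub> x. N +>\<^bsub>M\<^esub> (r \<odot>\<^bsub>M\<^esub> u)) = N +>\<^bsub>M\<^esub> (r \<odot>\<^bsub>M\<^esub> x)"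
    if r: "r \<in> carrier R" and x: "x \<in> carrier M" for r x
  proof -
    have eq: "N +>\<^bsub>M\<^esub> (r \<odot>\<^bsub>M\<^esub> u) = N +>\<^bsub>M\<^esub> (r \<odot>\<^bsub>M\<^esub> x)" if "u \<in> N +>\<^bsub>M\<^esub> x" for u
    proof -
      obtain i where i: "i \<in> N" "u = i \<oplus>\<^bsub>M\<^esub> x" using \<open>u \<in> N +>\<^bsub>M\<^esub> x\<close> by (auto simp: a_r_coset_def')
      have "r \<odot>\<^bsub>M\<^esub> u = r \<odot>\<^bsub>M\<^esub> i \<oplus>\<^bsub>M\<^esub> r \<odot>\<^bsub>M\<^esub> x"
        using i r x by (simp add: M.smult_r_distr)
      moreover have "r \<odot>\<^bsub>M\<^esub> i \<in> N" using N r i(1) by (rule submodule_smult)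
      ultimately have "r \<odot>\<^bsub>M\<^esub> u \<in> N +>\<^bsub>M\<^esub> (r \<odot>\<^bsub>M\<^esub> x)" by (auto simp: a_r_coset_def')
      then show ?thesis using N.a_repr_independence' r x by (metis M.smult_closed)
    qed
    then show ?thesis using N.a_rcos_self[OF x] by blast
  qed
  have lin: "linear_map R M Q (\<lambda>x. N +>\<^bsub>M\<^esub> x)"
  proof (rule linear_mapI)
    show "N +>\<^bsub>M\<^esub> x \<in> carrier Q" if "x \<in> carrier M" for x using im that by auto
  qed (simp_all add: Q N.a_rcos_sum sm)
  show "module R Q" by (rule module_surjective_image[OF M lin im]) (simp add: Q ker)
  show "quotient_map R M N Q (\<lambda>x. N +>\<^bsub>M\<^esub> x)"
    using lin im ker by (auto simp: quotient_map_def Q)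
qed

lemma quotient_map_eq_iff:
  assumes "module R M" "module R Q" "quotient_map R M N Q \<pi>" "x \<in> carrier M" "y \<in> carrier M"
  shows "\<pi> x = \<pi> y \<longleftrightarrow> x \<ominus>\<^bsub>M\<^esub> y \<in> N"
proof -
  interpret M: module R M by fact
  interpret Q: module R Q by fact
  have lin: "linear_map R M Q \<pi>" using assms by (simp add: quotient_map_def)
  have "\<pi> (x \<ominus>\<^bsub>M\<^esub> y) = \<pi> x \<ominus>\<^bsub>Q\<^esub> \<pi> y" using assms lin by (simp add: linear_map_minus)
  moreover have "\<pi> x \<in> carrier Q" "\<pi> y \<in> carrier Q" using assms lin by (auto intro: linear_map_closed)
  moreover have "\<pi> (x \<ominus>\<^bsub>M\<^esub> y) = \<zero>\<^bsub>Q\<^esub> \<longleftrightarrow> x \<ominus>\<^bsub>M\<^esub> y \<in> N"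
    using assms(3-5) unfolding quotient_map_def by simp
  ultimately show ?thesis using Q.M.minus_eq_zero_iff[of "\<pi> x" "\<pi> y"] by simp
qed

lemma quotient_map_lift:
  assumes M: "module R M" and P: "module R P" and Q: "module R Q"
    and \<pi>: "quotient_map R M N Q \<pi>" and h: "linear_map R M P h" and N: "\<And>x. x \<in> N \<Longrightarrow> h x = \<zero>\<^bsub>P\<^esub>"
  shows "\<exists>h'. linear_map R Q P h' \<and> (\<forall>x\<in>carrier M. h' (\<pi> x) = h x)"
proof -
  interpret M: module R M by fact
  interpret P: module R P by fact
  define h' where "h' U = h (SOME x. x \<in> carrier M \<and> \<pi> x = U)" for U
  have eq: "h' (\<pi> x) = h x" if x: "x \<in> carrier M" for x
  proof -
    define y where "y = (SOME y. y \<in> carrier M \<and> \<pi> y = \<pi> x)"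
    have y: "y \<in> carrier M" "\<pi> y = \<pi> x"
      unfolding y_def using someI[of "\<lambda>y. y \<in> carrier M \<and> \<pi> y = \<pi> x" x] x by auto
    then have "y \<ominus>\<^bsub>M\<^esub> x \<in> N" using quotient_map_eq_iff[OF M Q \<pi>] x by auto
    then have "h y \<ominus>\<^bsub>P\<^esub> h x = \<zero>\<^bsub>P\<^esub>"
      using N linear_map_minus[OF M P h y(1) x] by auto
    then have "h y = h x" using y x h linear_map_closed[OF h] by (simp add: P.M.minus_eq_zero_iff)
    then show ?thesis by (simp add: h'_def y_def)
  qed
  have lin: "linear_map R M Q \<pi>" and im: "\<pi> ` carrier M = carrier Q"
    using \<pi> by (auto simp: quotient_map_def)
  have "linear_map R Q P h'"
  proof (rule linear_mapI)
    show "h' x \<in> carrier P" if "x \<in> carrier Q" for x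
      using that eq linear_map_closed[OF h] by (auto simp: im[symmetric])
    show "h' (x \<oplus>\<^bsub>Q\<^esub> y) = h' x \<oplus>\<^bsub>P\<^esub> h' y" if "x \<in> carrier Q" "y \<in> carrier Q" for x y
      using that eq by (auto simp: im[symmetric] linear_map_add[OF lin, symmetric] linear_map_add[OF h])
    show "h' (r \<odot>\<^bsub>Q\<^esub> x) = r \<odot>\<^bsub>P\<^esub> h' x" if "r \<in> carrier R" "x \<in> carrier Q" for r x
      using that eq by (auto simp: im[symmetric] linear_map_smult[OF lin, symmetric] linear_map_smult[OF h])
  qed
  then show ?thesis using eq by auto
qed


section \<open>Free modules\<close>

lemma free_module_simps:
  "carrier (free_module R X) =
     {f. (\<forall>x\<in>X. f x \<in> carrier R) \<and> (\<forall>x. x \<notin> X \<longrightarrow> f x = \<zero>\<^bsub>R\<^esub>) \<and> finite {x. f x \<noteq> \<zero>\<^bsub>R\<^esub>}}"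
  "zero (free_module R X) = (\<lambda>x. \<zero>\<^bsub>R\<^esub>)"
  "add (free_module R X) = (\<lambda>f g x. f x \<oplus>\<^bsub>R\<^esub> g x)"
  "smult (free_module R X) = (\<lambda>r f x. r \<otimes>\<^bsub>R\<^esub> f x)"
  by (simp_all add: free_module_def)

lemma (in cring) free_module_value:
  "f \<in> carrier (free_module R X) \<Longrightarrow> f x \<in> carrier R"
  by (cases "x \<in> X") (auto simp: free_module_simps)

lemma (in cring) free_module_module: "module R (free_module R X)"
proof (rule moduleI)
  note v = free_module_value
  have fin: "finite {x. f x \<oplus> g x \<noteq> \<zero>}"
    if "f \<in> carrier (free_module R X)" "g \<in> carrier (free_module R X)" for f g
  proof (rule finite_subset[of _ "{x. f x \<noteq> \<zero>} \<union> {x. g x \<noteq> \<zero>}"])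
    show "{x. f x \<oplus> g x \<noteq> \<zero>} \<subseteq> {x. f x \<noteq> \<zero>} \<union> {x. g x \<noteq> \<zero>}" by auto
  qed (use that in \<open>auto simp: free_module_simps\<close>)
  have fin': "finite {x. r \<otimes> f x \<noteq> \<zero>}"
    if "f \<in> carrier (free_module R X)" "r \<in> carrier R" for f r
    by (rule finite_subset[of _ "{x. f x \<noteq> \<zero>}"]) (use that in \<open>auto simp: free_module_simps\<close>)
  show "cring R" ..
  show "abelian_group (free_module R X)"
  proof (rule abelian_groupI)
    show "\<exists>g\<in>carrier (free_module R X). g \<oplus>\<^bsub>free_module R X\<^esub> f = \<zero>\<^bsub>free_module R X\<^esub>"
      if f: "f \<in> carrier (free_module R X)" for f
    proof (rule bexI[of _ "\<lambda>x. \<ominus> f x"])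
      have "{x. \<ominus> f x \<noteq> \<zero>} \<subseteq> {x. f x \<noteq> \<zero>}" by auto
      then show "(\<lambda>x. \<ominus> f x) \<in> carrier (free_module R X)"
        using f by (auto simp: free_module_simps intro: finite_subset)
      show "(\<lambda>x. \<ominus> f x) \<oplus>\<^bsub>free_module R X\<^esub> f = \<zero>\<^bsub>free_module R X\<^esub>"
        using v[OF f] by (auto simp: free_module_simps l_neg)
    qed
    fix f g h assume fgh: "f \<in> carrier (free_module R X)" "g \<in> carrier (free_module R X)"
      "h \<in> carrier (free_module R X)"
    show "f \<oplus>\<^bsub>free_module R X\<^esub> g \<oplus>\<^bsub>free_module R X\<^esub> h = f \<oplus>\<^bsub>free_module R X\<^esub> (g \<oplus>\<^bsub>free_module R X\<^esub> h)"
      using v[OF fgh(1)] v[OF fgh(2)] v[OF fgh(3)] by (auto simp: free_module_simps a_assoc)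
  next
    fix f g assume fgh: "f \<in> carrier (free_module R X)" "g \<in> carrier (free_module R X)"
    show "f \<oplus>\<^bsub>free_module R X\<^esub> g \<in> carrier (free_module R X)"
      using fgh fin[OF fgh] by (auto simp: free_module_simps)
    show "f \<oplus>\<^bsub>free_module R X\<^esub> g = g \<oplus>\<^bsub>free_module R X\<^esub> f"
      using v[OF fgh(1)] v[OF fgh(2)] by (auto simp: free_module_simps a_comm)
  next
    fix f assume f: "f \<in> carrier (free_module R X)"
    show "\<zero>\<^bsub>free_module R X\<^esub> \<oplus>\<^bsub>free_module R X\<^esub> f = f"
      using v[OF f] by (auto simp: free_module_simps)
  qed (auto simp: free_module_simps)
  fix a b f g assume fg: "a \<in> carrier R" "f \<in> carrier (free_module R X)"
  show "a \<odot>\<^bsub>free_module R X\<^esub> f \<in> carrier (free_module R X)"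
    using fg fin'[of f a] by (auto simp: free_module_simps)
  show "(a \<oplus> b) \<odot>\<^bsub>free_module R X\<^esub> f =
      a \<odot>\<^bsub>free_module R X\<^esub> f \<oplus>\<^bsub>free_module R X\<^esub> b \<odot>\<^bsub>free_module R X\<^esub> f"
      "(a \<otimes> b) \<odot>\<^bsub>free_module R X\<^esub> f = a \<odot>\<^bsub>free_module R X\<^esub> (b \<odot>\<^bsub>free_module R X\<^esub> f)"
    if "b \<in> carrier R"
    using v[OF fg(2)] fg that by (auto simp: free_module_simps l_distr m_assoc)
  show "a \<odot>\<^bsub>free_module R X\<^esub> (f \<oplus>\<^bsub>free_module R X\<^esub> g) =
      a \<odot>\<^bsub>free_module R X\<^esub> f \<oplus>\<^bsub>free_module R X\<^esub> a \<odot>\<^bsub>free_module R X\<^esub> g"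
    if "g \<in> carrier (free_module R X)"
    using v[OF fg(2)] v[OF that] fg by (auto simp: free_module_simps r_distr)
next
  fix f assume f: "f \<in> carrier (free_module R X)"
  show "\<one> \<odot>\<^bsub>free_module R X\<^esub> f = f"
    using free_module_value[OF f] by (auto simp: free_module_simps)
qed

lemma (in cring) basis_vec_closed: "x \<in> X \<Longrightarrow> basis_vec R x \<in> carrier (free_module R X)"
  by (auto simp: free_module_simps basis_vec_def)

text \<open>
  Peeling off one point of the finite support at a time writes \<open>f\<close> as a combination of basis vectors. Asking
  only for the basis vectors in the support is what makes the principle applicable to homogeneous parts,
  where the support is restricted by degree.
\<close>

lemma (in cring) free_module_support_induct:
  assumes f: "f \<in> carrier (free_module R X)" and N: "submodule N R (free_module R X)"
    and supp: "\<And>x. f x \<noteq> \<zero> \<Longrightarrow> basis_vec R x \<in> N"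
  shows "f \<in> N"
proof -
  have "finite S \<Longrightarrow> f \<in> carrier (free_module R X) \<Longrightarrow> {x. f x \<noteq> \<zero>} \<subseteq> S \<Longrightarrow>
      (\<And>x. f x \<noteq> \<zero> \<Longrightarrow> basis_vec R x \<in> N) \<Longrightarrow> f \<in> N" for S
  proof (induction S arbitrary: f rule: finite_induct)
    case empty
    then have "f = \<zero>\<^bsub>free_module R X\<^esub>" by (auto simp: free_module_simps)
    then show ?case using submodule_zero[OF N] by simp
  next
    case (insert x S f)
    show ?case
    proof (cases "f x = \<zero>")
      case True
      then have "{x. f x \<noteq> \<zero>} \<subseteq> S" using insert.prems(2) by auto
      then show ?thesis using insert by blast
    next
      case False
      let ?f = "f(x := \<zero>)"
      have fin: "finite {y. ?f y \<noteq> \<zero>}"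
        by (rule finite_subset[of _ "{y. f y \<noteq> \<zero>}"]) (use insert.prems(1) in \<open>auto simp: free_module_simps\<close>)
      have "?f \<in> N"
      proof (rule insert.IH)
        show "?f \<in> carrier (free_module R X)"
          using insert.prems(1) fin by (simp add: free_module_simps)
        show "{y. ?f y \<noteq> \<zero>} \<subseteq> S" using insert.prems(2) by auto
      qed (use insert.prems(3) in \<open>auto split: if_splits\<close>)
      moreover have "f x \<odot>\<^bsub>free_module R X\<^esub> basis_vec R x \<in> N"
        using False by (intro submodule_smult[OF N] insert.prems(3) free_module_value[OF insert.prems(1)])
      moreover have "f = ?f \<oplus>\<^bsub>free_module R X\<^esub> (f x \<odot>\<^bsub>free_module R X\<^esub> basis_vec R x)"
        using free_module_value[OF insert.prems(1)] by (auto simp: free_module_simps basis_vec_def)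
      ultimately show ?thesis using submodule_add[OF N] by metis
    qed
  qed
  from this[of "{x. f x \<noteq> \<zero>}"] show ?thesis using f supp by (auto simp: free_module_simps)
qed

lemma (in cring) free_module_spans: "spans R (free_module R X) (basis_vec R ` X)"
  unfolding spans_def
proof (intro conjI allI impI subsetI)
  show "f \<in> carrier (free_module R X)" if "f \<in> basis_vec R ` X" for f
    using that basis_vec_closed by auto
  fix N f assume N: "submodule N R (free_module R X)" "basis_vec R ` X \<subseteq> N"
    and f: "f \<in> carrier (free_module R X)"
  show "f \<in> N"
    by (rule free_module_support_induct[OF f N(1)]) (use f N(2) in \<open>auto simp: free_module_simps\<close>)
qed

text \<open>
  The extension is the finite sum of \<open>f x \<odot> \<phi> x\<close> over the support of \<open>f\<close>; additivity holds because the sum may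
  be taken over any larger finite subset of \<open>X\<close>.
\<close>

lemma (in cring) free_module_universal:
  assumes P: "module R P" and \<phi>: "\<And>x. x \<in> X \<Longrightarrow> \<phi> x \<in> carrier P"
  shows "\<exists>h. linear_map R (free_module R X) P h \<and> (\<forall>x\<in>X. h (basis_vec R x) = \<phi> x)"
proof -
  interpret P: module R P by fact
  let ?E = "free_module R X"
  define h where "h f = (\<Oplus>\<^bsub>P\<^esub>x\<in>{x. f x \<noteq> \<zero>}. f x \<odot>\<^bsub>P\<^esub> \<phi> x)" for f
  have h: "h f = (\<Oplus>\<^bsub>P\<^esub>x\<in>B. f x \<odot>\<^bsub>P\<^esub> \<phi> x)"
    if "f \<in> carrier ?E" "finite B" "{x. f x \<noteq> \<zero>} \<subseteq> B" "B \<subseteq> X" for f B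
    unfolding h_def
    by (rule P.add.finprod_mono_neutral_cong_left)
      (use that free_module_value[OF that(1)] \<phi> in auto)
  have supp: "finite {x. f x \<noteq> \<zero>}" "{x. f x \<noteq> \<zero>} \<subseteq> X" if "f \<in> carrier ?E" for f
    using that by (auto simp: free_module_simps)
  note val = free_module_value
  interpret E: module R ?E by (rule free_module_module)
  have "linear_map R ?E P h"
  proof (rule linear_mapI)
    fix f assume f: "f \<in> carrier ?E"
    show "h f \<in> carrier P" unfolding h_def
      by (rule P.M.finsum_closed) (use supp[OF f] val[OF f] \<phi> in auto)
    show "h (r \<odot>\<^bsub>?E\<^esub> f) = r \<odot>\<^bsub>P\<^esub> h f" if r: "r \<in> carrier R" for r
    proof -
      have "h (r \<odot>\<^bsub>?E\<^esub> f) = (\<Oplus>\<^bsub>P\<^esub>x\<in>{x. f x \<noteq> \<zero>}. r \<odot>\<^bsub>P\<^esub> (f x \<odot>\<^bsub>P\<^esub> \<phi> x))"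
        using supp[OF f] val[OF f] \<phi> r E.smult_closed[OF r f]
        by (subst h[where B = "{x. f x \<noteq> \<zero>}"])
          (auto simp: free_module_simps(4) P.smult_assoc1 intro!: P.M.finsum_cong')
      also have "\<dots> = r \<odot>\<^bsub>P\<^esub> h f"
        unfolding h_def using supp[OF f] val[OF f] \<phi> r
        by (intro P.finsum_smult_ldistr[symmetric]) auto
      finally show ?thesis .
    qed
    fix g assume g: "g \<in> carrier ?E"
    let ?B = "{x. f x \<noteq> \<zero>} \<union> {x. g x \<noteq> \<zero>}"
    have B: "finite ?B" "?B \<subseteq> X" using supp f g by auto
    have "h (f \<oplus>\<^bsub>?E\<^esub> g) = (\<Oplus>\<^bsub>P\<^esub>x\<in>?B. (f x \<odot>\<^bsub>P\<^esub> \<phi> x) \<oplus>\<^bsub>P\<^esub> (g x \<odot>\<^bsub>P\<^esub> \<phi> x))"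
      by (subst h[where B = ?B])
        (use B E.M.a_closed[OF f g] val[OF f] val[OF g] \<phi> in
          \<open>auto simp: free_module_simps(3) P.smult_l_distr intro!: P.M.finsum_cong'\<close>)
    also have "\<dots> = (\<Oplus>\<^bsub>P\<^esub>x\<in>?B. f x \<odot>\<^bsub>P\<^esub> \<phi> x) \<oplus>\<^bsub>P\<^esub> (\<Oplus>\<^bsub>P\<^esub>x\<in>?B. g x \<odot>\<^bsub>P\<^esub> \<phi> x)"
      by (rule P.M.finsum_addf) (use B val[OF f] val[OF g] \<phi> in auto)
    also have "\<dots> = h f \<oplus>\<^bsub>P\<^esub> h g" using h[OF f B(1) _ B(2)] h[OF g B(1) _ B(2)] by simp
    finally show "h (f \<oplus>\<^bsub>?E\<^esub> g) = h f \<oplus>\<^bsub>P\<^esub> h g" .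
  qed
  moreover have "h (basis_vec R x) = \<phi> x" if x: "x \<in> X" for x
    by (subst h[where B = "{x}"]) (use x \<phi> basis_vec_closed[OF x] in \<open>auto simp: basis_vec_def\<close>)
  ultimately show ?thesis by auto
qed


section \<open>Graded Leibniz brackets and homomorphisms\<close>

text \<open>
  A Leibniz superalgebra without the requirement that the homogeneous parts form a direct sum. This is what
  can be said about the non-abelian tensor square before it has been compared with another algebra, and it is
  enough for being the target of homomorphisms from presented algebras.
\<close>

locale graded_leibniz = module R L for R (structure) and L (structure) +
  assumes hpart_sub: "submodule (hpart L p) R L"
    and bracket_bilinear: "bilinear_map R L L L (bracket L)"
    and bracket_hpart: "\<lbrakk>x \<in> hpart L \<alpha>; y \<in> hpart L \<beta>\<rbrakk> \<Longrightarrow> bracket L x y \<in> hpart L (\<alpha> + \<beta>)"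
    and leibniz: "\<lbrakk>x \<in> hpart L \<alpha>; y \<in> hpart L \<beta>; z \<in> hpart L \<gamma>\<rbrakk> \<Longrightarrow>
      bracket L x (bracket L y z) =
        bracket L (bracket L x y) z \<ominus>\<^bsub>L\<^esub> sgn_pow R (\<beta> * \<gamma>) \<odot>\<^bsub>L\<^esub> bracket L (bracket L x z) y"

lemma graded_leibniz_if_leibniz_superalgebra:
  "leibniz_superalgebra R L \<Longrightarrow> graded_leibniz R L"
  by (intro graded_leibniz.intro graded_leibniz_axioms.intro)
    (auto simp: leibniz_superalgebra_def leibniz_superalgebra_axioms_def supermodule_def supermodule_axioms_def)

text \<open>
  The direct sum condition amounts to existence of decompositions and to the two parts meeting only in zero.
\<close>

lemma supermoduleI:
  assumes M: "module R M" and sub: "\<And>p. submodule (hpart M p) R M"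
    and ex: "\<And>x. x \<in> carrier M \<Longrightarrow> \<exists>x0\<in>hpart M 0. \<exists>x1\<in>hpart M 1. x = x0 \<oplus>\<^bsub>M\<^esub> x1"
    and int: "\<And>x. x \<in> hpart M 0 \<Longrightarrow> x \<in> hpart M 1 \<Longrightarrow> x = \<zero>\<^bsub>M\<^esub>"
  shows "supermodule R M"
proof (intro supermodule.intro supermodule_axioms.intro M sub)
  interpret M: module R M by fact
  fix x assume "x \<in> carrier M"
  then obtain x0 x1 where x: "x0 \<in> hpart M 0" "x1 \<in> hpart M 1" "x = x0 \<oplus>\<^bsub>M\<^esub> x1"
    using ex by blast
  show "\<exists>!z. z \<in> hpart M 0 \<times> hpart M 1 \<and> x = fst z \<oplus>\<^bsub>M\<^esub> snd z"
  proof (rule ex1I[of _ "(x0, x1)"])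
    fix z assume z: "z \<in> hpart M 0 \<times> hpart M 1 \<and> x = fst z \<oplus>\<^bsub>M\<^esub> snd z"
    obtain y0 y1 where y: "z = (y0, y1)" by (cases z)
    have c: "x0 \<in> carrier M" "x1 \<in> carrier M" "y0 \<in> carrier M" "y1 \<in> carrier M"
      using x z y submodule_carrier[OF sub] by auto
    have "(x0 \<ominus>\<^bsub>M\<^esub> y0) \<ominus>\<^bsub>M\<^esub> (y1 \<ominus>\<^bsub>M\<^esub> x1) = (x0 \<oplus>\<^bsub>M\<^esub> x1) \<ominus>\<^bsub>M\<^esub> (y0 \<oplus>\<^bsub>M\<^esub> y1)"
      using c by (simp add: a_minus_def M.M.minus_add M.M.a_ac)
    also have "\<dots> = \<zero>\<^bsub>M\<^esub>"
      using x z y c by (simp add: M.M.minus_eq_zero_iff)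
    finally have eq: "x0 \<ominus>\<^bsub>M\<^esub> y0 = y1 \<ominus>\<^bsub>M\<^esub> x1"
      using c M.M.minus_eq_zero_iff[of "x0 \<ominus>\<^bsub>M\<^esub> y0" "y1 \<ominus>\<^bsub>M\<^esub> x1"] by simp
    have "x0 \<ominus>\<^bsub>M\<^esub> y0 \<in> hpart M 0" "y1 \<ominus>\<^bsub>M\<^esub> x1 \<in> hpart M 1"
      using x z y by (auto intro: submodule_minus[OF sub])
    then have "x0 \<ominus>\<^bsub>M\<^esub> y0 = \<zero>\<^bsub>M\<^esub>" "y1 \<ominus>\<^bsub>M\<^esub> x1 = \<zero>\<^bsub>M\<^esub>" using int eq by auto
    then show "z = (x0, x1)" using c y by (simp add: M.M.minus_eq_zero_iff)
  qed (use x in auto)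
qed

lemma supermodule_decompose:
  assumes "supermodule R M" "x \<in> carrier M"
  obtains x0 x1 where "x0 \<in> hpart M 0" "x1 \<in> hpart M 1" "x = x0 \<oplus>\<^bsub>M\<^esub> x1"
proof -
  from supermodule.hpart_direct_sum[OF assms]
  obtain z where "z \<in> hpart M 0 \<times> hpart M 1" "x = fst z \<oplus>\<^bsub>M\<^esub> snd z" by (elim ex1E conjE)
  then show thesis using that by auto
qed

lemma supermodule_decomposition_unique:
  assumes S: "supermodule R M" and x: "x0 \<in> hpart M 0" "x1 \<in> hpart M 1"
    and y: "y0 \<in> hpart M 0" "y1 \<in> hpart M 1" and eq: "x0 \<oplus>\<^bsub>M\<^esub> x1 = y0 \<oplus>\<^bsub>M\<^esub> y1"
  shows "x0 = y0" "x1 = y1"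
proof -
  interpret M: supermodule R M by fact
  have "x0 \<oplus>\<^bsub>M\<^esub> x1 \<in> carrier M" using x submodule_carrier[OF M.hpart_submodule] by auto
  from M.hpart_direct_sum[OF this] obtain z where
    "\<And>w. w \<in> hpart M 0 \<times> hpart M 1 \<and> x0 \<oplus>\<^bsub>M\<^esub> x1 = fst w \<oplus>\<^bsub>M\<^esub> snd w \<Longrightarrow> w = z"
    by (elim ex1E) blast
  from this[of "(x0, x1)"] this[of "(y0, y1)"] have "(x0, x1) = (y0, y1)" using x y eq by simp
  then show "x0 = y0" "x1 = y1" by auto
qed

definition bracket_hom ::
  "('r, 'rm) ring_scheme \<Rightarrow> ('r, 'a, 'am) superalgebra_scheme \<Rightarrow>
   ('r, 'b, 'bm) superalgebra_scheme \<Rightarrow> ('a \<Rightarrow> 'b) \<Rightarrow> bool" where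
  "bracket_hom R L P h \<longleftrightarrow> linear_map R L P h \<and>
     (\<forall>x\<in>carrier L. \<forall>y\<in>carrier L. h (bracket L x y) = bracket P (h x) (h y))"

definition graded_map ::
  "('r, 'a, 'am) supermodule_scheme \<Rightarrow> ('r, 'b, 'bm) supermodule_scheme \<Rightarrow> ('a \<Rightarrow> 'b) \<Rightarrow> bool" where
  "graded_map M P h \<longleftrightarrow> (\<forall>p. \<forall>x\<in>hpart M p. h x \<in> hpart P p)"

lemma (in cring) sgn_pow_closed [simp]: "sgn_pow R p \<in> carrier R"
  by (simp add: sgn_pow_def)

lemma bilinear_map_closed: "bilinear_map R M N P f \<Longrightarrow> x \<in> carrier M \<Longrightarrow> y \<in> carrier N \<Longrightarrow> f x y \<in> carrier P"
  and bilinear_map_left: "bilinear_map R M N P f \<Longrightarrow> y \<in> carrier N \<Longrightarrow> linear_map R M P (\<lambda>x. f x y)"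
  and bilinear_map_right: "bilinear_map R M N P f \<Longrightarrow> x \<in> carrier M \<Longrightarrow> linear_map R N P (f x)"
  by (auto simp: bilinear_map_iff linear_map_def)


section \<open>Quotients of graded algebras by ideals\<close>

lemma quot_superalgebra_simps:
  "carrier (quot_superalgebra A I) = a_rcosets\<^bsub>A\<^esub> I"
  "zero (quot_superalgebra A I) = I"
  "add (quot_superalgebra A I) = set_add A"
  "smult (quot_superalgebra A I) = (\<lambda>r U. \<Union>u\<in>U. I +>\<^bsub>A\<^esub> (r \<odot>\<^bsub>A\<^esub> u))"
  "hpart (quot_superalgebra A I) = (\<lambda>p. (\<lambda>x. I +>\<^bsub>A\<^esub> x) ` hpart A p)"
  "bracket (quot_superalgebra A I) = (\<lambda>U V. \<Union>u\<in>U. \<Union>v\<in>V. I +>\<^bsub>A\<^esub> (bracket A u v))"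
  by (simp_all add: quot_superalgebra_def quot_supermodule_def quot_module_def
      module.defs supermodule.defs superalgebra.defs)

lemma quot_superalgebra_module:
  assumes "module R A" "two_sided_ideal R A I"
  shows "module R (quot_superalgebra A I)"
    "quotient_map R A I (quot_superalgebra A I) (\<lambda>x. I +>\<^bsub>A\<^esub> x)"
  using assms(2) quotient_module[OF assms(1), where Q = "quot_superalgebra A I" and N = I]
  by (simp_all add: quot_superalgebra_simps two_sided_ideal_def)

text \<open>
  The bracket of cosets is a union over representatives; it collapses to one coset since changing
  representatives by \<open>i, j \<in> I\<close> changes the bracket by \<open>[i, v] + [x, j]\<close>, which lies in the ideal.
\<close>

lemma quot_superalgebra_bracket:
  assumes A: "module R A" and b: "bilinear_map R A A A (bracket A)" and I: "two_sided_ideal R A I"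
    and x: "x \<in> carrier A" and y: "y \<in> carrier A"
  shows "bracket (quot_superalgebra A I) (I +>\<^bsub>A\<^esub> x) (I +>\<^bsub>A\<^esub> y) = I +>\<^bsub>A\<^esub> (bracket A x y)"
proof -
  interpret A: module R A by fact
  have sub: "submodule I R A" using I by (simp add: two_sided_ideal_def)
  note Q = quot_superalgebra_module[OF A I]
  have coset: "u \<in> I +>\<^bsub>A\<^esub> z \<Longrightarrow> \<exists>i\<in>I. u = i \<oplus>\<^bsub>A\<^esub> z" for u z
    by (auto simp: a_r_coset_def')
  have self: "z \<in> I +>\<^bsub>A\<^esub> z" if "z \<in> carrier A" for z
    using submodule_zero[OF sub] that by (force simp: a_r_coset_def')
  have eq: "I +>\<^bsub>A\<^esub> bracket A u v = I +>\<^bsub>A\<^esub> bracket A x y" if uv: "u \<in> I +>\<^bsub>A\<^esub> x" "v \<in> I +>\<^bsub>A\<^esub> y" for u v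
  proof -
    obtain i j where ij: "i \<in> I" "j \<in> I" "u = i \<oplus>\<^bsub>A\<^esub> x" "v = j \<oplus>\<^bsub>A\<^esub> y" using coset uv by metis
    have c: "i \<in> carrier A" "j \<in> carrier A" using ij submodule_carrier[OF sub] by auto
    note cl = bilinear_map_closed[OF b]
    have "bracket A u v = bracket A i v \<oplus>\<^bsub>A\<^esub> (bracket A x j \<oplus>\<^bsub>A\<^esub> bracket A x y)"
      using c x y b cl by (simp add: ij bilinear_map_def A.M.a_ac)
    then have "bracket A u v \<ominus>\<^bsub>A\<^esub> bracket A x y = bracket A i v \<oplus>\<^bsub>A\<^esub> bracket A x j"
      using c x y cl by (simp add: a_minus_def A.M.a_assoc A.M.r_neg ij)
    moreover have "bracket A i v \<in> I" "bracket A x j \<in> I"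
      using I ij c x y by (auto simp: two_sided_ideal_def)
    ultimately have "bracket A u v \<ominus>\<^bsub>A\<^esub> bracket A x y \<in> I" using submodule_add[OF sub] by auto
    then show ?thesis
      using quotient_map_eq_iff[OF A Q, of "bracket A u v" "bracket A x y"] c x y ij cl by auto
  qed
  have "(\<Union>u\<in>I +>\<^bsub>A\<^esub> x. \<Union>v\<in>I +>\<^bsub>A\<^esub> y. I +>\<^bsub>A\<^esub> bracket A u v) =
      (\<Union>u\<in>I +>\<^bsub>A\<^esub> x. \<Union>v\<in>I +>\<^bsub>A\<^esub> y. I +>\<^bsub>A\<^esub> bracket A x y)"
    by (intro SUP_cong refl eq)
  also have "\<dots> = I +>\<^bsub>A\<^esub> bracket A x y" using self[OF x] self[OF y] by auto
  finally show ?thesis by (simp add: quot_superalgebra_simps)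
qed

lemma two_sided_ideal_hull:
  assumes "module R A" "bilinear_map R A A A (bracket A)" "S \<subseteq> carrier A"
  shows "two_sided_ideal R A (two_sided_ideal R A hull S)"
proof -
  have "two_sided_ideal R A (carrier A)"
    using assms module.carrier_is_submodule by (auto simp: two_sided_ideal_def intro: bilinear_map_closed)
  then have "submodule (two_sided_ideal R A hull S) R A"
    unfolding hull_def using assms(3)
    by (intro submodule_Inter[OF assms(1)]) (auto simp: two_sided_ideal_def)
  then show ?thesis by (auto simp: two_sided_ideal_def hull_def)
qed

text \<open>
  The sums of an even and an odd element of the ideal form an ideal \<open>J\<close> that contains the homogeneous generators,
  hence \<open>J\<close> is the whole ideal. Uniqueness of decompositions then puts each component into the ideal.
\<close>

lemma homogeneous_ideal:
  assumes A: "supermodule R A" and b: "bilinear_map R A A A (bracket A)"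
    and gr: "\<And>\<alpha> \<beta> x y. x \<in> hpart A \<alpha> \<Longrightarrow> y \<in> hpart A \<beta> \<Longrightarrow> bracket A x y \<in> hpart A (\<alpha> + \<beta>)"
    and S: "S \<subseteq> hpart A 0 \<union> hpart A 1"
    and x: "x0 \<in> hpart A 0" "x1 \<in> hpart A 1" "x0 \<oplus>\<^bsub>A\<^esub> x1 \<in> two_sided_ideal R A hull S"
  shows "x0 \<in> two_sided_ideal R A hull S"
proof -
  interpret A: supermodule R A by fact
  let ?I = "two_sided_ideal R A hull S"
  note sub = A.hpart_submodule
  have hc: "u \<in> hpart A p \<Longrightarrow> u \<in> carrier A" for u p using submodule_carrier[OF sub] .
  have I: "two_sided_ideal R A ?I"
    using S hc by (intro two_sided_ideal_hull[OF A.module_axioms b]) auto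
  then have Isub: "submodule ?I R A" by (simp add: two_sided_ideal_def)
  \<comment> \<open>By definition every element of \<open>J\<close> has both components in the ideal.\<close>
  define J where "J = {u0 \<oplus>\<^bsub>A\<^esub> u1 | u0 u1. u0 \<in> ?I \<inter> hpart A 0 \<and> u1 \<in> ?I \<inter> hpart A 1}"
  have JI: "u0 \<oplus>\<^bsub>A\<^esub> u1 \<in> J" if "u0 \<in> ?I" "u0 \<in> hpart A 0" "u1 \<in> ?I" "u1 \<in> hpart A 1" for u0 u1
    using that by (auto simp: J_def)
  have J: "submodule J R A"
  proof (rule A.submoduleI')
    show "\<zero>\<^bsub>A\<^esub> \<in> J"
      using JI[of "\<zero>\<^bsub>A\<^esub>" "\<zero>\<^bsub>A\<^esub>"] submodule_zero[OF sub] submodule_zero[OF Isub] by auto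
    show "u \<oplus>\<^bsub>A\<^esub> v \<in> J" if uv: "u \<in> J" "v \<in> J" for u v
    proof -
      obtain u0 u1 v0 v1 where *: "u = u0 \<oplus>\<^bsub>A\<^esub> u1" "v = v0 \<oplus>\<^bsub>A\<^esub> v1" "u0 \<in> ?I" "u1 \<in> ?I" "v0 \<in> ?I" "v1 \<in> ?I"
        "u0 \<in> hpart A 0" "u1 \<in> hpart A 1" "v0 \<in> hpart A 0" "v1 \<in> hpart A 1"
        using uv by (auto simp: J_def)
      have "u \<oplus>\<^bsub>A\<^esub> v = (u0 \<oplus>\<^bsub>A\<^esub> v0) \<oplus>\<^bsub>A\<^esub> (u1 \<oplus>\<^bsub>A\<^esub> v1)"
        using * by (simp add: A.M.a_ac hc)
      then show ?thesis using * by (auto intro!: JI submodule_add[OF Isub] submodule_add[OF sub])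
    qed
    show "r \<odot>\<^bsub>A\<^esub> u \<in> J" if "r \<in> carrier R" "u \<in> J" for r u
    proof -
      obtain u0 u1 where *: "u = u0 \<oplus>\<^bsub>A\<^esub> u1" "u0 \<in> ?I" "u1 \<in> ?I" "u0 \<in> hpart A 0" "u1 \<in> hpart A 1"
        using \<open>u \<in> J\<close> by (auto simp: J_def)
      then have "r \<odot>\<^bsub>A\<^esub> u = r \<odot>\<^bsub>A\<^esub> u0 \<oplus>\<^bsub>A\<^esub> r \<odot>\<^bsub>A\<^esub> u1" using that hc by (simp add: A.smult_r_distr)
      then show ?thesis
        using * \<open>r \<in> carrier R\<close> by (auto intro!: JI submodule_smult[OF Isub] submodule_smult[OF sub])
    qed
  qed (auto simp: J_def hc)
  have mult: "bracket A y u \<in> J \<and> bracket A u y \<in> J" if y: "y \<in> carrier A" and u: "u \<in> J" for y u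
  proof -
    obtain y0 y1 where y': "y0 \<in> hpart A 0" "y1 \<in> hpart A 1" "y = y0 \<oplus>\<^bsub>A\<^esub> y1"
      using supermodule_decompose[OF A y] .
    obtain u0 u1 where u': "u = u0 \<oplus>\<^bsub>A\<^esub> u1" "u0 \<in> ?I" "u1 \<in> ?I" "u0 \<in> hpart A 0" "u1 \<in> hpart A 1"
      using u by (auto simp: J_def)
    note c = hc[OF y'(1)] hc[OF y'(2)] hc[OF u'(4)] hc[OF u'(5)]
    note cl = bilinear_map_closed[OF b]
    have "bracket A y u = (bracket A y0 u0 \<oplus>\<^bsub>A\<^esub> bracket A y1 u1) \<oplus>\<^bsub>A\<^esub> (bracket A y0 u1 \<oplus>\<^bsub>A\<^esub> bracket A y1 u0)"
      using c b by (simp add: y' u' bilinear_map_def A.M.a_ac)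
    moreover have "bracket A u y = (bracket A u0 y0 \<oplus>\<^bsub>A\<^esub> bracket A u1 y1) \<oplus>\<^bsub>A\<^esub> (bracket A u1 y0 \<oplus>\<^bsub>A\<^esub> bracket A u0 y1)"
      using c b by (simp add: y' u' bilinear_map_def A.M.a_ac)
    moreover have "bracket A y0 u0 \<in> ?I" "bracket A y1 u1 \<in> ?I" "bracket A y0 u1 \<in> ?I" "bracket A y1 u0 \<in> ?I"
       "bracket A u0 y0 \<in> ?I" "bracket A u1 y1 \<in> ?I" "bracket A u1 y0 \<in> ?I" "bracket A u0 y1 \<in> ?I"
      using I c u' by (auto simp: two_sided_ideal_def)
    moreover have "bracket A y0 u0 \<in> hpart A 0" "bracket A y1 u1 \<in> hpart A 0" "bracket A y0 u1 \<in> hpart A 1" "bracket A y1 u0 \<in> hpart A 1"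
       "bracket A u0 y0 \<in> hpart A 0" "bracket A u1 y1 \<in> hpart A 0" "bracket A u1 y0 \<in> hpart A 1" "bracket A u0 y1 \<in> hpart A 1"
      using gr[OF y'(1) u'(4)] gr[OF y'(2) u'(5)] gr[OF y'(1) u'(5)] gr[OF y'(2) u'(4)]
        gr[OF u'(4) y'(1)] gr[OF u'(5) y'(2)] gr[OF u'(5) y'(1)] gr[OF u'(4) y'(2)] by simp_all
    ultimately show ?thesis
      by (auto intro!: JI submodule_add[OF Isub] submodule_add[OF sub])
  qed
  have SJ: "S \<subseteq> J"
  proof
    fix s assume s: "s \<in> S"
    have sI: "s \<in> ?I" using s by (auto simp: hull_def)
    have z: "\<zero>\<^bsub>A\<^esub> \<in> ?I" "\<zero>\<^bsub>A\<^esub> \<in> hpart A p" for p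
      using submodule_zero[OF Isub] submodule_zero[OF sub] by auto
    from s S consider "s \<in> hpart A 0" | "s \<in> hpart A 1" by auto
    then show "s \<in> J"
    proof cases
      case 1
      then show ?thesis using JI[OF sI _ z] hc[OF 1] by simp
    next
      case 2
      then show ?thesis using JI[OF z sI] hc[OF 2] by simp
    qed
  qed
  have "?I \<subseteq> J" using J mult SJ by (intro hull_minimal) (auto simp: two_sided_ideal_def)
  then obtain u0 u1 where "x0 \<oplus>\<^bsub>A\<^esub> x1 = u0 \<oplus>\<^bsub>A\<^esub> u1" "u0 \<in> ?I" "u0 \<in> hpart A 0" "u1 \<in> hpart A 1"
    using x(3) by (auto simp: J_def)
  then show ?thesis using supermodule_decomposition_unique(1)[OF A x(1,2)] by metis
qed

lemma leibniz_relators_homogeneous: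
  assumes A: "supermodule R A"
    and gr: "\<And>\<alpha> \<beta> x y. x \<in> hpart A \<alpha> \<Longrightarrow> y \<in> hpart A \<beta> \<Longrightarrow> bracket A x y \<in> hpart A (\<alpha> + \<beta>)"
  shows "leibniz_relators R A \<subseteq> hpart A 0 \<union> hpart A 1"
proof
  interpret A: supermodule R A by fact
  fix s assume "s \<in> leibniz_relators R A"
  then obtain x y z \<alpha> \<beta> \<gamma> where *: "x \<in> hpart A \<alpha>" "y \<in> hpart A \<beta>" "z \<in> hpart A \<gamma>" and s:
    "s = bracket A x (bracket A y z) \<ominus>\<^bsub>A\<^esub>
        (bracket A (bracket A x y) z \<ominus>\<^bsub>A\<^esub> sgn_pow R (\<beta> * \<gamma>) \<odot>\<^bsub>A\<^esub> bracket A (bracket A x z) y)"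
    unfolding leibniz_relators_def by blast
  have "bracket A x (bracket A y z) \<in> hpart A (\<alpha> + \<beta> + \<gamma>)" "bracket A (bracket A x y) z \<in> hpart A (\<alpha> + \<beta> + \<gamma>)"
    "bracket A (bracket A x z) y \<in> hpart A (\<alpha> + \<beta> + \<gamma>)"
    using gr[OF *(1) gr[OF *(2,3)]] gr[OF gr[OF *(1,2)] *(3)] gr[OF gr[OF *(1,3)] *(2)]
    by (simp_all only: add.assoc add.commute add.left_commute)
  then have "s \<in> hpart A (\<alpha> + \<beta> + \<gamma>)"
    unfolding s by (intro submodule_minus[OF A.hpart_submodule] submodule_smult[OF A.hpart_submodule]) auto
  then show "s \<in> hpart A 0 \<union> hpart A 1" by (cases "\<alpha> + \<beta> + \<gamma>") auto
qed

text \<open>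
  Homogeneity of the ideal is what keeps the two parts of the quotient independent. The Leibniz identity holds
  because its failures are among the generators of the ideal.
\<close>

lemma quot_superalgebra_leibniz:
  assumes A: "supermodule R A" and b: "bilinear_map R A A A (bracket A)"
    and gr: "\<And>\<alpha> \<beta> x y. x \<in> hpart A \<alpha> \<Longrightarrow> y \<in> hpart A \<beta> \<Longrightarrow> bracket A x y \<in> hpart A (\<alpha> + \<beta>)"
    and S: "S \<subseteq> hpart A 0 \<union> hpart A 1" "leibniz_relators R A \<subseteq> S"
  shows "leibniz_superalgebra R (quot_superalgebra A (two_sided_ideal R A hull S))"
proof -
  interpret A: supermodule R A by fact
  let ?I = "two_sided_ideal R A hull S"
  let ?Q = "quot_superalgebra A ?I"
  let ?\<pi> = "\<lambda>x. ?I +>\<^bsub>A\<^esub> x"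
  note sub = A.hpart_submodule
  have hc: "u \<in> hpart A p \<Longrightarrow> u \<in> carrier A" for u p using submodule_carrier[OF sub] .
  have I: "two_sided_ideal R A ?I"
    using S(1) hc by (intro two_sided_ideal_hull[OF A.module_axioms b]) auto
  then have Isub: "submodule ?I R A" by (simp add: two_sided_ideal_def)
  note Q = quot_superalgebra_module[OF A.module_axioms I]
  interpret Q: module R ?Q by (rule Q(1))
  have lin: "linear_map R A ?Q ?\<pi>" and im: "carrier ?Q = ?\<pi> ` carrier A"
    using Q(2) by (auto simp: quotient_map_def)
  note br = quot_superalgebra_bracket[OF A.module_axioms b I]
  note cl = bilinear_map_closed[OF b]
  have hq: "hpart ?Q p = ?\<pi> ` hpart A p" for p by (simp add: quot_superalgebra_simps)
  have hsub: "submodule (hpart ?Q p) R ?Q" for p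
    unfolding hq by (rule submodule_image[OF A.module_axioms Q(1) lin sub])
  have sm: "supermodule R ?Q"
  proof (rule supermoduleI[OF Q(1) hsub])
    fix X assume "X \<in> carrier ?Q"
    then obtain x where x: "x \<in> carrier A" "X = ?\<pi> x" using im by auto
    obtain x0 x1 where x': "x0 \<in> hpart A 0" "x1 \<in> hpart A 1" "x = x0 \<oplus>\<^bsub>A\<^esub> x1"
      using supermodule_decompose[OF A x(1)] .
    then show "\<exists>X0\<in>hpart ?Q 0. \<exists>X1\<in>hpart ?Q 1. X = X0 \<oplus>\<^bsub>?Q\<^esub> X1"
      using x(2) hc linear_map_add[OF lin] by (auto simp: hq)
  next
    fix X assume "X \<in> hpart ?Q 0" "X \<in> hpart ?Q 1"
    then obtain x y where xy: "x \<in> hpart A 0" "y \<in> hpart A 1" "X = ?\<pi> x" "X = ?\<pi> y" by (auto simp: hq)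
    then have "x \<ominus>\<^bsub>A\<^esub> y \<in> ?I"
      using quotient_map_eq_iff[OF A.module_axioms Q, of x y] hc by auto
    then have 1: "x \<oplus>\<^bsub>A\<^esub> (\<ominus>\<^bsub>A\<^esub> y) \<in> ?I" by (simp add: a_minus_def)
    have "x \<in> ?I"
      by (rule homogeneous_ideal[OF A b _ S(1) xy(1) submodule_uminus[OF sub xy(2)] 1]) (rule gr)
    then show "X = \<zero>\<^bsub>?Q\<^esub>" using Q(2) xy(1,3) hc by (auto simp: quotient_map_def)
  qed
  show ?thesis
  proof (intro leibniz_superalgebra.intro leibniz_superalgebra_axioms.intro sm)
    show "bilinear_map R ?Q ?Q ?Q (bracket ?Q)"
      using b unfolding bilinear_map_def im
      by (auto simp: br cl linear_map_add[OF lin, symmetric] linear_map_smult[OF lin, symmetric])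
    show "bracket ?Q X Y \<in> hpart ?Q (\<alpha> + \<beta>)" if "X \<in> hpart ?Q \<alpha>" "Y \<in> hpart ?Q \<beta>" for X Y \<alpha> \<beta>
    proof -
      obtain x y where xy: "x \<in> hpart A \<alpha>" "y \<in> hpart A \<beta>" "X = ?\<pi> x" "Y = ?\<pi> y"
        using \<open>X \<in> hpart ?Q \<alpha>\<close> \<open>Y \<in> hpart ?Q \<beta>\<close> by (auto simp: hq)
      then have "bracket ?Q X Y = ?\<pi> (bracket A x y)" by (simp add: br hc)
      then show ?thesis using gr[OF xy(1,2)] unfolding hq by blast
    qed
    fix X Y Z \<alpha> \<beta> \<gamma> assume XYZ: "X \<in> hpart ?Q \<alpha>" "Y \<in> hpart ?Q \<beta>" "Z \<in> hpart ?Q \<gamma>"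
    obtain x y z where *: "x \<in> hpart A \<alpha>" "y \<in> hpart A \<beta>" "z \<in> hpart A \<gamma>" and XYZ': "X = ?\<pi> x" "Y = ?\<pi> y" "Z = ?\<pi> z"
      using XYZ by (auto simp: hq)
    note c = *[THEN hc]
    let ?l = "bracket A x (bracket A y z)"
    let ?r = "bracket A (bracket A x y) z"
    let ?s = "sgn_pow R (\<beta> * \<gamma>) \<odot>\<^bsub>A\<^esub> bracket A (bracket A x z) y"
    have "?l \<ominus>\<^bsub>A\<^esub> (?r \<ominus>\<^bsub>A\<^esub> ?s) \<in> leibniz_relators R A"
      unfolding leibniz_relators_def using * by blast
    then have "?l \<ominus>\<^bsub>A\<^esub> (?r \<ominus>\<^bsub>A\<^esub> ?s) \<in> ?I" by (intro hull_inc subsetD[OF S(2)])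
    then have "?\<pi> ?l = ?\<pi> (?r \<ominus>\<^bsub>A\<^esub> ?s)"
      using quotient_map_eq_iff[OF A.module_axioms Q] c cl by simp
    also have "\<dots> = ?\<pi> ?r \<ominus>\<^bsub>?Q\<^esub> sgn_pow R (\<beta> * \<gamma>) \<odot>\<^bsub>?Q\<^esub> ?\<pi> (bracket A (bracket A x z) y)"
      using c cl by (simp add: linear_map_minus[OF A.module_axioms Q(1) lin] linear_map_smult[OF lin])
    finally show "bracket ?Q X (bracket ?Q Y Z) =
        bracket ?Q (bracket ?Q X Y) Z \<ominus>\<^bsub>?Q\<^esub> sgn_pow R (\<beta> * \<gamma>) \<odot>\<^bsub>?Q\<^esub> bracket ?Q (bracket ?Q X Z) Y"
      using c cl by (simp add: XYZ' br)
  qed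
qed


section \<open>Free superalgebras and presentations\<close>

lemma free_superalgebra_simps:
  "carrier (free_superalgebra R X deg) = carrier (free_module R {t. set_monomial t \<subseteq> X})"
  "zero (free_superalgebra R X deg) = zero (free_module R {t. set_monomial t \<subseteq> X})"
  "add (free_superalgebra R X deg) = add (free_module R {t. set_monomial t \<subseteq> X})"
  "smult (free_superalgebra R X deg) = smult (free_module R {t. set_monomial t \<subseteq> X})"
  "hpart (free_superalgebra R X deg) = (\<lambda>p. {f \<in> carrier (free_module R {t. set_monomial t \<subseteq> X}).
      \<forall>t. f t \<noteq> \<zero>\<^bsub>R\<^esub> \<longrightarrow> mdeg deg t = p})"
  "bracket (free_superalgebra R X deg) =
     (\<lambda>f g t. case t of Gen x \<Rightarrow> \<zero>\<^bsub>R\<^esub> | Prod u v \<Rightarrow> f u \<otimes>\<^bsub>R\<^esub> g v)"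
  by (simp_all add: free_superalgebra_def Let_def free_module_def
      module.defs supermodule.defs superalgebra.defs)

lemma linear_map_free_superalgebra:
  "linear_map R (free_superalgebra R X deg) P h \<longleftrightarrow> linear_map R (free_module R {t. set_monomial t \<subseteq> X}) P h"
  "linear_map R M (free_superalgebra R X deg) k \<longleftrightarrow> linear_map R M (free_module R {t. set_monomial t \<subseteq> X}) k"
  by (simp_all add: linear_map_def free_superalgebra_simps)

lemma (in cring) free_superalgebra_module: "module R (free_superalgebra R X deg)"
  by (rule module_surjective_image[OF free_module_module, where h = "\<lambda>x. x"])
    (auto simp: linear_map_free_superalgebra linear_map_id free_superalgebra_simps)

lemma submodule_free_superalgebra:
  "submodule N R (free_superalgebra R X deg) \<longleftrightarrow> submodule N R (free_module R {t. set_monomial t \<subseteq> X})"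
  by (simp add: submodule_def submodule_axioms_def free_superalgebra_simps subgroup_def m_inv_def)

lemma (in cring) free_superalgebra_hpart:
  "submodule (hpart (free_superalgebra R X deg) p) R (free_superalgebra R X deg)"
proof -
  let ?A = "free_superalgebra R X deg"
  interpret A: module R ?A by (rule free_superalgebra_module)
  note v = free_module_value
  have c: "f \<in> carrier ?A" if "f \<in> hpart ?A p" for f using that by (simp add: free_superalgebra_simps)
  show ?thesis
  proof (rule A.submoduleI'[OF c])
    show "\<zero>\<^bsub>?A\<^esub> \<in> hpart ?A p"
      using A.M.zero_closed by (simp add: free_superalgebra_simps free_module_simps(2))
    show "f \<oplus>\<^bsub>?A\<^esub> g \<in> hpart ?A p" if "f \<in> hpart ?A p" "g \<in> hpart ?A p" for f g
    proof -
      have "f \<oplus>\<^bsub>?A\<^esub> g \<in> carrier ?A" using that by (intro A.M.a_closed c)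
      moreover have "mdeg deg t = p" if t: "f t \<oplus> g t \<noteq> \<zero>" for t
      proof -
        have "f t \<noteq> \<zero> \<or> g t \<noteq> \<zero>" using t by auto
        then show ?thesis using \<open>f \<in> hpart ?A p\<close> \<open>g \<in> hpart ?A p\<close> by (auto simp: free_superalgebra_simps)
      qed
      ultimately show ?thesis by (simp add: free_superalgebra_simps free_module_simps(3))
    qed
    show "r \<odot>\<^bsub>?A\<^esub> f \<in> hpart ?A p" if "r \<in> carrier R" "f \<in> hpart ?A p" for r f
    proof -
      have "r \<odot>\<^bsub>?A\<^esub> f \<in> carrier ?A" using that by (intro A.smult_closed c)
      moreover have "mdeg deg t = p" if t: "r \<otimes> f t \<noteq> \<zero>" for t
      proof -
        have "f t \<noteq> \<zero>" using t \<open>r \<in> carrier R\<close> by auto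
        then show ?thesis using \<open>f \<in> hpart ?A p\<close> by (auto simp: free_superalgebra_simps)
      qed
      ultimately show ?thesis by (simp add: free_superalgebra_simps free_module_simps(4))
    qed
  qed
qed

lemma (in cring) free_superalgebra_supermodule: "supermodule R (free_superalgebra R X deg)"
proof (rule supermoduleI[OF free_superalgebra_module free_superalgebra_hpart])
  let ?A = "free_superalgebra R X deg"
  fix f assume f: "f \<in> carrier ?A"
  then have f': "f \<in> carrier (free_module R {t. set_monomial t \<subseteq> X})" by (simp add: free_superalgebra_simps)
  \<comment> \<open>The homogeneous component of degree \<open>p\<close>.\<close>
  define g where "g p t = (if mdeg deg t = p then f t else \<zero>)" for p t
  have "g p \<in> carrier (free_module R {t. set_monomial t \<subseteq> X})" for p
  proof -
    have "finite {t. g p t \<noteq> \<zero>}"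
      by (rule finite_subset[of _ "{t. f t \<noteq> \<zero>}"]) (use f' in \<open>auto simp: g_def free_module_simps\<close>)
    then show ?thesis using f' by (auto simp: g_def free_module_simps)
  qed
  then have "g p \<in> hpart ?A p" for p by (auto simp: free_superalgebra_simps g_def)
  moreover have "f = g 0 \<oplus>\<^bsub>?A\<^esub> g 1"
    using free_module_value[OF f'] by (auto simp: free_superalgebra_simps free_module_simps(3) g_def)
  ultimately show "\<exists>f0\<in>hpart ?A 0. \<exists>f1\<in>hpart ?A 1. f = f0 \<oplus>\<^bsub>?A\<^esub> f1" by blast
next
  let ?A = "free_superalgebra R X deg"
  fix f assume f: "f \<in> hpart ?A 0" "f \<in> hpart ?A 1"
  have "f t = \<zero>" for t using f by (fastforce simp: free_superalgebra_simps)
  then show "f = \<zero>\<^bsub>?A\<^esub>" by (auto simp: free_superalgebra_simps free_module_simps(2))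
qed

lemma (in cring) free_superalgebra_bracket_closed:
  assumes f: "f \<in> carrier (free_superalgebra R X deg)" and g: "g \<in> carrier (free_superalgebra R X deg)"
  shows "bracket (free_superalgebra R X deg) f g \<in> carrier (free_superalgebra R X deg)"
proof -
  let ?b = "\<lambda>t. case t of Gen x \<Rightarrow> \<zero> | Prod u v \<Rightarrow> f u \<otimes> g v"
  have f': "f \<in> carrier (free_module R {t. set_monomial t \<subseteq> X})"
    and g': "g \<in> carrier (free_module R {t. set_monomial t \<subseteq> X})"
    using f g by (simp_all add: free_superalgebra_simps)
  note v = free_module_value[OF f'] free_module_value[OF g']
  have "{t. ?b t \<noteq> \<zero>} \<subseteq> (\<lambda>(u, v). Prod u v) ` ({t. f t \<noteq> \<zero>} \<times> {t. g t \<noteq> \<zero>})"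
  proof
    fix t assume t: "t \<in> {t. ?b t \<noteq> \<zero>}"
    then obtain u w where uw: "t = Prod u w" by (cases t) auto
    then have "f u \<noteq> \<zero>" "g w \<noteq> \<zero>" using t v by auto
    then show "t \<in> (\<lambda>(u, v). Prod u v) ` ({t. f t \<noteq> \<zero>} \<times> {t. g t \<noteq> \<zero>})" using uw by auto
  qed
  moreover have "finite {t. f t \<noteq> \<zero>}" "finite {t. g t \<noteq> \<zero>}"
    using f' g' by (auto simp: free_module_simps)
  ultimately have "finite {t. ?b t \<noteq> \<zero>}" by (meson finite_SigmaI finite_imageI finite_subset)
  moreover have "?b t = \<zero>" if t: "\<not> set_monomial t \<subseteq> X" for t
  proof (cases t)
    case (Prod u w)
    then have "f u = \<zero> \<or> g w = \<zero>" using t f' g' by (auto simp: free_module_simps)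
    then show ?thesis using v Prod by auto
  qed simp
  moreover have "?b t \<in> carrier R" for t using v by (cases t) auto
  ultimately show ?thesis unfolding free_superalgebra_simps free_module_simps(1) by simp
qed

lemma (in cring) free_superalgebra_bilinear:
  "bilinear_map R (free_superalgebra R X deg) (free_superalgebra R X deg) (free_superalgebra R X deg)
     (bracket (free_superalgebra R X deg))"
proof -
  let ?A = "free_superalgebra R X deg"
  have v: "f t \<in> carrier R" if "f \<in> carrier ?A" for f t
    using that free_module_value by (auto simp: free_superalgebra_simps)
  show ?thesis
    unfolding bilinear_map_def
    by (intro conjI ballI free_superalgebra_bracket_closed;
        (assumption | simp add: free_superalgebra_simps(3,4,6) free_module_simps(3,4) fun_eq_iff v
            l_distr r_distr m_assoc m_lcomm split: monomial.split))
qed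

lemma (in cring) free_superalgebra_bracket_hpart:
  assumes f: "f \<in> hpart (free_superalgebra R X deg) \<alpha>" and g: "g \<in> hpart (free_superalgebra R X deg) \<beta>"
  shows "bracket (free_superalgebra R X deg) f g \<in> hpart (free_superalgebra R X deg) (\<alpha> + \<beta>)"
proof -
  let ?A = "free_superalgebra R X deg"
  have c: "f \<in> carrier ?A" "g \<in> carrier ?A" using f g by (auto simp: free_superalgebra_simps)
  have v: "f t \<in> carrier R" "g t \<in> carrier R" for t
    using c free_module_value by (auto simp: free_superalgebra_simps)
  have "mdeg deg t = \<alpha> + \<beta>" if t: "bracket ?A f g t \<noteq> \<zero>" for t
  proof (cases t)
    case (Gen x)
    then show ?thesis using t by (simp add: free_superalgebra_simps)
  next
    case (Prod u w)
    then have "f u \<noteq> \<zero>" "g w \<noteq> \<zero>" using t v by (auto simp: free_superalgebra_simps)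
    then show ?thesis using f g Prod by (auto simp: free_superalgebra_simps)
  qed
  then show ?thesis
    using free_superalgebra_bracket_closed[OF c] by (simp add: free_superalgebra_simps(1,5))
qed

lemma (in cring) basis_vec_bracket:
  "bracket (free_superalgebra R X deg) (basis_vec R u) (basis_vec R v) = basis_vec R (Prod u v)"
  by (auto simp: free_superalgebra_simps basis_vec_def fun_eq_iff split: monomial.split)

lemma (in cring) free_superalgebra_spans:
  "spans R (free_superalgebra R X deg) (basis_vec R ` {t. set_monomial t \<subseteq> X})"
  using free_module_spans[of "{t. set_monomial t \<subseteq> X}"]
  by (simp add: spans_def free_superalgebra_simps submodule_free_superalgebra)

lemma (in cring) basis_vec_hpart:
  "set_monomial t \<subseteq> X \<Longrightarrow> mdeg deg t = p \<Longrightarrow> basis_vec R t \<in> hpart (free_superalgebra R X deg) p"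
  using basis_vec_closed[of t "{t. set_monomial t \<subseteq> X}"] by (auto simp: free_superalgebra_simps basis_vec_def)

text \<open>
  A degree-preserving assignment on generators extends to monomials by recursion and to all elements by
  linearity. Compatibility with brackets is an equality of bilinear maps, so it suffices to see it on monomials,
  where it is the recursion equation.
\<close>

lemma (in cring) free_superalgebra_universal:
  assumes P: "graded_leibniz R P" and \<phi>: "\<And>x. x \<in> X \<Longrightarrow> \<phi> x \<in> hpart P (deg x)"
  shows "\<exists>h. bracket_hom R (free_superalgebra R X deg) P h \<and> graded_map (free_superalgebra R X deg) P h \<and>
    (\<forall>x\<in>X. h (basis_vec R (Gen x)) = \<phi> x)"
proof -
  interpret P: graded_leibniz R P by fact
  let ?A = "free_superalgebra R X deg"
  let ?X = "{t. set_monomial t \<subseteq> X}"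
  define \<psi> where "\<psi> = rec_monomial \<phi> (\<lambda>_ _. bracket P)"
  have \<psi>_simps: "\<psi> (Gen x) = \<phi> x" "\<psi> (Prod s t) = bracket P (\<psi> s) (\<psi> t)" for x s t
    by (simp_all add: \<psi>_def)
  have \<psi>: "\<psi> t \<in> hpart P (mdeg deg t)" if "set_monomial t \<subseteq> X" for t
    using that
  proof (induction t)
    case (Prod s t)
    then have "\<psi> s \<in> hpart P (mdeg deg s)" "\<psi> t \<in> hpart P (mdeg deg t)" by auto
    from P.bracket_hpart[OF this] show ?case by (simp only: \<psi>_simps mdeg.simps)
  qed (simp add: \<psi>_simps \<phi>)
  have hc: "u \<in> hpart P p \<Longrightarrow> u \<in> carrier P" for u p using submodule_carrier[OF P.hpart_sub] .
  obtain h where h: "linear_map R (free_module R ?X) P h" "\<And>t. set_monomial t \<subseteq> X \<Longrightarrow> h (basis_vec R t) = \<psi> t"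
    using free_module_universal[OF P.module_axioms, of ?X \<psi>] \<psi> hc by blast
  have lin: "linear_map R ?A P h" using h(1) by (simp add: linear_map_free_superalgebra)
  note A = free_superalgebra_module[of X deg]
  have "h (bracket ?A f g) = bracket P (h f) (h g)" if fg: "f \<in> carrier ?A" "g \<in> carrier ?A" for f g
  proof (rule bilinear_map_ext[OF A A P.module_axioms free_superalgebra_spans free_superalgebra_spans _ _ _ fg])
    show "bilinear_map R ?A ?A P (\<lambda>f g. h (bracket ?A f g))"
      using bilinear_map_comp[OF free_superalgebra_bilinear linear_map_id linear_map_id lin] .
    show "bilinear_map R ?A ?A P (\<lambda>f g. bracket P (h f) (h g))"
      using bilinear_map_comp[OF P.bracket_bilinear lin lin linear_map_id] .
    show "h (bracket ?A f g) = bracket P (h f) (h g)" if "f \<in> basis_vec R ` ?X" "g \<in> basis_vec R ` ?X" for f g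
      using that by (auto simp: basis_vec_bracket h(2) \<psi>_simps)
  qed
  moreover have "h f \<in> hpart P p" if f: "f \<in> hpart ?A p" for f p
  proof -
    have "f \<in> {f \<in> carrier (free_module R ?X). h f \<in> hpart P p}"
    proof (rule free_module_support_induct)
      show "f \<in> carrier (free_module R ?X)" using f by (simp add: free_superalgebra_simps)
      show "submodule {f \<in> carrier (free_module R ?X). h f \<in> hpart P p} R (free_module R ?X)"
        by (rule submodule_vimage[OF free_module_module P.module_axioms h(1) P.hpart_sub])
      fix t assume t: "f t \<noteq> \<zero>"
      then have "set_monomial t \<subseteq> X" "mdeg deg t = p"
        using f by (auto simp: free_superalgebra_simps free_module_simps)
      then show "basis_vec R t \<in> {f \<in> carrier (free_module R ?X). h f \<in> hpart P p}"
        using \<psi>[of t] h(2)[of t] basis_vec_closed[of t ?X] by auto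
    qed
    then show ?thesis by simp
  qed
  ultimately show ?thesis
    using lin h(2) by (intro exI[of _ h]) (auto simp: bracket_hom_def graded_map_def \<psi>_simps)
qed

definition presented_proj ::
  "('r, 'rm) ring_scheme \<Rightarrow> 'g set \<Rightarrow> ('g \<Rightarrow> bit) \<Rightarrow> ('g monomial \<Rightarrow> 'r) set \<Rightarrow> ('g monomial \<Rightarrow> 'r) \<Rightarrow>
   ('g monomial \<Rightarrow> 'r) set" where
  "presented_proj R X deg S = (let A = free_superalgebra R X deg in
     a_r_coset A (two_sided_ideal R A hull (leibniz_relators R A \<union> S)))"

context cring
begin

context
  fixes X :: "'g set" and deg :: "'g \<Rightarrow> bit" and S :: "('g monomial \<Rightarrow> 'a) set"
  assumes S: "S \<subseteq> hpart (free_superalgebra R X deg) 0 \<union> hpart (free_superalgebra R X deg) 1"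
begin

lemma presented_relators:
  "leibniz_relators R (free_superalgebra R X deg) \<union> S \<subseteq>
     hpart (free_superalgebra R X deg) 0 \<union> hpart (free_superalgebra R X deg) 1"
  "leibniz_relators R (free_superalgebra R X deg) \<union> S \<subseteq> carrier (free_superalgebra R X deg)"
proof -
  show *: "leibniz_relators R (free_superalgebra R X deg) \<union> S \<subseteq>
     hpart (free_superalgebra R X deg) 0 \<union> hpart (free_superalgebra R X deg) 1"
    using S leibniz_relators_homogeneous[OF free_superalgebra_supermodule free_superalgebra_bracket_hpart]
    by auto
  show "leibniz_relators R (free_superalgebra R X deg) \<union> S \<subseteq> carrier (free_superalgebra R X deg)"
    using * by (auto simp: free_superalgebra_simps)
qed

lemma presented_leibniz_superalgebra: "leibniz_superalgebra R (presented_leibniz R X deg S)"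
  unfolding presented_leibniz_def Let_def
  by (rule quot_superalgebra_leibniz[OF free_superalgebra_supermodule free_superalgebra_bilinear
        free_superalgebra_bracket_hpart presented_relators(1)]) auto

lemma presented_quotient_map:
  "quotient_map R (free_superalgebra R X deg)
     (two_sided_ideal R (free_superalgebra R X deg) hull (leibniz_relators R (free_superalgebra R X deg) \<union> S))
     (presented_leibniz R X deg S) (presented_proj R X deg S)"
  and presented_bracket_hom:
    "bracket_hom R (free_superalgebra R X deg) (presented_leibniz R X deg S) (presented_proj R X deg S)"
  and presented_hpart:
    "hpart (presented_leibniz R X deg S) p = presented_proj R X deg S ` hpart (free_superalgebra R X deg) p"
proof -
  note I = two_sided_ideal_hull[OF free_superalgebra_module free_superalgebra_bilinear presented_relators(2)]
  show q: "quotient_map R (free_superalgebra R X deg)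
     (two_sided_ideal R (free_superalgebra R X deg) hull (leibniz_relators R (free_superalgebra R X deg) \<union> S))
     (presented_leibniz R X deg S) (presented_proj R X deg S)"
    unfolding presented_leibniz_def presented_proj_def Let_def
    by (rule quot_superalgebra_module(2)[OF free_superalgebra_module I])
  show "bracket_hom R (free_superalgebra R X deg) (presented_leibniz R X deg S) (presented_proj R X deg S)"
    unfolding bracket_hom_def
  proof (intro conjI ballI)
    show "linear_map R (free_superalgebra R X deg) (presented_leibniz R X deg S) (presented_proj R X deg S)"
      using q by (simp add: quotient_map_def)
  qed (simp add: presented_leibniz_def presented_proj_def Let_def
      quot_superalgebra_bracket[OF free_superalgebra_module free_superalgebra_bilinear I])
  show "hpart (presented_leibniz R X deg S) p = presented_proj R X deg S ` hpart (free_superalgebra R X deg) p"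
    by (simp add: presented_leibniz_def presented_proj_def Let_def quot_superalgebra_simps)
qed

text \<open>
  By induction on monomials, homomorphisms that agree on generators agree on all monomials, and these span.
\<close>

lemma presented_hom_ext:
  assumes P: "module R P"
    and h: "bracket_hom R (presented_leibniz R X deg S) P h" and k: "bracket_hom R (presented_leibniz R X deg S) P k"
    and eq: "\<And>x. x \<in> X \<Longrightarrow>
      h (presented_proj R X deg S (basis_vec R (Gen x))) = k (presented_proj R X deg S (basis_vec R (Gen x)))"
    and y: "y \<in> carrier (presented_leibniz R X deg S)"
  shows "h y = k y"
proof -
  let ?A = "free_superalgebra R X deg"
  let ?L = "presented_leibniz R X deg S"
  let ?\<pi> = "presented_proj R X deg S"
  have \<pi>: "linear_map R ?A ?L ?\<pi>" "\<And>f g. f \<in> carrier ?A \<Longrightarrow> g \<in> carrier ?A \<Longrightarrow>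
      ?\<pi> (bracket ?A f g) = bracket ?L (?\<pi> f) (?\<pi> g)"
    using presented_bracket_hom by (auto simp: bracket_hom_def)
  have bc: "basis_vec R t \<in> carrier ?A" if "set_monomial t \<subseteq> X" for t
    using basis_vec_closed[of t "{t. set_monomial t \<subseteq> X}"] that by (simp add: free_superalgebra_simps)
  have gen: "h (?\<pi> (basis_vec R t)) = k (?\<pi> (basis_vec R t))" if "set_monomial t \<subseteq> X" for t
    using that
  proof (induction t)
    case (Gen x)
    then show ?case by (simp add: eq)
  next
    case (Prod s t)
    then have c: "basis_vec R s \<in> carrier ?A" "basis_vec R t \<in> carrier ?A" by (auto intro: bc)
    have "?\<pi> (basis_vec R (Prod s t)) = bracket ?L (?\<pi> (basis_vec R s)) (?\<pi> (basis_vec R t))"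
      using \<pi>(2)[OF c] by (simp add: basis_vec_bracket)
    then show ?case
      using Prod h k linear_map_closed[OF \<pi>(1)] c by (simp add: bracket_hom_def)
  qed
  obtain f where f: "f \<in> carrier ?A" "y = ?\<pi> f"
    using y presented_quotient_map unfolding quotient_map_def by (metis imageE)
  have "h (?\<pi> f) = k (?\<pi> f)"
    by (rule linear_map_ext[OF free_superalgebra_module P free_superalgebra_spans _ _ _ f(1)])
      (use h k gen \<pi>(1) in \<open>auto simp: bracket_hom_def intro: linear_map_comp\<close>)
  then show ?thesis using f by simp
qed

text \<open>
  The kernel of the homomorphism from the free superalgebra is an ideal. It contains the Leibniz relators since
  the target satisfies the Leibniz identity on homogeneous elements and the homomorphism preserves degrees.
\<close>

lemma presented_universal:
  assumes P: "graded_leibniz R P" and \<phi>: "\<And>x. x \<in> X \<Longrightarrow> \<phi> x \<in> hpart P (deg x)"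
    and rel: "\<And>h s. bracket_hom R (free_superalgebra R X deg) P h \<Longrightarrow>
      (\<And>x. x \<in> X \<Longrightarrow> h (basis_vec R (Gen x)) = \<phi> x) \<Longrightarrow> s \<in> S \<Longrightarrow> h s = \<zero>\<^bsub>P\<^esub>"
  shows "\<exists>g. bracket_hom R (presented_leibniz R X deg S) P g \<and> graded_map (presented_leibniz R X deg S) P g \<and>
    (\<forall>x\<in>X. g (presented_proj R X deg S (basis_vec R (Gen x))) = \<phi> x)"
proof -
  let ?A = "free_superalgebra R X deg"
  let ?L = "presented_leibniz R X deg S"
  let ?\<pi> = "presented_proj R X deg S"
  let ?I = "two_sided_ideal R ?A hull (leibniz_relators R ?A \<union> S)"
  interpret P: graded_leibniz R P by fact
  have A: "module R ?A" by (rule free_superalgebra_module)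
  interpret A: module R ?A by fact
  have L: "module R ?L"
    using presented_leibniz_superalgebra by (simp add: leibniz_superalgebra_def supermodule_def)
  obtain h where h: "bracket_hom R ?A P h" "graded_map ?A P h" "\<And>x. x \<in> X \<Longrightarrow> h (basis_vec R (Gen x)) = \<phi> x"
    using free_superalgebra_universal[of P X \<phi> deg, OF P \<phi>] by blast
  have lin: "linear_map R ?A P h" and hb: "\<And>f g. f \<in> carrier ?A \<Longrightarrow> g \<in> carrier ?A \<Longrightarrow>
      h (bracket ?A f g) = bracket P (h f) (h g)"
    using h(1) by (auto simp: bracket_hom_def)
  have cl: "f \<in> carrier ?A \<Longrightarrow> g \<in> carrier ?A \<Longrightarrow> bracket ?A f g \<in> carrier ?A" for f g
    by (rule free_superalgebra_bracket_closed)
  let ?K = "{f \<in> carrier ?A. h f = \<zero>\<^bsub>P\<^esub>}"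
  have "?I \<subseteq> ?K"
  proof (rule hull_minimal)
    show "two_sided_ideal R ?A ?K"
      unfolding two_sided_ideal_def
    proof (intro conjI ballI)
      show "submodule ?K R ?A" by (rule submodule_kernel[OF A P.module_axioms lin])
    next
      fix f u assume f: "f \<in> carrier ?A" and u: "u \<in> ?K"
      have "h f \<in> carrier P" using f lin by (rule linear_map_closed[rotated])
      then have "bracket P (h f) \<zero>\<^bsub>P\<^esub> = \<zero>\<^bsub>P\<^esub>" "bracket P \<zero>\<^bsub>P\<^esub> (h f) = \<zero>\<^bsub>P\<^esub>"
        using linear_map_zero[OF P.module_axioms P.module_axioms bilinear_map_right[OF P.bracket_bilinear, of "h f"]]
          linear_map_zero[OF P.module_axioms P.module_axioms bilinear_map_left[OF P.bracket_bilinear, of "h f"]]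
        by auto
      then show "bracket ?A f u \<in> ?K" "bracket ?A u f \<in> ?K" using f u by (auto simp: hb cl)
    qed
    show "leibniz_relators R ?A \<union> S \<subseteq> ?K"
    proof
      fix s assume s: "s \<in> leibniz_relators R ?A \<union> S"
      have "h s = \<zero>\<^bsub>P\<^esub>"
      proof (cases "s \<in> S")
        case True
        then show ?thesis using rel h by blast
      next
        case False
        then obtain x y z \<alpha> \<beta> \<gamma> where *: "x \<in> hpart ?A \<alpha>" "y \<in> hpart ?A \<beta>" "z \<in> hpart ?A \<gamma>" and s':
          "s = bracket ?A x (bracket ?A y z) \<ominus>\<^bsub>?A\<^esub>
              (bracket ?A (bracket ?A x y) z \<ominus>\<^bsub>?A\<^esub> sgn_pow R (\<beta> * \<gamma>) \<odot>\<^bsub>?A\<^esub> bracket ?A (bracket ?A x z) y)"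
          using s unfolding leibniz_relators_def by blast
        have c: "x \<in> carrier ?A" "y \<in> carrier ?A" "z \<in> carrier ?A"
          using * by (auto simp: free_superalgebra_simps)
        have hxyz: "h x \<in> hpart P \<alpha>" "h y \<in> hpart P \<beta>" "h z \<in> hpart P \<gamma>"
          using * h(2) by (auto simp: graded_map_def)
        note hl = linear_map_closed[OF lin]
        have "h s = bracket P (h x) (bracket P (h y) (h z)) \<ominus>\<^bsub>P\<^esub> (bracket P (bracket P (h x) (h y)) (h z) \<ominus>\<^bsub>P\<^esub>
           sgn_pow R (\<beta> * \<gamma>) \<odot>\<^bsub>P\<^esub> bracket P (bracket P (h x) (h z)) (h y))"
          unfolding s' using c
          by (simp add: cl hb linear_map_minus[OF A P.module_axioms lin] linear_map_smult[OF lin])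
        also have "\<dots> = \<zero>\<^bsub>P\<^esub>"
          using P.leibniz[OF hxyz] c hl bilinear_map_closed[OF P.bracket_bilinear]
          by (simp add: P.M.minus_eq_zero_iff)
        finally show ?thesis .
      qed
      then show "s \<in> ?K" using s presented_relators(2) by auto
    qed
  qed
  then obtain g where g: "linear_map R ?L P g" "\<And>f. f \<in> carrier ?A \<Longrightarrow> g (?\<pi> f) = h f"
    using quotient_map_lift[OF A P.module_axioms L presented_quotient_map lin] by blast
  have surj: "\<exists>f\<in>carrier ?A. x = ?\<pi> f" if "x \<in> carrier ?L" for x
    using that presented_quotient_map unfolding quotient_map_def by (metis imageE)
  have "g (bracket ?L x y) = bracket P (g x) (g y)" if xy: "x \<in> carrier ?L" "y \<in> carrier ?L" for x y
  proof -
    obtain u v where uv: "u \<in> carrier ?A" "v \<in> carrier ?A" "x = ?\<pi> u" "y = ?\<pi> v" using surj xy by metis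
    have "bracket ?L x y = ?\<pi> (bracket ?A u v)"
      using presented_bracket_hom uv by (simp add: bracket_hom_def)
    then show ?thesis using uv by (simp add: g(2) cl hb)
  qed
  moreover have "g x \<in> hpart P p" if "x \<in> hpart ?L p" for x p
  proof -
    obtain u where u: "u \<in> hpart ?A p" "x = ?\<pi> u" using \<open>x \<in> hpart ?L p\<close> by (auto simp: presented_hpart)
    then have "u \<in> carrier ?A" by (simp add: free_superalgebra_simps)
    then show ?thesis using u h(2) by (simp add: g(2) graded_map_def)
  qed
  moreover have "g (?\<pi> (basis_vec R (Gen x))) = \<phi> x" if "x \<in> X" for x
    using basis_vec_closed[of "Gen x" "{t. set_monomial t \<subseteq> X}"] that h(3)
    by (simp add: g(2) free_superalgebra_simps)
  ultimately show ?thesis using g(1) by (intro exI[of _ g]) (auto simp: bracket_hom_def graded_map_def)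
qed

end

end


section \<open>Tensor products\<close>

lemma tensor_supermodule_simps:
  "carrier (tensor_supermodule R M N) =
     a_rcosets\<^bsub>free_module R (carrier M \<times> carrier N)\<^esub> (tensor_null R M N)"
  "zero (tensor_supermodule R M N) = tensor_null R M N"
  "add (tensor_supermodule R M N) = set_add (free_module R (carrier M \<times> carrier N))"
  "smult (tensor_supermodule R M N) = (\<lambda>r U. \<Union>u\<in>U. tensor_null R M N
     +>\<^bsub>free_module R (carrier M \<times> carrier N)\<^esub> (r \<odot>\<^bsub>free_module R (carrier M \<times> carrier N)\<^esub> u))"
  "hpart (tensor_supermodule R M N) = (\<lambda>p. submodule_generated R (tensor_module R M N)
     {pure_tensor R M N x y | x y \<alpha> \<beta>. x \<in> hpart M \<alpha> \<and> y \<in> hpart N \<beta> \<and> \<alpha> + \<beta> = p})"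
  by (simp_all add: tensor_supermodule_def tensor_module_def quot_module_def module.defs supermodule.defs)

lemma submodule_generated_tensor_module:
  "submodule_generated R (tensor_module R M N) S = submodule_generated R (tensor_supermodule R M N) S"
proof -
  have "submodule H R (tensor_module R M N) \<longleftrightarrow> submodule H R (tensor_supermodule R M N)" for H
    by (simp add: submodule_def submodule_axioms_def subgroup_def m_inv_def tensor_supermodule_def
        tensor_module_def quot_module_def module.defs supermodule.defs)
  then show ?thesis by (simp add: submodule_generated_def)
qed

context cring
begin

context
  fixes M :: "('a, 'x, 'm) supermodule_scheme" and N :: "('a, 'y, 'n) supermodule_scheme"
  assumes M: "module R M" and N: "module R N"
begin

lemma tensor_relators_carrier:
  "tensor_relators R M N \<subseteq> carrier (free_module R (carrier M \<times> carrier N))"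
proof -
  interpret M: module R M by (rule M)
  interpret N: module R N by (rule N)
  interpret E: module R "free_module R (carrier M \<times> carrier N)" by (rule free_module_module)
  show ?thesis
    unfolding tensor_relators_def Let_def
    by (auto intro!: E.M.minus_closed E.M.a_closed E.smult_closed basis_vec_closed)
qed

lemma tensor_null_submodule:
  "submodule (tensor_null R M N) R (free_module R (carrier M \<times> carrier N))"
  unfolding tensor_null_def
  by (rule submodule_generated_submodule[OF free_module_module tensor_relators_carrier])

lemma tensor_supermodule_module: "module R (tensor_supermodule R M N)"
  and tensor_quotient_map: "quotient_map R (free_module R (carrier M \<times> carrier N)) (tensor_null R M N)
     (tensor_supermodule R M N) (\<lambda>x. tensor_null R M N +>\<^bsub>free_module R (carrier M \<times> carrier N)\<^esub> x)"
  by (rule quotient_module[OF free_module_module tensor_null_submodule]; simp add: tensor_supermodule_simps)+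

lemma pure_tensor_bilinear: "bilinear_map R M N (tensor_supermodule R M N) (pure_tensor R M N)"
proof -
  interpret M: module R M by (rule M)
  interpret N: module R N by (rule N)
  let ?E = "free_module R (carrier M \<times> carrier N)"
  let ?T = "tensor_supermodule R M N"
  interpret E: module R ?E by (rule free_module_module)
  let ?\<pi> = "\<lambda>x. tensor_null R M N +>\<^bsub>?E\<^esub> x"
  let ?d = "\<lambda>x y. basis_vec R (x, y)"
  have lin: "linear_map R ?E ?T ?\<pi>" using tensor_quotient_map by (simp add: quotient_map_def)
  have d: "?d x y \<in> carrier ?E" if "x \<in> carrier M" "y \<in> carrier N" for x y
    using that by (intro basis_vec_closed) auto
  have rel: "?\<pi> u = ?\<pi> v" if "u \<ominus>\<^bsub>?E\<^esub> v \<in> tensor_relators R M N" "u \<in> carrier ?E" "v \<in> carrier ?E" for u v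
  proof -
    have "u \<ominus>\<^bsub>?E\<^esub> v \<in> tensor_null R M N"
      using that(1) unfolding tensor_null_def by (rule submodule_generated_incl)
    then show ?thesis
      using quotient_map_eq_iff[OF free_module_module tensor_supermodule_module tensor_quotient_map that(2,3)]
      by simp
  qed
  show ?thesis
    unfolding bilinear_map_def
  proof (intro conjI ballI)
    show "pure_tensor R M N x y \<in> carrier ?T" if "x \<in> carrier M" "y \<in> carrier N" for x y
      unfolding pure_tensor_def by (rule linear_map_closed[OF lin d[OF that]])
    show "pure_tensor R M N (x \<oplus>\<^bsub>M\<^esub> x') y = pure_tensor R M N x y \<oplus>\<^bsub>?T\<^esub> pure_tensor R M N x' y"
      if "x \<in> carrier M" "x' \<in> carrier M" "y \<in> carrier N" for x x' y
    proof -
      have "?\<pi> (?d (x \<oplus>\<^bsub>M\<^esub> x') y) = ?\<pi> (?d x y \<oplus>\<^bsub>?E\<^esub> ?d x' y)" (is "_ +>\<^bsub>_\<^esub> ?u = _ +>\<^bsub>_\<^esub> ?v")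
      proof (rule rel)
        show "?u \<ominus>\<^bsub>?E\<^esub> ?v \<in> tensor_relators R M N"
          using that unfolding tensor_relators_def Let_def by blast
      qed (use that in \<open>auto intro!: d E.M.a_closed\<close>)
      then show ?thesis using that d by (simp add: pure_tensor_def linear_map_add[OF lin])
    qed
    show "pure_tensor R M N x (y \<oplus>\<^bsub>N\<^esub> y') = pure_tensor R M N x y \<oplus>\<^bsub>?T\<^esub> pure_tensor R M N x y'"
      if "x \<in> carrier M" "y \<in> carrier N" "y' \<in> carrier N" for x y y'
    proof -
      have "?\<pi> (?d x (y \<oplus>\<^bsub>N\<^esub> y')) = ?\<pi> (?d x y \<oplus>\<^bsub>?E\<^esub> ?d x y')" (is "_ +>\<^bsub>_\<^esub> ?u = _ +>\<^bsub>_\<^esub> ?v")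
      proof (rule rel)
        show "?u \<ominus>\<^bsub>?E\<^esub> ?v \<in> tensor_relators R M N"
          using that unfolding tensor_relators_def Let_def by blast
      qed (use that in \<open>auto intro!: d E.M.a_closed\<close>)
      then show ?thesis using that d by (simp add: pure_tensor_def linear_map_add[OF lin])
    qed
    show "pure_tensor R M N (r \<odot>\<^bsub>M\<^esub> x) y = r \<odot>\<^bsub>?T\<^esub> pure_tensor R M N x y"
      if "r \<in> carrier R" "x \<in> carrier M" "y \<in> carrier N" for r x y
    proof -
      have "?\<pi> (?d (r \<odot>\<^bsub>M\<^esub> x) y) = ?\<pi> (r \<odot>\<^bsub>?E\<^esub> ?d x y)" (is "_ +>\<^bsub>_\<^esub> ?u = _ +>\<^bsub>_\<^esub> ?v")
      proof (rule rel)
        show "?u \<ominus>\<^bsub>?E\<^esub> ?v \<in> tensor_relators R M N"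
          using that unfolding tensor_relators_def Let_def by blast
      qed (use that in \<open>auto intro!: d E.smult_closed\<close>)
      then show ?thesis using that d by (simp add: pure_tensor_def linear_map_smult[OF lin])
    qed
    show "pure_tensor R M N x (r \<odot>\<^bsub>N\<^esub> y) = r \<odot>\<^bsub>?T\<^esub> pure_tensor R M N x y"
      if "r \<in> carrier R" "x \<in> carrier M" "y \<in> carrier N" for r x y
    proof -
      have "?\<pi> (?d x (r \<odot>\<^bsub>N\<^esub> y)) = ?\<pi> (r \<odot>\<^bsub>?E\<^esub> ?d x y)" (is "_ +>\<^bsub>_\<^esub> ?u = _ +>\<^bsub>_\<^esub> ?v")
      proof (rule rel)
        show "?u \<ominus>\<^bsub>?E\<^esub> ?v \<in> tensor_relators R M N"
          using that unfolding tensor_relators_def Let_def by blast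
      qed (use that in \<open>auto intro!: d E.smult_closed\<close>)
      then show ?thesis using that d by (simp add: pure_tensor_def linear_map_smult[OF lin])
    qed
  qed
qed

lemma pure_tensor_spans:
  "spans R (tensor_supermodule R M N) {pure_tensor R M N x y | x y. x \<in> carrier M \<and> y \<in> carrier N}"
proof -
  let ?E = "free_module R (carrier M \<times> carrier N)"
  let ?\<pi> = "\<lambda>x. tensor_null R M N +>\<^bsub>?E\<^esub> x"
  have "spans R (tensor_supermodule R M N) (?\<pi> ` basis_vec R ` (carrier M \<times> carrier N))"
    using tensor_quotient_map
    by (intro spans_surjective_image[OF free_module_module tensor_supermodule_module _ _ free_module_spans])
      (simp_all add: quotient_map_def)
  also have "?\<pi> ` basis_vec R ` (carrier M \<times> carrier N) =
      {pure_tensor R M N x y | x y. x \<in> carrier M \<and> y \<in> carrier N}"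
    by (auto simp: pure_tensor_def)
  finally show ?thesis .
qed

text \<open>
  The linear extension of \<open>f\<close> to the free module kills the tensor relators exactly because \<open>f\<close> is bilinear.
\<close>

lemma tensor_universal:
  assumes P: "module R P" and f: "bilinear_map R M N P f"
  shows "\<exists>h. linear_map R (tensor_supermodule R M N) P h \<and>
    (\<forall>x\<in>carrier M. \<forall>y\<in>carrier N. h (pure_tensor R M N x y) = f x y)"
proof -
  interpret M: module R M by (rule M)
  interpret N: module R N by (rule N)
  interpret P: module R P by (rule P)
  let ?E = "free_module R (carrier M \<times> carrier N)"
  let ?T = "tensor_supermodule R M N"
  interpret E: module R ?E by (rule free_module_module)
  let ?d = "\<lambda>x y. basis_vec R (x, y)"
  have d: "?d x y \<in> carrier ?E" if "x \<in> carrier M" "y \<in> carrier N" for x y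
    using that by (intro basis_vec_closed) auto
  have "\<exists>h. linear_map R ?E P h \<and> (\<forall>z\<in>carrier M \<times> carrier N. h (basis_vec R z) = (\<lambda>(x, y). f x y) z)"
    by (rule free_module_universal[OF P]) (use bilinear_map_closed[OF f] in auto)
  then obtain h where h: "linear_map R ?E P h"
      "\<And>x y. x \<in> carrier M \<Longrightarrow> y \<in> carrier N \<Longrightarrow> h (?d x y) = f x y"
    by auto
  note lm = linear_map_minus[OF free_module_module P h(1)] linear_map_add[OF h(1)] linear_map_smult[OF h(1)]
  note cl = bilinear_map_closed[OF f]
  have rel: "h s = \<zero>\<^bsub>P\<^esub>" if "s \<in> tensor_relators R M N" for s
    using that f unfolding tensor_relators_def Let_def
    by (auto simp: lm d h(2) cl P.M.minus_eq_zero_iff bilinear_map_def)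
  have "tensor_null R M N \<subseteq> {x \<in> carrier ?E. h x = \<zero>\<^bsub>P\<^esub>}"
    unfolding tensor_null_def
    by (rule submodule_generated_least[OF submodule_kernel[OF free_module_module P h(1)]])
      (use rel tensor_relators_carrier in auto)
  then have "\<exists>k. linear_map R ?T P k \<and> (\<forall>x\<in>carrier ?E. k (tensor_null R M N +>\<^bsub>?E\<^esub> x) = h x)"
    by (intro quotient_map_lift[OF free_module_module P tensor_supermodule_module tensor_quotient_map h(1)]) auto
  then obtain k where "linear_map R ?T P k"
      "\<And>x. x \<in> carrier ?E \<Longrightarrow> k (tensor_null R M N +>\<^bsub>?E\<^esub> x) = h x" by blast
  then show ?thesis using d h(2) by (intro exI[of _ k]) (simp add: pure_tensor_def)
qed

end

end


section \<open>The non-abelian tensor square\<close>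

lemma nonabelian_tensor_simps:
  "carrier (nonabelian_tensor R L) = carrier (nonabelian_supermodule R L)"
  "zero (nonabelian_tensor R L) = zero (nonabelian_supermodule R L)"
  "add (nonabelian_tensor R L) = add (nonabelian_supermodule R L)"
  "smult (nonabelian_tensor R L) = smult (nonabelian_supermodule R L)"
  "hpart (nonabelian_tensor R L) = hpart (nonabelian_supermodule R L)"
  "bracket (nonabelian_tensor R L) = nonabelian_bracket R L"
  by (simp_all add: nonabelian_tensor_def supermodule.defs superalgebra.defs)

lemma nonabelian_supermodule_simps:
  "carrier (nonabelian_supermodule R L) = a_rcosets\<^bsub>tensor_supermodule R L L\<^esub> (nonabelian_null R L)"
  "zero (nonabelian_supermodule R L) = nonabelian_null R L"
  "add (nonabelian_supermodule R L) = set_add (tensor_supermodule R L L)"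
  "smult (nonabelian_supermodule R L) = (\<lambda>r U. \<Union>u\<in>U. nonabelian_null R L
     +>\<^bsub>tensor_supermodule R L L\<^esub> (r \<odot>\<^bsub>tensor_supermodule R L L\<^esub> u))"
  "hpart (nonabelian_supermodule R L) =
     (\<lambda>p. (\<lambda>x. nonabelian_null R L +>\<^bsub>tensor_supermodule R L L\<^esub> x) ` hpart (tensor_supermodule R L L) p)"
  by (simp_all add: nonabelian_supermodule_def quot_supermodule_def quot_module_def module.defs supermodule.defs)

lemma bilinear_map_nonabelian_tensor:
  "bilinear_map R (nonabelian_tensor R L) (nonabelian_tensor R L) (nonabelian_tensor R L) f \<longleftrightarrow>
   bilinear_map R (nonabelian_supermodule R L) (nonabelian_supermodule R L) (nonabelian_supermodule R L) f"
  by (simp add: bilinear_map_def nonabelian_tensor_simps)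

context
  fixes R :: "('r, 'rm) ring_scheme" and L :: "('r, 'a, 'am) superalgebra_scheme"
  assumes L: "leibniz_superalgebra R L"
begin

interpretation L: leibniz_superalgebra R L by (rule L)

lemma hpart_carrier: "x \<in> hpart L p \<Longrightarrow> x \<in> carrier L"
  using submodule_carrier[OF L.hpart_submodule] .

lemma nonabelian_null_submodule: "submodule (nonabelian_null R L) R (tensor_supermodule R L L)"
  and nonabelian_relators_carrier: "nonabelian_relators R L \<subseteq> carrier (tensor_supermodule R L L)"
proof -
  interpret T: module R "tensor_supermodule R L L"
    by (rule L.tensor_supermodule_module[OF L.module_axioms L.module_axioms])
  note cl = bilinear_map_closed[OF L.pure_tensor_bilinear[OF L.module_axioms L.module_axioms]]
    bilinear_map_closed[OF L.bracket_bilinear]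
  show "nonabelian_relators R L \<subseteq> carrier (tensor_supermodule R L L)"
    unfolding nonabelian_relators_def Let_def by (auto simp: cl hpart_carrier)
  then show "submodule (nonabelian_null R L) R (tensor_supermodule R L L)"
    unfolding nonabelian_null_def by (rule submodule_generated_submodule[OF T.module_axioms])
qed

lemma nonabelian_tensor_module: "module R (nonabelian_tensor R L)"
  and nonabelian_quotient_map: "quotient_map R (tensor_supermodule R L L) (nonabelian_null R L)
     (nonabelian_tensor R L) (\<lambda>x. nonabelian_null R L +>\<^bsub>tensor_supermodule R L L\<^esub> x)"
  by (rule quotient_module[OF L.tensor_supermodule_module[OF L.module_axioms L.module_axioms] nonabelian_null_submodule];
      simp add: nonabelian_tensor_simps nonabelian_supermodule_simps)+

lemma nonabelian_pure_bilinear: "bilinear_map R L L (nonabelian_tensor R L) (nonabelian_pure R L)"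
proof -
  have "bilinear_map R L L (nonabelian_tensor R L)
     (\<lambda>x y. nonabelian_null R L +>\<^bsub>tensor_supermodule R L L\<^esub> pure_tensor R L L x y)"
    using nonabelian_quotient_map
    by (intro bilinear_map_comp[OF L.pure_tensor_bilinear[OF L.module_axioms L.module_axioms]
          linear_map_id linear_map_id]) (simp add: quotient_map_def)
  then show ?thesis by (simp add: nonabelian_pure_def[abs_def])
qed

lemma nonabelian_pure_spans:
  "spans R (nonabelian_tensor R L) {nonabelian_pure R L x y | x y. x \<in> carrier L \<and> y \<in> carrier L}"
proof -
  let ?T = "tensor_supermodule R L L"
  let ?\<pi> = "\<lambda>x. nonabelian_null R L +>\<^bsub>?T\<^esub> x"
  have "spans R (nonabelian_tensor R L) (?\<pi> ` {pure_tensor R L L x y | x y. x \<in> carrier L \<and> y \<in> carrier L})"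
    using nonabelian_quotient_map
    by (intro spans_surjective_image[OF L.tensor_supermodule_module[OF L.module_axioms L.module_axioms]
          nonabelian_tensor_module _ _ L.pure_tensor_spans[OF L.module_axioms L.module_axioms]])
      (simp_all add: quotient_map_def)
  also have "?\<pi> ` {pure_tensor R L L x y | x y. x \<in> carrier L \<and> y \<in> carrier L} =
      {nonabelian_pure R L x y | x y. x \<in> carrier L \<and> y \<in> carrier L}"
    by (auto simp: nonabelian_pure_def)
  finally show ?thesis .
qed

text \<open>
  The defining relators of the tensor square, solved for their middle term. In this form they are the Leibniz
  identity with the outer bracket replaced by the tensor product.
\<close>

lemma nonabelian_pure_bracket:
  assumes "x \<in> hpart L \<alpha>" "y \<in> hpart L \<beta>" "z \<in> hpart L \<gamma>"
  shows "nonabelian_pure R L x (bracket L y z) =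
    nonabelian_pure R L (bracket L x y) z \<ominus>\<^bsub>nonabelian_tensor R L\<^esub>
      sgn_pow R (\<beta> * \<gamma>) \<odot>\<^bsub>nonabelian_tensor R L\<^esub> nonabelian_pure R L (bracket L x z) y"
proof -
  let ?T = "tensor_supermodule R L L"
  let ?N = "nonabelian_tensor R L"
  let ?\<pi> = "\<lambda>x. nonabelian_null R L +>\<^bsub>?T\<^esub> x"
  let ?t = "nonabelian_pure R L"
  have T: "module R ?T" by (rule L.tensor_supermodule_module[OF L.module_axioms L.module_axioms])
  interpret T: module R ?T by (rule T)
  interpret N: module R ?N by (rule nonabelian_tensor_module)
  have c: "x \<in> carrier L" "y \<in> carrier L" "z \<in> carrier L" using assms by (auto intro: hpart_carrier)
  note cl = bilinear_map_closed[OF L.pure_tensor_bilinear[OF L.module_axioms L.module_axioms]]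
    bilinear_map_closed[OF L.bracket_bilinear] bilinear_map_closed[OF nonabelian_pure_bilinear]
  have lin: "linear_map R ?T ?N ?\<pi>" using nonabelian_quotient_map by (simp add: quotient_map_def)
  let ?s = "\<ominus>\<^bsub>?T\<^esub> pure_tensor R L L (bracket L x y) z \<oplus>\<^bsub>?T\<^esub> pure_tensor R L L x (bracket L y z)
        \<oplus>\<^bsub>?T\<^esub> sgn_pow R (\<beta> * \<gamma>) \<odot>\<^bsub>?T\<^esub> pure_tensor R L L (bracket L x z) y"
  have "?s \<in> nonabelian_relators R L"
    unfolding nonabelian_relators_def Let_def using assms by blast
  then have "?s \<in> nonabelian_null R L" "?s \<in> carrier ?T"
    using nonabelian_relators_carrier unfolding nonabelian_null_def by (auto intro: submodule_generated_incl)
  then have "?\<pi> ?s = \<zero>\<^bsub>?N\<^esub>" using nonabelian_quotient_map by (simp add: quotient_map_def)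
  then have 0: "\<ominus>\<^bsub>?N\<^esub> ?t (bracket L x y) z \<oplus>\<^bsub>?N\<^esub> ?t x (bracket L y z)
        \<oplus>\<^bsub>?N\<^esub> sgn_pow R (\<beta> * \<gamma>) \<odot>\<^bsub>?N\<^esub> ?t (bracket L x z) y = \<zero>\<^bsub>?N\<^esub>"
    using c by (simp add: linear_map_add[OF lin] linear_map_smult[OF lin] cl
        linear_map_uminus[OF T nonabelian_tensor_module lin] nonabelian_pure_def)
  have "?t x (bracket L y z) \<ominus>\<^bsub>?N\<^esub> (?t (bracket L x y) z \<ominus>\<^bsub>?N\<^esub> sgn_pow R (\<beta> * \<gamma>) \<odot>\<^bsub>?N\<^esub> ?t (bracket L x z) y)
      = \<zero>\<^bsub>?N\<^esub>"
    unfolding 0[symmetric] using c by (simp add: a_minus_def N.M.minus_add N.M.a_ac cl)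
  then show ?thesis using c by (simp add: N.M.minus_eq_zero_iff cl)
qed

lemma nonabelian_hpart_submodule: "submodule (hpart (nonabelian_tensor R L) p) R (nonabelian_tensor R L)"
  and nonabelian_pure_hpart: "x \<in> hpart L \<alpha> \<Longrightarrow> y \<in> hpart L \<beta> \<Longrightarrow>
    nonabelian_pure R L x y \<in> hpart (nonabelian_tensor R L) (\<alpha> + \<beta>)"
proof -
  let ?T = "tensor_supermodule R L L"
  have T: "module R ?T" by (rule L.tensor_supermodule_module[OF L.module_axioms L.module_axioms])
  let ?S = "\<lambda>p. {pure_tensor R L L x y | x y \<alpha> \<beta>. x \<in> hpart L \<alpha> \<and> y \<in> hpart L \<beta> \<and> \<alpha> + \<beta> = p}"
  have hp: "hpart ?T p = submodule_generated R ?T (?S p)" for p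
    by (simp add: tensor_supermodule_simps submodule_generated_tensor_module)
  have S: "?S p \<subseteq> carrier ?T" for p
    using bilinear_map_closed[OF L.pure_tensor_bilinear[OF L.module_axioms L.module_axioms]] hpart_carrier by auto
  have hN: "hpart (nonabelian_tensor R L) p = (\<lambda>x. nonabelian_null R L +>\<^bsub>?T\<^esub> x) ` hpart ?T p" for p
    by (simp add: nonabelian_tensor_simps nonabelian_supermodule_simps)
  show "submodule (hpart (nonabelian_tensor R L) p) R (nonabelian_tensor R L)"
    unfolding hN hp using nonabelian_quotient_map
    by (intro submodule_image[OF T nonabelian_tensor_module _ submodule_generated_submodule[OF T S]])
      (simp add: quotient_map_def)
  assume "x \<in> hpart L \<alpha>" "y \<in> hpart L \<beta>"
  then have "pure_tensor R L L x y \<in> hpart ?T (\<alpha> + \<beta>)"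
    unfolding hp by (intro submodule_generated_incl) auto
  then show "nonabelian_pure R L x y \<in> hpart (nonabelian_tensor R L) (\<alpha> + \<beta>)"
    unfolding hN nonabelian_pure_def by blast
qed

text \<open>
  The bracket of \<open>L\<close> is bilinear, so it factors through the tensor product; the Leibniz identity of \<open>L\<close> says that
  the factorisation kills the relators of the tensor square. Degrees add up in brackets as they do in tensors.
\<close>

lemma commutator_map_exists:
  "\<exists>\<mu>. linear_map R (nonabelian_tensor R L) L \<mu> \<and> graded_map (nonabelian_tensor R L) L \<mu> \<and>
    (\<forall>x\<in>carrier L. \<forall>y\<in>carrier L. \<mu> (nonabelian_pure R L x y) = bracket L x y)"
proof -
  let ?T = "tensor_supermodule R L L"
  let ?N = "nonabelian_tensor R L"
  have T: "module R ?T" by (rule L.tensor_supermodule_module[OF L.module_axioms L.module_axioms])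
  note cl = bilinear_map_closed[OF L.pure_tensor_bilinear[OF L.module_axioms L.module_axioms]]
    bilinear_map_closed[OF L.bracket_bilinear]
  interpret T: module R ?T by (rule T)
  obtain h where h: "linear_map R ?T L h"
    "\<And>x y. x \<in> carrier L \<Longrightarrow> y \<in> carrier L \<Longrightarrow> h (pure_tensor R L L x y) = bracket L x y"
    using L.tensor_universal[OF L.module_axioms L.module_axioms L.module_axioms L.bracket_bilinear] by blast
  have rel: "h s = \<zero>\<^bsub>L\<^esub>" if s: "s \<in> nonabelian_relators R L" for s
  proof -
    obtain x y z \<alpha> \<beta> \<gamma> where *: "x \<in> hpart L \<alpha>" "y \<in> hpart L \<beta>" "z \<in> hpart L \<gamma>" and s':
      "s = \<ominus>\<^bsub>?T\<^esub> pure_tensor R L L (bracket L x y) z \<oplus>\<^bsub>?T\<^esub> pure_tensor R L L x (bracket L y z)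
        \<oplus>\<^bsub>?T\<^esub> sgn_pow R (\<beta> * \<gamma>) \<odot>\<^bsub>?T\<^esub> pure_tensor R L L (bracket L x z) y"
      using s unfolding nonabelian_relators_def Let_def by blast
    have c: "x \<in> carrier L" "y \<in> carrier L" "z \<in> carrier L" using * by (auto intro: hpart_carrier)
    let ?u = "bracket L (bracket L x y) z"
    let ?v = "sgn_pow R (\<beta> * \<gamma>) \<odot>\<^bsub>L\<^esub> bracket L (bracket L x z) y"
    have uv: "?u \<in> carrier L" "?v \<in> carrier L" using c cl by auto
    have "h s = \<ominus>\<^bsub>L\<^esub> ?u \<oplus>\<^bsub>L\<^esub> bracket L x (bracket L y z) \<oplus>\<^bsub>L\<^esub> ?v"
      unfolding s' using c
      by (simp add: linear_map_add[OF h(1)] linear_map_smult[OF h(1)] cl h(2)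
          linear_map_uminus[OF T L.module_axioms h(1)])
    also have "\<dots> = \<ominus>\<^bsub>L\<^esub> ?u \<oplus>\<^bsub>L\<^esub> (?u \<ominus>\<^bsub>L\<^esub> ?v) \<oplus>\<^bsub>L\<^esub> ?v"
      by (simp add: L.leibniz[OF *])
    also have "\<dots> = \<zero>\<^bsub>L\<^esub>" using uv by (simp add: a_minus_def L.M.r_neg1 L.M.l_neg)
    finally show ?thesis .
  qed
  have "nonabelian_null R L \<subseteq> {x \<in> carrier ?T. h x = \<zero>\<^bsub>L\<^esub>}"
    unfolding nonabelian_null_def
    by (rule submodule_generated_least[OF submodule_kernel[OF T L.module_axioms h(1)]])
      (use rel nonabelian_relators_carrier in auto)
  then obtain \<mu> where \<mu>: "linear_map R ?N L \<mu>"
      "\<And>x. x \<in> carrier ?T \<Longrightarrow> \<mu> (nonabelian_null R L +>\<^bsub>?T\<^esub> x) = h x"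
    using quotient_map_lift[OF T L.module_axioms nonabelian_tensor_module nonabelian_quotient_map h(1)] by blast
  have hT: "hpart ?T p \<subseteq> {x \<in> carrier ?T. h x \<in> hpart L p}" for p
    unfolding tensor_supermodule_simps(5) submodule_generated_tensor_module
  proof (rule submodule_generated_least[OF submodule_vimage[OF T L.module_axioms h(1) L.hpart_submodule]], rule)
    fix s assume "s \<in> {pure_tensor R L L x y | x y \<alpha> \<beta>. x \<in> hpart L \<alpha> \<and> y \<in> hpart L \<beta> \<and> \<alpha> + \<beta> = p}"
    then obtain x y \<alpha> \<beta> where *: "s = pure_tensor R L L x y" "x \<in> hpart L \<alpha>" "y \<in> hpart L \<beta>" "\<alpha> + \<beta> = p"
      by blast
    then show "s \<in> {x \<in> carrier ?T. h x \<in> hpart L p}"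
      using L.bracket_hpart[OF *(2,3)] by (simp only: mem_Collect_eq h(2) cl hpart_carrier simp_thms)
  qed
  have "\<mu> U \<in> hpart L p" if "U \<in> hpart ?N p" for U p
  proof -
    obtain u where u: "u \<in> hpart ?T p" "U = nonabelian_null R L +>\<^bsub>?T\<^esub> u"
      using \<open>U \<in> hpart ?N p\<close> unfolding nonabelian_tensor_simps nonabelian_supermodule_simps by blast
    have "u \<in> {x \<in> carrier ?T. h x \<in> hpart L p}" using hT u(1) by (rule subsetD)
    then show ?thesis by (simp add: u(2) \<mu>(2))
  qed
  then have "graded_map ?N L \<mu>" by (simp add: graded_map_def)
  moreover have "\<mu> (nonabelian_pure R L x y) = bracket L x y" if "x \<in> carrier L" "y \<in> carrier L" for x y
    using that by (simp add: nonabelian_pure_def \<mu>(2) cl h(2))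
  ultimately show ?thesis using \<mu>(1) by blast
qed

text \<open>
  Elements \<open>x \<otimes> y\<close> span, so on the carrier there is only one map to choose.
\<close>

definition commutator_map :: "('a \<times> 'a \<Rightarrow> 'r) set set \<Rightarrow> 'a" where
  "commutator_map = (SOME \<mu>. linear_map R (nonabelian_tensor R L) L \<mu> \<and> graded_map (nonabelian_tensor R L) L \<mu> \<and>
    (\<forall>x\<in>carrier L. \<forall>y\<in>carrier L. \<mu> (nonabelian_pure R L x y) = bracket L x y))"

lemma commutator_map_linear: "linear_map R (nonabelian_tensor R L) L commutator_map"
  and commutator_map_graded: "graded_map (nonabelian_tensor R L) L commutator_map"
  and commutator_map_pure: "x \<in> carrier L \<Longrightarrow> y \<in> carrier L \<Longrightarrow>
    commutator_map (nonabelian_pure R L x y) = bracket L x y"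
  using someI_ex[OF commutator_map_exists] unfolding commutator_map_def by blast+

text \<open>
  The map \<open>\<mu> u \<otimes> \<mu> v\<close>, with \<open>\<mu>\<close> the commutator map, has the properties by which the bracket is chosen.
  This shows that the choice succeeds, and since tensors span, it determines the result.
\<close>

lemma nonabelian_bracket_bilinear:
  "bilinear_map R (nonabelian_tensor R L) (nonabelian_tensor R L) (nonabelian_tensor R L)
     (bracket (nonabelian_tensor R L))"
  and nonabelian_bracket_eq:
  "u \<in> carrier (nonabelian_tensor R L) \<Longrightarrow> v \<in> carrier (nonabelian_tensor R L) \<Longrightarrow>
     bracket (nonabelian_tensor R L) u v = nonabelian_pure R L (commutator_map u) (commutator_map v)"
proof -
  let ?N = "nonabelian_tensor R L"
  let ?b = "\<lambda>u v. nonabelian_pure R L (commutator_map u) (commutator_map v)"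
  have b: "bilinear_map R ?N ?N ?N ?b"
    by (rule bilinear_map_comp[OF nonabelian_pure_bilinear commutator_map_linear commutator_map_linear linear_map_id])
  let ?P = "\<lambda>b. bilinear_map R (nonabelian_supermodule R L) (nonabelian_supermodule R L) (nonabelian_supermodule R L) b \<and>
       (\<forall>x\<in>carrier L. \<forall>y\<in>carrier L. \<forall>x'\<in>carrier L. \<forall>y'\<in>carrier L.
          b (nonabelian_pure R L x y) (nonabelian_pure R L x' y') =
            nonabelian_pure R L (bracket L x y) (bracket L x' y'))"
  have "?P ?b" using b by (simp add: bilinear_map_nonabelian_tensor commutator_map_pure)
  then have "?P (SOME b. ?P b)" by (rule someI[where P = ?P])
  then have P: "?P (bracket ?N)" by (simp add: nonabelian_bracket_def Let_def nonabelian_tensor_simps)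
  then show br: "bilinear_map R ?N ?N ?N (bracket ?N)" by (simp add: bilinear_map_nonabelian_tensor)
  assume uv: "u \<in> carrier ?N" "v \<in> carrier ?N"
  show "bracket ?N u v = ?b u v"
    by (rule bilinear_map_ext[OF nonabelian_tensor_module nonabelian_tensor_module nonabelian_tensor_module
          nonabelian_pure_spans nonabelian_pure_spans br b _ uv])
      (use P in \<open>auto simp: commutator_map_pure\<close>)
qed

text \<open>
  As \<open>\<mu>\<close> is compatible with brackets, the Leibniz identity for \<open>u, v, w\<close> is the relation
  \<open>nonabelian_pure_bracket\<close> at \<open>\<mu> u, \<mu> v, \<mu> w\<close>.
\<close>

lemma nonabelian_graded_leibniz: "graded_leibniz R (nonabelian_tensor R L)"
proof (intro graded_leibniz.intro graded_leibniz_axioms.intro nonabelian_tensor_module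
    nonabelian_hpart_submodule nonabelian_bracket_bilinear)
  let ?N = "nonabelian_tensor R L"
  have hc: "u \<in> carrier ?N" if "u \<in> hpart ?N p" for u p
    using nonabelian_hpart_submodule that by (rule submodule_carrier)
  have hm: "commutator_map u \<in> hpart L p" if "u \<in> hpart ?N p" for u p
    using commutator_map_graded that by (simp add: graded_map_def)
  show "bracket ?N u v \<in> hpart ?N (\<alpha> + \<beta>)" if "u \<in> hpart ?N \<alpha>" "v \<in> hpart ?N \<beta>" for u v \<alpha> \<beta>
    using nonabelian_pure_hpart[OF hm[OF that(1)] hm[OF that(2)]] hc that
    by (simp only: nonabelian_bracket_eq)
  show "bracket ?N u (bracket ?N v w) = bracket ?N (bracket ?N u v) w \<ominus>\<^bsub>?N\<^esub>
      sgn_pow R (\<beta> * \<gamma>) \<odot>\<^bsub>?N\<^esub> bracket ?N (bracket ?N u w) v"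
    if "u \<in> hpart ?N \<alpha>" "v \<in> hpart ?N \<beta>" "w \<in> hpart ?N \<gamma>" for u v w \<alpha> \<beta> \<gamma>
  proof -
    have c: "u \<in> carrier ?N" "v \<in> carrier ?N" "w \<in> carrier ?N" using that by (auto intro: hc)
    note cm = c[THEN linear_map_closed[OF commutator_map_linear]]
    show ?thesis
      using nonabelian_pure_bracket[OF hm[OF that(1)] hm[OF that(2)] hm[OF that(3)]] c cm
      by (simp add: nonabelian_bracket_eq commutator_map_pure bilinear_map_closed[OF nonabelian_pure_bilinear])
  qed
qed

lemma commutator_map_bracket:
  assumes "u \<in> carrier (nonabelian_tensor R L)" "v \<in> carrier (nonabelian_tensor R L)"
  shows "commutator_map (bracket (nonabelian_tensor R L) u v) = bracket L (commutator_map u) (commutator_map v)"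
  using assms linear_map_closed[OF commutator_map_linear]
  by (simp add: nonabelian_bracket_eq commutator_map_pure)

text \<open>
  A homomorphic section of the commutator map is automatically a two-sided inverse, since for \<open>x, y \<in> L\<close>
  \<open>g (\<mu> (x \<otimes> y)) = [g x, g y] = \<mu> (g x) \<otimes> \<mu> (g y) = x \<otimes> y\<close>. The direct sum decomposition of the tensor square
  is transported from \<open>L\<close>.
\<close>

lemma commutator_map_iso:
  assumes g: "bracket_hom R L (nonabelian_tensor R L) g" "graded_map L (nonabelian_tensor R L) g"
    and section_of: "\<And>x. x \<in> carrier L \<Longrightarrow> commutator_map (g x) = x"
  shows "leibniz_iso R (nonabelian_tensor R L) L commutator_map"
proof -
  let ?N = "nonabelian_tensor R L"
  interpret N: graded_leibniz R ?N by (rule nonabelian_graded_leibniz)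
  have gl: "linear_map R L ?N g"
    and gb: "\<And>x y. x \<in> carrier L \<Longrightarrow> y \<in> carrier L \<Longrightarrow> g (bracket L x y) = bracket ?N (g x) (g y)"
    using g(1) by (auto simp: bracket_hom_def)
  note gc = linear_map_closed[OF gl] and mc = linear_map_closed[OF commutator_map_linear]
  have gm: "g (commutator_map u) = u" if u: "u \<in> carrier ?N" for u
  proof (rule linear_map_ext[OF nonabelian_tensor_module nonabelian_tensor_module nonabelian_pure_spans
        linear_map_comp[OF commutator_map_linear gl] linear_map_id _ u])
    fix v assume "v \<in> {nonabelian_pure R L x y | x y. x \<in> carrier L \<and> y \<in> carrier L}"
    then obtain x y where xy: "v = nonabelian_pure R L x y" "x \<in> carrier L" "y \<in> carrier L" by auto
    then have "g (commutator_map v) = bracket ?N (g x) (g y)" by (simp add: commutator_map_pure gb)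
    also have "\<dots> = v" using xy gc by (simp add: nonabelian_bracket_eq section_of)
    finally show "g (commutator_map v) = v" .
  qed
  have bij: "bij_betw commutator_map (carrier ?N) (carrier L)"
    by (rule bij_betw_byWitness[where f' = g]) (use gm section_of gc mc in auto)
  have "supermodule R ?N"
  proof (rule supermoduleI[OF nonabelian_tensor_module nonabelian_hpart_submodule])
    fix u assume u: "u \<in> carrier ?N"
    obtain x0 x1 where x: "x0 \<in> hpart L 0" "x1 \<in> hpart L 1" "commutator_map u = x0 \<oplus>\<^bsub>L\<^esub> x1"
      using supermodule_decompose[OF L.supermodule_axioms mc[OF u]] .
    then have "u = g x0 \<oplus>\<^bsub>?N\<^esub> g x1"
      using gm[OF u] hpart_carrier by (simp add: linear_map_add[OF gl])
    then show "\<exists>u0\<in>hpart ?N 0. \<exists>u1\<in>hpart ?N 1. u = u0 \<oplus>\<^bsub>?N\<^esub> u1"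
      using x g(2) by (auto simp: graded_map_def)
  next
    fix u assume u: "u \<in> hpart ?N 0" "u \<in> hpart ?N 1"
    let ?x = "commutator_map u"
    have uc: "u \<in> carrier ?N" using nonabelian_hpart_submodule u(1) by (rule submodule_carrier)
    have x: "?x \<in> hpart L 0" "?x \<in> hpart L 1" using u commutator_map_graded by (auto simp: graded_map_def)
    have z: "\<zero>\<^bsub>L\<^esub> \<in> hpart L p" for p by (rule submodule_zero[OF L.hpart_submodule])
    have "?x = \<zero>\<^bsub>L\<^esub>"
      by (rule supermodule_decomposition_unique(1)[OF L.supermodule_axioms x(1) z z x(2)])
        (use x hpart_carrier in simp)
    then show "u = \<zero>\<^bsub>?N\<^esub>"
      using gm[OF uc] linear_map_zero[OF L.module_axioms nonabelian_tensor_module gl] by simp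
  qed
  then have "leibniz_superalgebra R ?N"
    by (intro leibniz_superalgebra.intro leibniz_superalgebra_axioms.intro)
      (use N.bracket_bilinear N.bracket_hpart N.leibniz in auto)
  then show ?thesis
    unfolding leibniz_iso_def
    using L bij commutator_map_graded commutator_map_bracket
    by (auto simp: linear_map_add[OF commutator_map_linear] linear_map_smult[OF commutator_map_linear] graded_map_def)
qed

end


section \<open>The Steinberg relations\<close>

text \<open>
  Elements of a graded Leibniz structure that satisfy the Steinberg relations. The notion applies both to the
  generators of the Steinberg algebra and to candidates for their images under a homomorphism.
\<close>

locale steinberg_family = graded_leibniz R L for R (structure) and L (structure) +
  fixes D :: "('a, 'd, 'dm) superdialgebra_scheme" and m n :: nat
    and E :: "nat \<Rightarrow> nat \<Rightarrow> bit \<Rightarrow> 'd \<Rightarrow> 'c"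
  assumes gen_hpart: "\<lbrakk>i \<in> {1..m+n}; j \<in> {1..m+n}; i \<noteq> j; a \<in> hpart D \<alpha>\<rbrakk> \<Longrightarrow>
      E i j \<alpha> a \<in> hpart L (st_deg m i j \<alpha>)"
    and gen_linear: "\<lbrakk>i \<in> {1..m+n}; j \<in> {1..m+n}; i \<noteq> j; a \<in> hpart D \<alpha>; b \<in> hpart D \<alpha>;
      r \<in> carrier R; s \<in> carrier R\<rbrakk> \<Longrightarrow>
      E i j \<alpha> (r \<odot>\<^bsub>D\<^esub> a \<oplus>\<^bsub>D\<^esub> s \<odot>\<^bsub>D\<^esub> b) = r \<odot>\<^bsub>L\<^esub> E i j \<alpha> a \<oplus>\<^bsub>L\<^esub> s \<odot>\<^bsub>L\<^esub> E i j \<alpha> b"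
    and gen_right: "\<lbrakk>i \<in> {1..m+n}; j \<in> {1..m+n}; l \<in> {1..m+n}; i \<noteq> j; j \<noteq> l; i \<noteq> l;
      a \<in> hpart D \<alpha>; b \<in> hpart D \<beta>\<rbrakk> \<Longrightarrow>
      bracket L (E i j \<alpha> a) (E j l \<beta> b) = E i l (\<alpha> + \<beta>) (a \<stileturn>\<^bsub>D\<^esub> b)"
    and gen_left: "\<lbrakk>i \<in> {1..m+n}; j \<in> {1..m+n}; k \<in> {1..m+n}; i \<noteq> j; k \<noteq> i; j \<noteq> k;
      a \<in> hpart D \<alpha>; b \<in> hpart D \<beta>\<rbrakk> \<Longrightarrow>
      bracket L (E i j \<alpha> a) (E k i \<beta> b) =
        \<ominus>\<^bsub>L\<^esub> (sgn_pow R (st_deg m i j \<alpha> * st_deg m k i \<beta>) \<odot>\<^bsub>L\<^esub> E k j (\<beta> + \<alpha>) (b \<turnstile>\<^bsub>D\<^esub> a))"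
    and gen_zero: "\<lbrakk>i \<in> {1..m+n}; j \<in> {1..m+n}; k \<in> {1..m+n}; l \<in> {1..m+n}; i \<noteq> j; k \<noteq> l;
      i \<noteq> l; j \<noteq> k; a \<in> hpart D \<alpha>; b \<in> hpart D \<beta>\<rbrakk> \<Longrightarrow>
      bracket L (E i j \<alpha> a) (E k l \<beta> b) = \<zero>\<^bsub>L\<^esub>"

lemma st_deg_add: "st_deg m i j \<alpha> + st_deg m j l \<beta> = st_deg m i l (\<alpha> + \<beta>)"
  by (cases "index_deg m j"; cases "index_deg m i"; cases "index_deg m l"; cases \<alpha>; cases \<beta>)
    (simp_all add: st_deg_def)

lemma st_deg_add': "st_deg m i j \<alpha> + st_deg m k i \<beta> = st_deg m k j (\<beta> + \<alpha>)"
  using st_deg_add[of m k i \<beta> j \<alpha>] by (simp only: add.commute)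

lemma (in cring) sgn_pow_add: "sgn_pow R (p + q) = sgn_pow R p \<otimes> sgn_pow R q"
  by (cases p; cases q) (simp_all add: sgn_pow_def l_minus)

context superdialgebra
begin

lemma st_elem_hpart:
  assumes "i \<in> {1..m+n}" "j \<in> {1..m+n}" "i \<noteq> j" "a \<in> hpart D \<alpha>"
  shows "st_elem R i j \<alpha> a \<in> hpart (st_free R D m n) (st_deg m i j \<alpha>)"
  unfolding st_elem_def st_free_def
  by (rule basis_vec_hpart) (use assms in \<open>auto simp: st_gens_def\<close>)

lemma dialgebra_linear_closed:
  assumes "a \<in> hpart D \<alpha>" "b \<in> hpart D \<alpha>" "r \<in> carrier R" "s \<in> carrier R"
  shows "r \<odot>\<^bsub>D\<^esub> a \<oplus>\<^bsub>D\<^esub> s \<odot>\<^bsub>D\<^esub> b \<in> hpart D \<alpha>"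
  using assms by (intro submodule_add[OF hpart_submodule] submodule_smult[OF hpart_submodule])

text \<open>
  Each relator is homogeneous because the degree of the middle index cancels modulo 2. This is what makes the
  ideal of relations homogeneous.
\<close>

lemma st_relators_homogeneous:
  "st_relators R D m n \<subseteq> hpart (st_free R D m n) 0 \<union> hpart (st_free R D m n) 1"
proof
  fix s assume s: "s \<in> st_relators R D m n"
  let ?A = "st_free R D m n"
  have sub: "submodule (hpart ?A p) R ?A" for p
    unfolding st_free_def by (rule free_superalgebra_hpart)
  have br: "bracket ?A x y \<in> hpart ?A (\<alpha> + \<beta>)" if "x \<in> hpart ?A \<alpha>" "y \<in> hpart ?A \<beta>" for x y \<alpha> \<beta>
    using that unfolding st_free_def by (rule free_superalgebra_bracket_hpart)
  note closed = submodule_minus[OF sub] submodule_uminus[OF sub] submodule_add[OF sub] submodule_smult[OF sub]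
  from s have "\<exists>p. s \<in> hpart ?A p"
  proof cases
    case (linear i j a \<alpha> b r s')
    then have "s \<in> hpart ?A (st_deg m i j \<alpha>)"
      by (auto intro!: closed st_elem_hpart dialgebra_linear_closed)
    then show ?thesis ..
  next
    case (right i j k l a \<alpha> b \<beta>)
    have "bracket ?A (st_elem R i j \<alpha> a) (st_elem R k l \<beta> b) \<in> hpart ?A (st_deg m i l (\<alpha> + \<beta>))"
      using br[OF st_elem_hpart[OF right(2,3,6,8)] st_elem_hpart[OF right(4,5,7,9)]]
      by (simp only: right(11) st_deg_add)
    then have "s \<in> hpart ?A (st_deg m i l (\<alpha> + \<beta>))"
      unfolding right(1) using right by (intro closed st_elem_hpart rprod_hpart)
    then show ?thesis ..
  next
    case (left i j k l a \<alpha> b \<beta>)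
    have "bracket ?A (st_elem R i j \<alpha> a) (st_elem R k l \<beta> b) \<in> hpart ?A (st_deg m k j (\<beta> + \<alpha>))"
      using br[OF st_elem_hpart[OF left(2,3,6,8)] st_elem_hpart[OF left(4,5,7,9)]]
      by (simp only: left(10) st_deg_add')
    then have "s \<in> hpart ?A (st_deg m k j (\<beta> + \<alpha>))"
      unfolding left(1) using left by (intro closed st_elem_hpart lprod_hpart sgn_pow_closed) auto
    then show ?thesis ..
  next
    case (zero i j k l a \<alpha> b \<beta>)
    then show ?thesis
      using br[OF st_elem_hpart[OF zero(2,3,6,8)] st_elem_hpart[OF zero(4,5,7,9)]] by blast
  qed
  then obtain p where "s \<in> hpart ?A p" ..
  then show "s \<in> hpart ?A 0 \<union> hpart ?A 1" by (cases p) auto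
qed

lemmas st_relators_homogeneous' = st_relators_homogeneous[unfolded st_free_def]

lemma stl_leibniz: "leibniz_superalgebra R (stl R m n D)"
  unfolding stl_def by (rule presented_leibniz_superalgebra[OF st_relators_homogeneous'])

definition stl_gen :: "nat \<Rightarrow> nat \<Rightarrow> nat \<Rightarrow> nat \<Rightarrow> bit \<Rightarrow> 'c \<Rightarrow> ('c st_gen monomial \<Rightarrow> 'a) set" where
  "stl_gen m n i j \<alpha> a =
     presented_proj R (st_gens D m n) (st_gen_deg m) (st_relators R D m n) (st_elem R i j \<alpha> a)"

lemma stl_family: "steinberg_family R (stl R m n D) D m n (stl_gen m n)"
proof -
  let ?A = "st_free R D m n"
  let ?\<pi> = "presented_proj R (st_gens D m n) (st_gen_deg m) (st_relators R D m n)"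
  let ?L = "stl R m n D"
  let ?I = "two_sided_ideal R ?A hull (leibniz_relators R ?A \<union> st_relators R D m n)"
  interpret L: graded_leibniz R ?L by (rule graded_leibniz_if_leibniz_superalgebra[OF stl_leibniz])
  have A: "module R ?A" unfolding st_free_def by (rule free_superalgebra_module)
  interpret A: module R ?A by fact
  have q: "quotient_map R ?A ?I ?L ?\<pi>"
    unfolding stl_def st_free_def by (rule presented_quotient_map[OF st_relators_homogeneous'])
  have hom: "bracket_hom R ?A ?L ?\<pi>"
    unfolding stl_def st_free_def by (rule presented_bracket_hom[OF st_relators_homogeneous'])
  have lin: "linear_map R ?A ?L ?\<pi>" using hom by (simp add: bracket_hom_def)
  have ehp: "st_elem R i j \<alpha> a \<in> hpart ?A (st_deg m i j \<alpha>)"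
    if "i \<in> {1..m+n}" "j \<in> {1..m+n}" "i \<noteq> j" "a \<in> hpart D \<alpha>" for i j \<alpha> a
    by (rule st_elem_hpart[OF that])
  have hc: "x \<in> carrier ?A" if "x \<in> hpart ?A p" for x p
    using that by (simp add: st_free_def free_superalgebra_simps)
  note ec = hc[OF ehp]
  have brc: "bracket ?A x y \<in> carrier ?A" if "x \<in> carrier ?A" "y \<in> carrier ?A" for x y
    using that unfolding st_free_def by (rule free_superalgebra_bracket_closed)
  have br: "?\<pi> (bracket ?A x y) = bracket ?L (?\<pi> x) (?\<pi> y)" if "x \<in> carrier ?A" "y \<in> carrier ?A" for x y
    using hom that by (simp add: bracket_hom_def)
  have inI: "x \<in> ?I" if "x \<in> st_relators R D m n" for x
    using that by (intro hull_inc) auto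
  have eq: "?\<pi> x = ?\<pi> y" if "x \<ominus>\<^bsub>?A\<^esub> y \<in> st_relators R D m n" "x \<in> carrier ?A" "y \<in> carrier ?A" for x y
    using quotient_map_eq_iff[OF A L.module_axioms q that(2,3)] inI[OF that(1)] by simp
  show ?thesis
  proof (intro steinberg_family.intro steinberg_family_axioms.intro L.graded_leibniz_axioms)
    fix i j a \<alpha> assume ij: "i \<in> {1..m+n}" "j \<in> {1..m+n}" "i \<noteq> j" and a: "a \<in> hpart D \<alpha>"
    have "hpart ?L (st_deg m i j \<alpha>) = ?\<pi> ` hpart ?A (st_deg m i j \<alpha>)"
      unfolding stl_def st_free_def by (rule presented_hpart[OF st_relators_homogeneous'])
    then show "stl_gen m n i j \<alpha> a \<in> hpart ?L (st_deg m i j \<alpha>)"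
      using ehp[OF ij a] by (simp add: stl_gen_def)
    fix b r s assume b: "b \<in> hpart D \<alpha>" and rs: "r \<in> carrier R" "s \<in> carrier R"
    have "?\<pi> (st_elem R i j \<alpha> (r \<odot>\<^bsub>D\<^esub> a \<oplus>\<^bsub>D\<^esub> s \<odot>\<^bsub>D\<^esub> b)) =
        ?\<pi> (r \<odot>\<^bsub>?A\<^esub> st_elem R i j \<alpha> a \<oplus>\<^bsub>?A\<^esub> s \<odot>\<^bsub>?A\<^esub> st_elem R i j \<alpha> b)"
      using ij a b rs
      by (intro eq st_relators.linear ec A.M.a_closed A.smult_closed dialgebra_linear_closed)
    then show "stl_gen m n i j \<alpha> (r \<odot>\<^bsub>D\<^esub> a \<oplus>\<^bsub>D\<^esub> s \<odot>\<^bsub>D\<^esub> b) =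
        r \<odot>\<^bsub>?L\<^esub> stl_gen m n i j \<alpha> a \<oplus>\<^bsub>?L\<^esub> s \<odot>\<^bsub>?L\<^esub> stl_gen m n i j \<alpha> b"
      using ec[OF ij a] ec[OF ij b] rs
      by (simp add: stl_gen_def linear_map_add[OF lin] linear_map_smult[OF lin])
  next
    fix i j l a \<alpha> b \<beta>
    assume *: "i \<in> {1..m+n}" "j \<in> {1..m+n}" "l \<in> {1..m+n}" "i \<noteq> j" "j \<noteq> l" "i \<noteq> l"
      "a \<in> hpart D \<alpha>" "b \<in> hpart D \<beta>"
    have c: "st_elem R i j \<alpha> a \<in> carrier ?A" "st_elem R j l \<beta> b \<in> carrier ?A"
      "st_elem R i l (\<alpha> + \<beta>) (a \<stileturn>\<^bsub>D\<^esub> b) \<in> carrier ?A"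
      using ec[OF *(1,2,4,7)] ec[OF *(2,3,5,8)] ec[OF *(1,3,6) rprod_hpart[OF *(7,8)]] .
    have "?\<pi> (bracket ?A (st_elem R i j \<alpha> a) (st_elem R j l \<beta> b)) = ?\<pi> (st_elem R i l (\<alpha> + \<beta>) (a \<stileturn>\<^bsub>D\<^esub> b))"
      using * c by (intro eq st_relators.right brc refl)
    then show "bracket ?L (stl_gen m n i j \<alpha> a) (stl_gen m n j l \<beta> b) = stl_gen m n i l (\<alpha> + \<beta>) (a \<stileturn>\<^bsub>D\<^esub> b)"
      unfolding stl_gen_def using br c by metis
  next
    fix i j k a \<alpha> b \<beta>
    assume *: "i \<in> {1..m+n}" "j \<in> {1..m+n}" "k \<in> {1..m+n}" "i \<noteq> j" "k \<noteq> i" "j \<noteq> k"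
      "a \<in> hpart D \<alpha>" "b \<in> hpart D \<beta>"
    let ?s = "sgn_pow R (st_deg m i j \<alpha> * st_deg m k i \<beta>)"
    have c: "st_elem R i j \<alpha> a \<in> carrier ?A" "st_elem R k i \<beta> b \<in> carrier ?A"
      "st_elem R k j (\<beta> + \<alpha>) (b \<turnstile>\<^bsub>D\<^esub> a) \<in> carrier ?A"
      using ec[OF *(1,2,4,7)] ec[OF *(3,1,5,8)] ec[OF *(3,2) *(6)[symmetric] lprod_hpart[OF *(8,7)]] .
    have "?\<pi> (bracket ?A (st_elem R i j \<alpha> a) (st_elem R k i \<beta> b)) =
        ?\<pi> (\<ominus>\<^bsub>?A\<^esub> (?s \<odot>\<^bsub>?A\<^esub> st_elem R k j (\<beta> + \<alpha>) (b \<turnstile>\<^bsub>D\<^esub> a)))"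
      using * c by (intro eq st_relators.left brc refl A.M.a_inv_closed A.smult_closed sgn_pow_closed)
    also have "\<dots> = \<ominus>\<^bsub>?L\<^esub> (?s \<odot>\<^bsub>?L\<^esub> ?\<pi> (st_elem R k j (\<beta> + \<alpha>) (b \<turnstile>\<^bsub>D\<^esub> a)))"
      using c by (simp only: linear_map_uminus[OF A L.module_axioms lin] linear_map_smult[OF lin]
          A.smult_closed sgn_pow_closed)
    finally show "bracket ?L (stl_gen m n i j \<alpha> a) (stl_gen m n k i \<beta> b) =
        \<ominus>\<^bsub>?L\<^esub> (?s \<odot>\<^bsub>?L\<^esub> stl_gen m n k j (\<beta> + \<alpha>) (b \<turnstile>\<^bsub>D\<^esub> a))"
      unfolding stl_gen_def using br c by metis
  next
    fix i j k l a \<alpha> b \<beta>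
    assume *: "i \<in> {1..m+n}" "j \<in> {1..m+n}" "k \<in> {1..m+n}" "l \<in> {1..m+n}" "i \<noteq> j" "k \<noteq> l"
      "i \<noteq> l" "j \<noteq> k" "a \<in> hpart D \<alpha>" "b \<in> hpart D \<beta>"
    have c: "st_elem R i j \<alpha> a \<in> carrier ?A" "st_elem R k l \<beta> b \<in> carrier ?A"
      using ec[OF *(1,2,5,9)] ec[OF *(3,4,6,10)] .
    have "bracket ?A (st_elem R i j \<alpha> a) (st_elem R k l \<beta> b) \<in> ?I"
      using * by (intro inI st_relators.zero)
    then have "?\<pi> (bracket ?A (st_elem R i j \<alpha> a) (st_elem R k l \<beta> b)) = \<zero>\<^bsub>?L\<^esub>"
      using q brc[OF c] by (simp add: quotient_map_def)
    then show "bracket ?L (stl_gen m n i j \<alpha> a) (stl_gen m n k l \<beta> b) = \<zero>\<^bsub>?L\<^esub>"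
      unfolding stl_gen_def using br[OF c] by metis
  qed
qed

text \<open>
  The Steinberg relations for \<open>G\<close> say precisely that the homomorphism from the free superalgebra determined by
  \<open>G\<close> kills the relators.
\<close>

lemma stl_universal:
  assumes "steinberg_family R P D m n G"
  shows "\<exists>g. bracket_hom R (stl R m n D) P g \<and> graded_map (stl R m n D) P g \<and>
    (\<forall>i\<in>{1..m+n}. \<forall>j\<in>{1..m+n}. \<forall>\<alpha>. \<forall>a\<in>hpart D \<alpha>. i \<noteq> j \<longrightarrow> g (stl_gen m n i j \<alpha> a) = G i j \<alpha> a)"
proof -
  interpret G: steinberg_family R P D m n G by fact
  let ?A = "st_free R D m n"
  define \<phi> where "\<phi> x = (case x of F i j \<alpha> a \<Rightarrow> G i j \<alpha> a)" for x
  have A: "module R ?A" unfolding st_free_def by (rule free_superalgebra_module)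
  interpret A: module R ?A by fact
  have ec: "st_elem R i j \<alpha> a \<in> carrier ?A"
    if "i \<in> {1..m+n}" "j \<in> {1..m+n}" "i \<noteq> j" "a \<in> hpart D \<alpha>" for i j \<alpha> a
    using st_elem_hpart[OF that] by (simp add: st_free_def free_superalgebra_simps)
  have Gc: "G i j \<alpha> a \<in> carrier P"
    if "i \<in> {1..m+n}" "j \<in> {1..m+n}" "i \<noteq> j" "a \<in> hpart D \<alpha>" for i j \<alpha> a
    using G.gen_hpart[OF that] by (rule submodule_carrier[OF G.hpart_sub])
  have brc: "bracket ?A x y \<in> carrier ?A" if "x \<in> carrier ?A" "y \<in> carrier ?A" for x y
    using that unfolding st_free_def by (rule free_superalgebra_bracket_closed)
  have "\<exists>g. bracket_hom R (stl R m n D) P g \<and> graded_map (stl R m n D) P g \<and>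
    (\<forall>x\<in>st_gens D m n. g (presented_proj R (st_gens D m n) (st_gen_deg m) (st_relators R D m n)
        (basis_vec R (Gen x))) = \<phi> x)"
    unfolding stl_def
  proof (rule presented_universal[OF st_relators_homogeneous' G.graded_leibniz_axioms])
    show "\<phi> x \<in> hpart P (st_gen_deg m x)" if "x \<in> st_gens D m n" for x
      using that by (auto simp: st_gens_def \<phi>_def intro!: G.gen_hpart)
    fix h s assume h: "bracket_hom R (free_superalgebra R (st_gens D m n) (st_gen_deg m)) P h"
      and hg: "\<And>x. x \<in> st_gens D m n \<Longrightarrow> h (basis_vec R (Gen x)) = \<phi> x" and s: "s \<in> st_relators R D m n"
    have lin: "linear_map R ?A P h" and hb: "\<And>f g. f \<in> carrier ?A \<Longrightarrow> g \<in> carrier ?A \<Longrightarrow>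
        h (bracket ?A f g) = bracket P (h f) (h g)"
      using h by (auto simp: bracket_hom_def st_free_def)
    have he: "h (st_elem R i j \<alpha> a) = G i j \<alpha> a"
      if "i \<in> {1..m+n}" "j \<in> {1..m+n}" "i \<noteq> j" "a \<in> hpart D \<alpha>" for i j \<alpha> a
      unfolding st_elem_def using that by (subst hg) (auto simp: st_gens_def \<phi>_def)
    note lm = linear_map_minus[OF A G.module_axioms lin] linear_map_add[OF lin] linear_map_smult[OF lin]
      linear_map_uminus[OF A G.module_axioms lin]
    have minus0: "x \<ominus>\<^bsub>P\<^esub> x = \<zero>\<^bsub>P\<^esub>" if "x \<in> carrier P" for x using that by (simp add: G.M.minus_eq_zero_iff)
    from s show "h s = \<zero>\<^bsub>P\<^esub>"
    proof cases
      case (linear i j a \<alpha> b r s')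
      note e = ec[OF linear(2-4)] he[OF linear(2-4)] Gc[OF linear(2-4)]
      note ab = linear(5,6) dialgebra_linear_closed[OF linear(5-8)]
      show ?thesis
        unfolding linear(1) using linear(7,8) ab
        by (simp add: lm e G.gen_linear[OF linear(2-8)] minus0)
    next
      case (right i j k l a \<alpha> b \<beta>)
      note c = ec[OF right(2,3,6,8)] ec[OF right(4,5,7,9)] ec[OF right(2,5,10) rprod_hpart[OF right(8,9)]]
      have "h (bracket ?A (st_elem R i j \<alpha> a) (st_elem R k l \<beta> b)) = G i l (\<alpha> + \<beta>) (a \<stileturn>\<^bsub>D\<^esub> b)"
        unfolding hb[OF c(1,2)] he[OF right(2,3,6,8)] he[OF right(4,5,7,9)]
        unfolding right(11)[symmetric]
        by (rule G.gen_right[OF right(2,3,5,6) _ right(10,8,9)]) (use right(7,11) in simp)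
      then show ?thesis
        unfolding right(1) lm(1)[OF brc[OF c(1,2)] c(3)] he[OF right(2,5,10) rprod_hpart[OF right(8,9)]]
        using Gc[OF right(2,5,10) rprod_hpart[OF right(8,9)]] by (simp only: minus0)
    next
      case (left i j k l a \<alpha> b \<beta>)
      have kj: "k \<noteq> j" using left by auto
      note c = ec[OF left(2,3,6,8)] ec[OF left(4,5,7,9)] ec[OF left(4,3) kj lprod_hpart[OF left(9,8)]]
      let ?s = "sgn_pow R (st_deg m i j \<alpha> * st_deg m k l \<beta>)"
      let ?v = "\<ominus>\<^bsub>?A\<^esub> (?s \<odot>\<^bsub>?A\<^esub> st_elem R k j (\<beta> + \<alpha>) (b \<turnstile>\<^bsub>D\<^esub> a))"
      let ?w = "\<ominus>\<^bsub>P\<^esub> (?s \<odot>\<^bsub>P\<^esub> G k j (\<beta> + \<alpha>) (b \<turnstile>\<^bsub>D\<^esub> a))"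
      have v: "?v \<in> carrier ?A" using c(3) by (intro A.M.a_inv_closed A.smult_closed sgn_pow_closed)
      have "h (bracket ?A (st_elem R i j \<alpha> a) (st_elem R k l \<beta> b)) = ?w"
        unfolding hb[OF c(1,2)] he[OF left(2,3,6,8)] he[OF left(4,5,7,9)]
        unfolding left(10)[symmetric]
        by (rule G.gen_left[OF left(2,3,4,6) _ left(11,8,9)]) (use left(7,10) in simp)
      moreover have "h ?v = ?w"
        using c(3) by (simp only: lm A.smult_closed sgn_pow_closed
            he[OF left(4,3) kj lprod_hpart[OF left(9,8)]])
      moreover have "?w \<in> carrier P"
        using Gc[OF left(4,3) kj lprod_hpart[OF left(9,8)]]
        by (intro G.M.a_inv_closed G.smult_closed sgn_pow_closed)
      ultimately show ?thesis
        unfolding left(1) lm(1)[OF brc[OF c(1,2)] v] by (simp only: minus0)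
    next
      case (zero i j k l a \<alpha> b \<beta>)
      note c = ec[OF zero(2,3,6,8)] ec[OF zero(4,5,7,9)]
      show ?thesis
        unfolding zero(1) hb[OF c] he[OF zero(2,3,6,8)] he[OF zero(4,5,7,9)]
        by (rule G.gen_zero[OF zero(2-7,10,11,8,9)])
    qed
  qed
  then obtain g where g: "bracket_hom R (stl R m n D) P g" "graded_map (stl R m n D) P g"
    "\<And>x. x \<in> st_gens D m n \<Longrightarrow> g (presented_proj R (st_gens D m n) (st_gen_deg m) (st_relators R D m n)
        (basis_vec R (Gen x))) = \<phi> x"
    by blast
  have "g (stl_gen m n i j \<alpha> a) = G i j \<alpha> a"
    if "i \<in> {1..m+n}" "j \<in> {1..m+n}" "i \<noteq> j" "a \<in> hpart D \<alpha>" for i j \<alpha> a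
    unfolding stl_gen_def st_elem_def using that by (subst g(3)) (auto simp: st_gens_def \<phi>_def)
  then show ?thesis using g(1,2) by blast
qed

lemma stl_hom_ext:
  assumes P: "module R P" and h: "bracket_hom R (stl R m n D) P h" and k: "bracket_hom R (stl R m n D) P k"
    and eq: "\<And>i j \<alpha> a. \<lbrakk>i \<in> {1..m+n}; j \<in> {1..m+n}; i \<noteq> j; a \<in> hpart D \<alpha>\<rbrakk> \<Longrightarrow>
      h (stl_gen m n i j \<alpha> a) = k (stl_gen m n i j \<alpha> a)"
    and x: "x \<in> carrier (stl R m n D)"
  shows "h x = k x"
proof (rule presented_hom_ext[OF st_relators_homogeneous' P h[unfolded stl_def] k[unfolded stl_def] _
      x[unfolded stl_def]])
  fix y assume "y \<in> st_gens D m n"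
  then obtain i j \<alpha> a where "i \<in> {1..m+n}" "j \<in> {1..m+n}" "i \<noteq> j" "a \<in> hpart D \<alpha>" "y = F i j \<alpha> a"
    unfolding st_gens_def by blast
  then show "h (presented_proj R (st_gens D m n) (st_gen_deg m) (st_relators R D m n) (basis_vec R (Gen y))) =
      k (presented_proj R (st_gens D m n) (st_gen_deg m) (st_relators R D m n) (basis_vec R (Gen y)))"
    using eq by (simp add: stl_gen_def st_elem_def)
qed

end


section \<open>The Steinberg relations in the tensor square\<close>

lemma fresh_index:
  assumes "5 \<le> m + n"
  obtains s where "s \<in> {1..m+n}" "s \<noteq> i" "s \<noteq> j" "s \<noteq> k" "s \<noteq> (l::nat)"
proof -
  have "card {i, j, k, l} \<le> 4" by (simp add: card_insert_if)
  then have "card {i, j, k, l} < card {1..m+n}" using assms by simp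
  then have "\<not> {1..m+n} \<subseteq> {i, j, k, l}" using card_mono[of "{i, j, k, l}" "{1..m+n}"] by auto
  then show thesis using that by blast
qed

text \<open>
  The computation in the tensor square uses nothing about the Steinberg algebra except the relations between its
  generators, so it is carried out for any family satisfying them.
\<close>

locale unital_steinberg_family =
  D: unital_superdialgebra R D e + steinberg_family R L D m n E + L: leibniz_superalgebra R L
  for R (structure) and D :: "('a, 'd, 'dm) superdialgebra_scheme" (structure) and e :: 'd and L (structure)
    and m n :: nat and E +
  assumes rank: "5 \<le> m + n"
begin

abbreviation T where "T \<equiv> nonabelian_tensor R L"
abbreviation t where "t \<equiv> nonabelian_pure R L"

lemma T_graded: "graded_leibniz R T"
  by (rule nonabelian_graded_leibniz[OF L.leibniz_superalgebra_axioms])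

sublocale T: graded_leibniz R T by (rule T_graded)

lemma t_bilinear: "bilinear_map R L L T t"
  by (rule nonabelian_pure_bilinear[OF L.leibniz_superalgebra_axioms])

lemmas t_closed = bilinear_map_closed[OF t_bilinear]
lemmas t_rel = nonabelian_pure_bracket[OF L.leibniz_superalgebra_axioms]

lemma t_zero_left: "y \<in> carrier L \<Longrightarrow> t \<zero>\<^bsub>L\<^esub> y = \<zero>\<^bsub>T\<^esub>"
  using linear_map_zero[OF module_axioms T.module_axioms bilinear_map_left[OF t_bilinear]] by simp

lemma t_zero_right: "x \<in> carrier L \<Longrightarrow> t x \<zero>\<^bsub>L\<^esub> = \<zero>\<^bsub>T\<^esub>"
  using linear_map_zero[OF module_axioms T.module_axioms bilinear_map_right[OF t_bilinear]] by simp

lemma E_carrier: "\<lbrakk>i \<in> {1..m+n}; j \<in> {1..m+n}; i \<noteq> j; a \<in> hpart D \<alpha>\<rbrakk> \<Longrightarrow> E i j \<alpha> a \<in> carrier L"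
  by (rule submodule_carrier[OF hpart_sub gen_hpart])

lemma D_carrier: "a \<in> hpart D \<alpha> \<Longrightarrow> a \<in> carrier D"
  by (rule submodule_carrier[OF D.hpart_submodule])

lemma E_split:
  assumes "i \<in> {1..m+n}" "s \<in> {1..m+n}" "j \<in> {1..m+n}" "i \<noteq> s" "s \<noteq> j" "i \<noteq> j" "a \<in> hpart D \<alpha>"
  shows "bracket L (E i s \<alpha> a) (E s j 0 e) = E i j \<alpha> a"
  using gen_right[OF assms D.bar_unit_even] assms(7) by (simp add: D.bar_unit_right D_carrier)

text \<open>
  Both terms of the expanded tensor vanish when the second factor is split through an index \<open>s\<close> that differs from
  all four given ones.
\<close>

lemma pure_gen_zero:
  assumes "i \<in> {1..m+n}" "j \<in> {1..m+n}" "k \<in> {1..m+n}" "l \<in> {1..m+n}" "i \<noteq> j" "k \<noteq> l" "i \<noteq> l" "j \<noteq> k"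
    and ab: "a \<in> hpart D \<alpha>" "b \<in> hpart D \<beta>"
  shows "t (E i j \<alpha> a) (E k l \<beta> b) = \<zero>\<^bsub>T\<^esub>"
proof -
  obtain s where s: "s \<in> {1..m+n}" "s \<noteq> i" "s \<noteq> j" "s \<noteq> k" "s \<noteq> l" using fresh_index[OF rank] .
  have x: "E i j \<alpha> a \<in> hpart L (st_deg m i j \<alpha>)" using assms by (intro gen_hpart)
  have y: "E k s \<beta> b \<in> hpart L (st_deg m k s \<beta>)" using assms s by (intro gen_hpart) blast+
  have z: "E s l 0 e \<in> hpart L (st_deg m s l 0)" using assms s by (intro gen_hpart D.bar_unit_even) blast+
  have yc: "E k s \<beta> b \<in> carrier L" "E s l 0 e \<in> carrier L"
    using y z by (auto intro: submodule_carrier[OF hpart_sub])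
  have yz: "bracket L (E k s \<beta> b) (E s l 0 e) = E k l \<beta> b" using assms s by (intro E_split) blast+
  have xy: "bracket L (E i j \<alpha> a) (E k s \<beta> b) = \<zero>\<^bsub>L\<^esub>" using assms s by (intro gen_zero) blast+
  have xz: "bracket L (E i j \<alpha> a) (E s l 0 e) = \<zero>\<^bsub>L\<^esub>"
    using assms s by (intro gen_zero D.bar_unit_even) blast+
  show ?thesis using t_rel[OF x y z] by (simp add: yz xy xz t_zero_left yc T.M.minus_eq_zero_iff)
qed

text \<open>
  Splitting the second factor as \<open>[F_js(b), F_sl(e)]\<close> leaves one term, which depends on \<open>a\<close> and \<open>b\<close> only through
  \<open>a \<stileturn> b\<close>.
\<close>

lemma pure_gen_right:
  assumes "i \<in> {1..m+n}" "j \<in> {1..m+n}" "l \<in> {1..m+n}" "s \<in> {1..m+n}" "i \<noteq> j" "j \<noteq> l" "i \<noteq> l"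
    and s: "s \<noteq> i" "s \<noteq> j" "s \<noteq> l" and ab: "a \<in> hpart D \<alpha>" "b \<in> hpart D \<beta>"
  shows "t (E i j \<alpha> a) (E j l \<beta> b) = t (E i s (\<alpha> + \<beta>) (a \<stileturn>\<^bsub>D\<^esub> b)) (E s l 0 e)"
proof -
  have x: "E i j \<alpha> a \<in> hpart L (st_deg m i j \<alpha>)" using assms by (intro gen_hpart)
  have y: "E j s \<beta> b \<in> hpart L (st_deg m j s \<beta>)" using assms s by (intro gen_hpart) blast+
  have z: "E s l 0 e \<in> hpart L (st_deg m s l 0)" using assms s by (intro gen_hpart D.bar_unit_even) blast+
  have yc: "E j s \<beta> b \<in> carrier L" "E s l 0 e \<in> carrier L"
    using y z by (auto intro: submodule_carrier[OF hpart_sub])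
  have wc: "E i s (\<alpha> + \<beta>) (a \<stileturn>\<^bsub>D\<^esub> b) \<in> carrier L"
    using assms by (intro E_carrier D.rprod_hpart) blast+
  have yz: "bracket L (E j s \<beta> b) (E s l 0 e) = E j l \<beta> b" using assms s by (intro E_split) blast+
  have xy: "bracket L (E i j \<alpha> a) (E j s \<beta> b) = E i s (\<alpha> + \<beta>) (a \<stileturn>\<^bsub>D\<^esub> b)"
    using assms s by (intro gen_right) blast+
  have xz: "bracket L (E i j \<alpha> a) (E s l 0 e) = \<zero>\<^bsub>L\<^esub>"
    using assms s by (intro gen_zero D.bar_unit_even) blast+
  show ?thesis
    using t_rel[OF x y z] t_closed[OF wc yc(2)] unfolding yz xy xz
    by (simp add: t_zero_left yc a_minus_def)
qed

text \<open>
  The image of \<open>F_ij(a)\<close> in the tensor square. The intermediate index is chosen arbitrarily; the result does not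
  depend on it by \<open>tensor_gen_eq\<close>.
\<close>

definition tensor_gen :: "nat \<Rightarrow> nat \<Rightarrow> bit \<Rightarrow> 'd \<Rightarrow> _" where
  "tensor_gen i j \<alpha> a = (let s = (SOME s. s \<in> {1..m+n} \<and> s \<noteq> i \<and> s \<noteq> j) in t (E i s \<alpha> a) (E s j 0 e))"

text \<open>
  Independence of the intermediate index is the case \<open>b = e\<close> of \<open>pure_gen_right\<close>, read as passing from one
  intermediate index to another.
\<close>

lemma tensor_gen_eq:
  assumes "i \<in> {1..m+n}" "j \<in> {1..m+n}" "i \<noteq> j" "a \<in> hpart D \<alpha>" and s: "s \<in> {1..m+n}" "s \<noteq> i" "s \<noteq> j"
  shows "tensor_gen i j \<alpha> a = t (E i s \<alpha> a) (E s j 0 e)"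
proof -
  define k where "k = (SOME s. s \<in> {1..m+n} \<and> s \<noteq> i \<and> s \<noteq> j)"
  have k: "k \<in> {1..m+n} \<and> k \<noteq> i \<and> k \<noteq> j"
    unfolding k_def by (rule someI[of _ s]) (use s in auto)
  have gen_k: "tensor_gen i j \<alpha> a = t (E i k \<alpha> a) (E k j 0 e)" by (simp add: tensor_gen_def k_def Let_def)
  show ?thesis
  proof (cases "k = s")
    case False
    then have "t (E i k \<alpha> a) (E k j 0 e) = t (E i s (\<alpha> + 0) (a \<stileturn>\<^bsub>D\<^esub> e)) (E s j 0 e)"
      using assms k by (intro pure_gen_right D.bar_unit_even) blast+
    then show ?thesis using assms(4) by (simp add: gen_k D.bar_unit_right D_carrier)
  qed (use gen_k in simp)
qed

text \<open>
  Here the first factor is split, \<open>F_ij(a) = [F_is(a), F_sj(e)]\<close>: the term with \<open>[F_sj(e), F_ki(b)] = 0\<close> drops out and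
  \<open>[F_is(a), F_ki(b)]\<close> produces \<open>b \<turnstile> a\<close>. The two signs that arise combine to the expected one since the
  degrees of \<open>F_is(a)\<close> and \<open>F_sj(e)\<close> add up to that of \<open>F_ij(a)\<close>.
\<close>

lemma pure_gen_left:
  assumes "i \<in> {1..m+n}" "j \<in> {1..m+n}" "k \<in> {1..m+n}" "i \<noteq> j" "k \<noteq> i" "j \<noteq> k"
    and ab: "a \<in> hpart D \<alpha>" "b \<in> hpart D \<beta>"
  shows "t (E i j \<alpha> a) (E k i \<beta> b) =
    \<ominus>\<^bsub>T\<^esub> (sgn_pow R (st_deg m i j \<alpha> * st_deg m k i \<beta>) \<odot>\<^bsub>T\<^esub> tensor_gen k j (\<beta> + \<alpha>) (b \<turnstile>\<^bsub>D\<^esub> a))"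
proof -
  obtain s where s: "s \<in> {1..m+n}" "s \<noteq> i" "s \<noteq> j" "s \<noteq> k" using fresh_index[OF rank] by metis
  let ?x = "E i s \<alpha> a" and ?y = "E s j 0 e" and ?z = "E k i \<beta> b"
  let ?w = "E k s (\<beta> + \<alpha>) (b \<turnstile>\<^bsub>D\<^esub> a)"
  let ?p = "st_deg m i s \<alpha>" and ?q = "st_deg m s j 0" and ?r = "st_deg m k i \<beta>"
  have x: "?x \<in> hpart L ?p" using assms s by (intro gen_hpart) blast+
  have y: "?y \<in> hpart L ?q" using assms s by (intro gen_hpart D.bar_unit_even) blast+
  have z: "?z \<in> hpart L ?r" using assms s by (intro gen_hpart) blast+
  have c: "?x \<in> carrier L" "?y \<in> carrier L" "?z \<in> carrier L"
    using x y z by (auto intro: submodule_carrier[OF hpart_sub])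
  have wc: "?w \<in> carrier L" using assms s by (intro E_carrier D.lprod_hpart) blast+
  have Ec: "E i j \<alpha> a \<in> carrier L" using assms by (intro E_carrier)
  have yz: "bracket L ?y ?z = \<zero>\<^bsub>L\<^esub>" using assms s by (intro gen_zero D.bar_unit_even) blast+
  have xy: "bracket L ?x ?y = E i j \<alpha> a" using assms s by (intro E_split) blast+
  have xz: "bracket L ?x ?z = \<ominus>\<^bsub>L\<^esub> (sgn_pow R (?p * ?r) \<odot>\<^bsub>L\<^esub> ?w)"
    using assms s by (intro gen_left) blast+
  have deg: "?q * ?r + ?p * ?r = st_deg m i j \<alpha> * ?r"
    using st_deg_add[of m i s \<alpha> j 0] by (simp only: distrib_right[symmetric] add.commute[of ?q] add_0_right)
  have gen_w: "tensor_gen k j (\<beta> + \<alpha>) (b \<turnstile>\<^bsub>D\<^esub> a) = t ?w ?y"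
    using assms s by (intro tensor_gen_eq D.lprod_hpart) blast+
  note lin = bilinear_map_left[OF t_bilinear c(2)]
  note tw = t_closed[OF wc c(2)]
  have "t (bracket L ?x ?z) ?y = \<ominus>\<^bsub>T\<^esub> (sgn_pow R (?p * ?r) \<odot>\<^bsub>T\<^esub> t ?w ?y)"
    unfolding xz using wc
    by (simp add: linear_map_uminus[OF module_axioms T.module_axioms lin] linear_map_smult[OF lin])
  then have "sgn_pow R (?q * ?r) \<odot>\<^bsub>T\<^esub> t (bracket L ?x ?z) ?y =
      \<ominus>\<^bsub>T\<^esub> ((sgn_pow R (?q * ?r) \<otimes> sgn_pow R (?p * ?r)) \<odot>\<^bsub>T\<^esub> t ?w ?y)"
    using tw by (simp only: T.smult_r_minus T.smult_assoc1 T.smult_closed D.sgn_pow_closed)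
  also have "\<dots> = \<ominus>\<^bsub>T\<^esub> (sgn_pow R (st_deg m i j \<alpha> * ?r) \<odot>\<^bsub>T\<^esub> tensor_gen k j (\<beta> + \<alpha>) (b \<turnstile>\<^bsub>D\<^esub> a))"
    unfolding gen_w by (simp only: D.sgn_pow_add[symmetric] deg)
  finally have 1: "sgn_pow R (?q * ?r) \<odot>\<^bsub>T\<^esub> t (bracket L ?x ?z) ?y =
      \<ominus>\<^bsub>T\<^esub> (sgn_pow R (st_deg m i j \<alpha> * ?r) \<odot>\<^bsub>T\<^esub> tensor_gen k j (\<beta> + \<alpha>) (b \<turnstile>\<^bsub>D\<^esub> a))" .
  have "t ?x (bracket L ?y ?z) = \<zero>\<^bsub>T\<^esub>" unfolding yz using c(1) by (rule t_zero_right)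
  then have "t (E i j \<alpha> a) ?z \<ominus>\<^bsub>T\<^esub> \<ominus>\<^bsub>T\<^esub> (sgn_pow R (st_deg m i j \<alpha> * ?r) \<odot>\<^bsub>T\<^esub> tensor_gen k j (\<beta> + \<alpha>) (b \<turnstile>\<^bsub>D\<^esub> a)) = \<zero>\<^bsub>T\<^esub>"
    using t_rel[OF x y z] unfolding 1 xy by simp
  then show ?thesis
    using t_closed[OF Ec c(3)] tw unfolding gen_w
    by (simp only: T.M.minus_eq_zero_iff T.M.a_inv_closed T.smult_closed D.sgn_pow_closed)
qed

lemma tensor_gen_obtain:
  assumes "i \<in> {1..m+n}" "j \<in> {1..m+n}" "i \<noteq> j"
  obtains s where "s \<in> {1..m+n}" "s \<noteq> i" "s \<noteq> j"
    "\<And>a \<alpha>. a \<in> hpart D \<alpha> \<Longrightarrow> tensor_gen i j \<alpha> a = t (E i s \<alpha> a) (E s j 0 e)"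
proof -
  obtain s where s: "s \<in> {1..m+n}" "s \<noteq> i" "s \<noteq> j" using fresh_index[OF rank] by metis
  then show thesis using that tensor_gen_eq[OF assms _ s] by blast
qed

lemma commutator_map_tensor_gen:
  assumes "i \<in> {1..m+n}" "j \<in> {1..m+n}" "i \<noteq> j" "a \<in> hpart D \<alpha>"
  shows "commutator_map R L (tensor_gen i j \<alpha> a) = E i j \<alpha> a"
proof -
  obtain s where s: "s \<in> {1..m+n}" "s \<noteq> i" "s \<noteq> j" "tensor_gen i j \<alpha> a = t (E i s \<alpha> a) (E s j 0 e)"
    using tensor_gen_obtain[OF assms(1-3)] assms(4) by metis
  have "E i s \<alpha> a \<in> carrier L" "E s j 0 e \<in> carrier L"
    using assms s by (intro E_carrier D.bar_unit_even; blast)+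
  then have "commutator_map R L (tensor_gen i j \<alpha> a) = bracket L (E i s \<alpha> a) (E s j 0 e)"
    unfolding s(4) by (rule commutator_map_pure[OF L.leibniz_superalgebra_axioms])
  also have "\<dots> = E i j \<alpha> a" using assms s by (intro E_split) blast+
  finally show ?thesis .
qed

lemma tensor_gen_hpart:
  assumes "i \<in> {1..m+n}" "j \<in> {1..m+n}" "i \<noteq> j" "a \<in> hpart D \<alpha>"
  shows "tensor_gen i j \<alpha> a \<in> hpart T (st_deg m i j \<alpha>)"
proof -
  obtain s where s: "s \<in> {1..m+n}" "s \<noteq> i" "s \<noteq> j" "tensor_gen i j \<alpha> a = t (E i s \<alpha> a) (E s j 0 e)"
    using tensor_gen_obtain[OF assms(1-3)] assms(4) by metis
  have "t (E i s \<alpha> a) (E s j 0 e) \<in> hpart T (st_deg m i s \<alpha> + st_deg m s j 0)"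
    using assms s
    by (intro nonabelian_pure_hpart[OF L.leibniz_superalgebra_axioms] gen_hpart D.bar_unit_even) blast+
  then show ?thesis unfolding s(4) by (simp only: st_deg_add add_0_right)
qed

text \<open>
  The bracket of the tensor square sees its arguments only through the commutator map, which takes the images of
  the generators back to the generators. So the Steinberg relations become statements about tensors of generators.
\<close>

lemma bracket_tensor_gen:
  assumes "i \<in> {1..m+n}" "j \<in> {1..m+n}" "i \<noteq> j" "a \<in> hpart D \<alpha>"
    and "k \<in> {1..m+n}" "l \<in> {1..m+n}" "k \<noteq> l" "b \<in> hpart D \<beta>"
  shows "bracket T (tensor_gen i j \<alpha> a) (tensor_gen k l \<beta> b) = t (E i j \<alpha> a) (E k l \<beta> b)"
  using nonabelian_bracket_eq[OF L.leibniz_superalgebra_axioms, of "tensor_gen i j \<alpha> a" "tensor_gen k l \<beta> b"]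
    submodule_carrier[OF T.hpart_sub tensor_gen_hpart[OF assms(1-4)]]
    submodule_carrier[OF T.hpart_sub tensor_gen_hpart[OF assms(5-8)]]
  by (simp add: commutator_map_tensor_gen[OF assms(1-4)] commutator_map_tensor_gen[OF assms(5-8)])

lemma tensor_gen_family: "steinberg_family R T D m n tensor_gen"
proof (intro steinberg_family.intro steinberg_family_axioms.intro T_graded)
  fix i j a \<alpha> assume ij: "i \<in> {1..m+n}" "j \<in> {1..m+n}" "i \<noteq> j" and a: "a \<in> hpart D \<alpha>"
  show "tensor_gen i j \<alpha> a \<in> hpart T (st_deg m i j \<alpha>)" by (rule tensor_gen_hpart[OF ij a])
  fix b r s assume b: "b \<in> hpart D \<alpha>" and rs: "r \<in> carrier R" "s \<in> carrier R"
  obtain k where k: "k \<in> {1..m+n}" "k \<noteq> i" "k \<noteq> j"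
    "\<And>a \<alpha>. a \<in> hpart D \<alpha> \<Longrightarrow> tensor_gen i j \<alpha> a = t (E i k \<alpha> a) (E k j 0 e)"
    using tensor_gen_obtain[OF ij] by metis
  have ik: "i \<noteq> k" using k by auto
  have c: "E k j 0 e \<in> carrier L" by (rule E_carrier[OF k(1) ij(2) k(3) D.bar_unit_even])
  note lin = bilinear_map_left[OF t_bilinear c]
  have "r \<odot>\<^bsub>D\<^esub> a \<oplus>\<^bsub>D\<^esub> s \<odot>\<^bsub>D\<^esub> b \<in> hpart D \<alpha>" by (rule D.dialgebra_linear_closed[OF a b rs])
  then show "tensor_gen i j \<alpha> (r \<odot>\<^bsub>D\<^esub> a \<oplus>\<^bsub>D\<^esub> s \<odot>\<^bsub>D\<^esub> b) = r \<odot>\<^bsub>T\<^esub> tensor_gen i j \<alpha> a \<oplus>\<^bsub>T\<^esub> s \<odot>\<^bsub>T\<^esub> tensor_gen i j \<alpha> b"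
    using E_carrier[OF ij(1) k(1) ik a] E_carrier[OF ij(1) k(1) ik b] rs a b
    by (simp add: k(4) gen_linear[OF ij(1) k(1) ik a b rs] linear_map_add[OF lin] linear_map_smult[OF lin])
next
  fix i j l a \<alpha> b \<beta>
  assume *: "i \<in> {1..m+n}" "j \<in> {1..m+n}" "l \<in> {1..m+n}" "i \<noteq> j" "j \<noteq> l" "i \<noteq> l"
    "a \<in> hpart D \<alpha>" "b \<in> hpart D \<beta>"
  obtain s where s: "s \<in> {1..m+n}" "s \<noteq> i" "s \<noteq> j" "s \<noteq> l" using fresh_index[OF rank] by metis
  have "bracket T (tensor_gen i j \<alpha> a) (tensor_gen j l \<beta> b) = t (E i j \<alpha> a) (E j l \<beta> b)"
    using * by (intro bracket_tensor_gen)
  also have "\<dots> = t (E i s (\<alpha> + \<beta>) (a \<stileturn>\<^bsub>D\<^esub> b)) (E s l 0 e)" using * s by (intro pure_gen_right)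
  also have "\<dots> = tensor_gen i l (\<alpha> + \<beta>) (a \<stileturn>\<^bsub>D\<^esub> b)" using * s by (intro tensor_gen_eq[symmetric] D.rprod_hpart)
  finally show "bracket T (tensor_gen i j \<alpha> a) (tensor_gen j l \<beta> b) = tensor_gen i l (\<alpha> + \<beta>) (a \<stileturn>\<^bsub>D\<^esub> b)" .
next
  fix i j k a \<alpha> b \<beta>
  assume *: "i \<in> {1..m+n}" "j \<in> {1..m+n}" "k \<in> {1..m+n}" "i \<noteq> j" "k \<noteq> i" "j \<noteq> k"
    "a \<in> hpart D \<alpha>" "b \<in> hpart D \<beta>"
  have "bracket T (tensor_gen i j \<alpha> a) (tensor_gen k i \<beta> b) = t (E i j \<alpha> a) (E k i \<beta> b)"
    using * by (intro bracket_tensor_gen)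
  then show "bracket T (tensor_gen i j \<alpha> a) (tensor_gen k i \<beta> b) =
    \<ominus>\<^bsub>T\<^esub> (sgn_pow R (st_deg m i j \<alpha> * st_deg m k i \<beta>) \<odot>\<^bsub>T\<^esub> tensor_gen k j (\<beta> + \<alpha>) (b \<turnstile>\<^bsub>D\<^esub> a))"
    using pure_gen_left[OF *] by simp
next
  fix i j k l a \<alpha> b \<beta>
  assume *: "i \<in> {1..m+n}" "j \<in> {1..m+n}" "k \<in> {1..m+n}" "l \<in> {1..m+n}" "i \<noteq> j" "k \<noteq> l"
      "i \<noteq> l" "j \<noteq> k" "a \<in> hpart D \<alpha>" "b \<in> hpart D \<beta>"
  have "bracket T (tensor_gen i j \<alpha> a) (tensor_gen k l \<beta> b) = t (E i j \<alpha> a) (E k l \<beta> b)"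
    using * by (intro bracket_tensor_gen)
  also have "\<dots> = \<zero>\<^bsub>T\<^esub>" using * by (intro pure_gen_zero)
  finally show "bracket T (tensor_gen i j \<alpha> a) (tensor_gen k l \<beta> b) = \<zero>\<^bsub>T\<^esub>" .
qed

end


theorem theorem3p1:
  fixes R :: "('r, 'rm) ring_scheme"
    and D :: "('r, 'd, 'dm) superdialgebra_scheme"
    and e :: 'd
    and m n :: nat
  assumes "cring R"
    and "unital_superdialgebra R D e"
    and "m + n \<ge> 5"
  shows "\<exists>f. leibniz_iso R (nonabelian_tensor R (stl R m n D)) (stl R m n D) f"
proof -
  interpret D: unital_superdialgebra R D e by fact
  let ?L = "stl R m n D"
  let ?T = "nonabelian_tensor R ?L"
  note L = D.stl_leibniz[of m n]
  interpret S: unital_steinberg_family R D e ?L m n "D.stl_gen m n"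
    by (intro unital_steinberg_family.intro unital_steinberg_family_axioms.intro
        assms(2,3) D.stl_family L)
  obtain g where g: "bracket_hom R ?L ?T g" "graded_map ?L ?T g"
    "\<And>i j \<alpha> a. \<lbrakk>i \<in> {1..m+n}; j \<in> {1..m+n}; i \<noteq> j; a \<in> hpart D \<alpha>\<rbrakk> \<Longrightarrow>
      g (D.stl_gen m n i j \<alpha> a) = S.tensor_gen i j \<alpha> a"
    using D.stl_universal[OF S.tensor_gen_family] by blast
  have gl: "linear_map R ?L ?T g" using g(1) by (simp add: bracket_hom_def)
  have hom: "bracket_hom R ?L ?L (\<lambda>x. commutator_map R ?L (g x))"
    using g(1) linear_map_comp[OF gl commutator_map_linear[OF L]] linear_map_closed[OF gl]
    by (simp add: bracket_hom_def commutator_map_bracket[OF L])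
  have id: "bracket_hom R ?L ?L (\<lambda>x. x)" by (simp add: bracket_hom_def linear_map_id)
  have "commutator_map R ?L (g x) = x" if "x \<in> carrier ?L" for x
    by (rule D.stl_hom_ext[OF S.module_axioms hom id _ that]) (simp add: g(3) S.commutator_map_tensor_gen del: atLeastAtMost_iff)
  then show ?thesis using commutator_map_iso[OF L g(1,2)] by blast
qed

end
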